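(* (1) Every closed infinite-dimensional subspace $M$ of $JT$ contains a closed subspace isomorphic to $\ell_2$ which is complemented in $JT$. (2) Every closed infinite-dimensional subspace $N$ of $JT^*$ contains a closed subspace isomorphic to $\ell_2$ which is complemented in $JT^*$.
   Context: Let $\mathcal T$ be the dyadic tree (a tree with a unique root in which every node has exactly two immediate successors). Its nodes are enumerated by $\mathbb N$ so that the tree order $\preceq$ satisfies $n\preceq m\Rightarrow n\le m$ (for instance, node $i$ of height $n$, $0\le i<2^n$, is the number $2^n+i$). A segment is a subset $s\subseteq\mathcal T$ totally ordered by $\preceq$ such that $n,m\in s$ and $n\preceq k\preceq m$ imply $k\in s$. For $x=(x(t))_{t\in\mathcal T}\in c_0$ put $\|x\|_{JT}=\sup\big(\sum_{j=1}^k(\sum_{t\in s_j}x(t))^2\big)^{1/2}$, where the supremum is over all $k\in\mathbb N$ and all pairwise disjoint finite segments $s_1,\dots,s_k$. The James tree space is $JT=\{x\in c_0:\|x\|_{JT}<\infty\}$ with this norm, and $JT^*$ is its dual. *)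

theory Defs
  imports "HOL-Analysis.Analysis"
begin

text \<open>Tree nodes are the natural numbers; node n corresponds to the number n+1 in the
  enumeration of the paper (node i of height h is 2^h + i), so the root is 0 and the
  immediate successors of node n are 2n+1 and 2n+2. The tree order: n below m iff the
  binary expansion of m+1 extends that of n+1.\<close>

definition tree_le :: "nat \<Rightarrow> nat \<Rightarrow> bool" where
  "tree_le n m \<longleftrightarrow> (\<exists>k. (m + 1) div 2 ^ k = n + 1)"

definition segment :: "nat set \<Rightarrow> bool" where
  "segment s \<longleftrightarrow> (\<forall>n\<in>s. \<forall>m\<in>s. tree_le n m \<or> tree_le m n) \<and>
                  (\<forall>n\<in>s. \<forall>m\<in>s. \<forall>k. tree_le n k \<and> tree_le k m \<longrightarrow> k \<in> s)"

definition jt_vals :: "(nat \<Rightarrow> real) \<Rightarrow> real set" where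
  "jt_vals x = {sqrt (\<Sum>s\<in>S. (\<Sum>t\<in>s. x t)\<^sup>2) | S.
      finite S \<and> (\<forall>s\<in>S. finite s \<and> segment s) \<and> disjoint S}"

definition jt_norm :: "(nat \<Rightarrow> real) \<Rightarrow> real" where
  "jt_norm x = Sup (jt_vals x)"

definition JT :: "(nat \<Rightarrow> real) set" where
  "JT = {x. x \<longlonglongrightarrow> 0 \<and> bdd_above (jt_vals x)}"

definition lin_on :: "('i \<Rightarrow> real) set \<Rightarrow> (('i \<Rightarrow> real) \<Rightarrow> ('j \<Rightarrow> real)) \<Rightarrow> bool" where
  "lin_on V f \<longleftrightarrow>
     (\<forall>x\<in>V. \<forall>y\<in>V. f (\<lambda>t. x t + y t) = (\<lambda>u. f x u + f y u)) \<and>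
     (\<forall>x\<in>V. \<forall>c. f (\<lambda>t. c * x t) = (\<lambda>u. c * f x u))"

definition lin_subspace :: "('i \<Rightarrow> real) set \<Rightarrow> bool" where
  "lin_subspace Y \<longleftrightarrow> (\<lambda>t. 0) \<in> Y \<and>
     (\<forall>x\<in>Y. \<forall>y\<in>Y. (\<lambda>t. x t + y t) \<in> Y) \<and> (\<forall>x\<in>Y. \<forall>c. (\<lambda>t. c * x t) \<in> Y)"

definition closed_subspace_in ::
    "('i \<Rightarrow> real) set \<Rightarrow> (('i \<Rightarrow> real) \<Rightarrow> real) \<Rightarrow> ('i \<Rightarrow> real) set \<Rightarrow> bool" where
  "closed_subspace_in V N Y \<longleftrightarrow> Y \<subseteq> V \<and> lin_subspace Y \<and>
     (\<forall>u x. (\<forall>n. u n \<in> Y) \<longrightarrow> x \<in> V \<longrightarrow> (\<lambda>n. N (\<lambda>t. u n t - x t)) \<longlonglongrightarrow> 0 \<longrightarrow> x \<in> Y)"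

definition infinite_dim :: "('i \<Rightarrow> real) set \<Rightarrow> bool" where
  "infinite_dim Y \<longleftrightarrow> \<not> (\<exists>B. finite B \<and>
      (\<forall>y\<in>Y. \<exists>c. y = (\<lambda>t. \<Sum>b\<in>B. c b * b t)))"

definition l2 :: "(nat \<Rightarrow> real) set" where
  "l2 = {x. summable (\<lambda>n. (x n)\<^sup>2)}"

definition l2_norm :: "(nat \<Rightarrow> real) \<Rightarrow> real" where
  "l2_norm x = sqrt (\<Sum>n. (x n)\<^sup>2)"

definition isomorphic_to_l2 :: "(('i \<Rightarrow> real) \<Rightarrow> real) \<Rightarrow> ('i \<Rightarrow> real) set \<Rightarrow> bool" where
  "isomorphic_to_l2 N Y \<longleftrightarrow> (\<exists>T. lin_on Y T \<and> bij_betw T Y l2 \<and>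
     (\<exists>c C. c > 0 \<and> (\<forall>y\<in>Y. c * N y \<le> l2_norm (T y) \<and> l2_norm (T y) \<le> C * N y)))"

definition complemented_in ::
    "('i \<Rightarrow> real) set \<Rightarrow> (('i \<Rightarrow> real) \<Rightarrow> real) \<Rightarrow> ('i \<Rightarrow> real) set \<Rightarrow> bool" where
  "complemented_in V N Y \<longleftrightarrow> (\<exists>P. lin_on V P \<and> P ` V \<subseteq> Y \<and> (\<forall>y\<in>Y. P y = y) \<and>
     (\<exists>C. \<forall>x\<in>V. N (P x) \<le> C * N x))"

text \<open>Bounded linear functionals on JT, normalised to vanish outside JT.\<close>
definition JT_dual :: "((nat \<Rightarrow> real) \<Rightarrow> real) set" where
  "JT_dual = {f. (\<forall>x\<in>JT. \<forall>y\<in>JT. f (\<lambda>t. x t + y t) = f x + f y) \<and>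
                 (\<forall>x\<in>JT. \<forall>c. f (\<lambda>t. c * x t) = c * f x) \<and>
                 (\<exists>C. \<forall>x\<in>JT. \<bar>f x\<bar> \<le> C * jt_norm x) \<and>
                 (\<forall>x. x \<notin> JT \<longrightarrow> f x = 0)}"

definition dual_norm :: "((nat \<Rightarrow> real) \<Rightarrow> real) \<Rightarrow> real" where
  "dual_norm f = Sup {\<bar>f x\<bar> | x. x \<in> JT \<and> jt_norm x \<le> 1}"

end

theory Submission
  imports Defs "HOL-Library.Diagonal_Subsequence"
begin

text \<open>
  Disjoint segments of successive blocks may be combined, so block sequences in \<open>JT\<close> have a
  lower \<open>\<ell>\<^sub>2\<close>-estimate, and block sequences of functionals an upper one. The point is an upper
  estimate in \<open>JT\<close>. Only boundedly many separated branches carry a given mass of a bounded block;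
  by compactness a block sequence whose sums along every branch tend to 0 can be thinned out so that
  every segment crossing whole blocks sees at most one of them substantially, and then the sequence
  has an upper \<open>\<ell>\<^sub>2\<close>-estimate. Every bounded block sequence has a subsequence whose sums along all
  branches converge, so that differences of consecutive terms are of this kind. Together with
  biorthogonal block functionals this settles \<open>JT\<close>.

  The values of a functional \<open>f\<close> on the unit vectors converge along each branch \<open>\<sigma>\<close>, to
  \<open>blim f \<sigma>\<close> say, and these limits are square summable over all branches. The norm of \<open>f\<close> on tails
  is asymptotically at most the \<open>\<ell>\<^sub>2\<close>-norm of \<open>blim f\<close>. Hence in a subspace of the dual either
  \<open>blim\<close> is bounded below on a subspace of finite codimension, and Gram-Schmidt orthonormalisation
  gives a complemented Hilbert space, or the subspace contains functionals close to blocks, for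
  which norming block vectors, replaced by differences, provide the projection.
\<close>

section \<open>The norm of JT and its restriction to intervals\<close>

text \<open>The obstacle is a branch along which the block sums stay away from 0: unit vectors along
  one branch add up on a single segment, so a sum of \<open>n\<close> of them has norm at least
  \<open>n\<close>. Differences of consecutive terms cancel such limits. The thresholds in the
  thinning are tied to positions: at most \<open>q\<close> disjoint nonempty segments start before
  node \<open>q\<close>, so the error tolerated at a block must be small against its left end, and
  the greedy choice of a block takes this tolerance as an input. Since there are uncountably many
  branches, convergence on all of them cannot come from diagonalising over branches; instead the
  lower estimate bounds, for each threshold, the number of branches with large sums. Everything ends
  in one factorisation: synthesis from l2 bounded by an upper estimate, analysis into l2 bounded by
  a Bessel inequality, and biorthogonality. In the block case of the dual the roles are exchanged:
  block vectors of \<open>JT\<close> act as functionals, and their upper estimate becomes the Bessel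
  inequality.\<close>

definition seg_fam :: "nat set set \<Rightarrow> bool" where
  "seg_fam S \<longleftrightarrow> finite S \<and> (\<forall>s\<in>S. finite s \<and> segment s) \<and> disjoint S"

definition seg_val :: "nat set set \<Rightarrow> (nat \<Rightarrow> real) \<Rightarrow> real" where
  "seg_val S x = (\<Sum>s\<in>S. (\<Sum>t\<in>s. x t)\<^sup>2)"

definition rst :: "nat set \<Rightarrow> (nat \<Rightarrow> real) \<Rightarrow> nat \<Rightarrow> real" where
  "rst I x = (\<lambda>t. if t \<in> I then x t else 0)"

definition order_convex :: "nat set \<Rightarrow> bool" where
  "order_convex I \<longleftrightarrow> (\<forall>n\<in>I. \<forall>m\<in>I. \<forall>k. n \<le> k \<and> k \<le> m \<longrightarrow> k \<in> I)"

lemma order_convex_intervals [simp]: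
  "order_convex {a..<b}" "order_convex {..<b}" "order_convex {a..}"
  by (auto simp: order_convex_def)

lemma tree_le_imp_le: "tree_le n m \<Longrightarrow> n \<le> m"
  unfolding tree_le_def using div_le_dividend[of "m + 1"] by (metis add_le_cancel_right)

lemma tree_le_refl [simp]: "tree_le n n"
  unfolding tree_le_def by (rule exI[of _ 0]) simp

lemma segment_singleton [simp]: "segment {t}"
  unfolding segment_def using tree_le_imp_le by (auto intro: le_antisym)

text \<open>The numbering extends the tree order, so a node that lies between two others in the tree
  also lies between them as a number. This is why cutting at intervals of numbers is compatible with
  segments.\<close>

lemma segment_Int_convex:
  assumes "segment s" "order_convex I"
  shows "segment (s \<inter> I)"
  unfolding segment_def
proof (intro conjI ballI allI impI)
  fix n m assume "n \<in> s \<inter> I" "m \<in> s \<inter> I"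
  then show "tree_le n m \<or> tree_le m n" using assms(1) by (auto simp: segment_def)
next
  fix n m k assume *: "n \<in> s \<inter> I" "m \<in> s \<inter> I" "tree_le n k \<and> tree_le k m"
  then have "k \<in> s" using assms(1) unfolding segment_def by blast
  moreover have "n \<le> k" "k \<le> m" using * tree_le_imp_le by auto
  ultimately show "k \<in> s \<inter> I" using assms(2) * unfolding order_convex_def by blast
qed

lemma seg_val_nonneg: "0 \<le> seg_val S x"
  by (simp add: seg_val_def sum_nonneg)

lemma jt_vals_alt: "jt_vals x = {sqrt (seg_val S x) | S. seg_fam S}"
  by (simp add: jt_vals_def seg_val_def seg_fam_def)

lemma seg_fam_empty [simp]: "seg_fam {}"
  by (simp add: seg_fam_def disjoint_def)

lemma seg_val_le_norm:
  assumes "x \<in> JT" "seg_fam S"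
  shows "seg_val S x \<le> (jt_norm x)\<^sup>2"
proof -
  have "sqrt (seg_val S x) \<le> jt_norm x"
    unfolding jt_norm_def using assms by (intro cSup_upper) (auto simp: JT_def jt_vals_alt)
  then have "(sqrt (seg_val S x))\<^sup>2 \<le> (jt_norm x)\<^sup>2"
    by (intro power_mono) (auto simp: seg_val_nonneg)
  then show ?thesis by (simp add: seg_val_nonneg)
qed

lemma jt_norm_nonneg: assumes "x \<in> JT" shows "0 \<le> jt_norm x"
proof -
  have "sqrt (seg_val {} x) \<le> jt_norm x"
    unfolding jt_norm_def using assms
    by (intro cSup_upper) (auto simp: JT_def jt_vals_alt intro!: exI[of _ "{}"])
  then show ?thesis by (simp add: seg_val_def)
qed

text \<open>The norm is defined by sets of segments, while the arguments below produce indexed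
  families. A disjoint family can repeat only the empty set, so dropping empty members makes the
  indexing injective without changing the sum.\<close>

lemma seg_fam_of_family:
  assumes "finite J" "disjoint_family_on s J" "\<And>j. j \<in> J \<Longrightarrow> finite (s j) \<and> segment (s j)"
  shows "\<exists>S. seg_fam S \<and> (\<forall>x. (\<Sum>j\<in>J. (\<Sum>t\<in>s j. x t)\<^sup>2) = seg_val S x)"
proof (intro exI conjI allI)
  let ?J = "{j \<in> J. s j \<noteq> {}}"
  have inj: "inj_on s ?J"
    using assms(2) unfolding inj_on_def disjoint_family_on_def by fastforce
  show "seg_fam (s ` ?J)"
    unfolding seg_fam_def disjoint_def
  proof (intro conjI ballI impI)
    fix a b assume "a \<in> s ` ?J" "b \<in> s ` ?J" "a \<noteq> b"
    then obtain i j where "i \<in> J" "j \<in> J" "a = s i" "b = s j" "i \<noteq> j" by blast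
    then show "a \<inter> b = {}" using assms(2) by (simp add: disjoint_family_on_def)
  qed (use assms in auto)
  fix x :: "nat \<Rightarrow> real"
  have "(\<Sum>j\<in>J. (\<Sum>t\<in>s j. x t)\<^sup>2) = (\<Sum>j\<in>?J. (\<Sum>t\<in>s j. x t)\<^sup>2)"
    using assms(1) by (intro sum.mono_neutral_right) auto
  also have "\<dots> = seg_val (s ` ?J) x"
    unfolding seg_val_def using inj by (simp add: sum.reindex)
  finally show "(\<Sum>j\<in>J. (\<Sum>t\<in>s j. x t)\<^sup>2) = seg_val (s ` ?J) x" .
qed

lemma sum_family_le_norm:
  assumes "x \<in> JT" "finite J" "disjoint_family_on s J"
    "\<And>j. j \<in> J \<Longrightarrow> finite (s j) \<and> segment (s j)"
  shows "(\<Sum>j\<in>J. (\<Sum>t\<in>s j. x t)\<^sup>2) \<le> (jt_norm x)\<^sup>2"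
proof -
  obtain S where "seg_fam S" "\<forall>x. (\<Sum>j\<in>J. (\<Sum>t\<in>s j. x t)\<^sup>2) = seg_val S x"
    using seg_fam_of_family[OF assms(2-4)] by blast
  then show ?thesis using seg_val_le_norm[OF assms(1)] by simp
qed

text \<open>Membership in \<open>JT\<close> also asks for convergence to 0; single nodes are
  disjoint segments, so the bound makes the coordinates square summable.\<close>

lemma JT_I:
  assumes "\<And>S. seg_fam S \<Longrightarrow> seg_val S x \<le> C\<^sup>2" "0 \<le> C"
  shows "x \<in> JT" "jt_norm x \<le> C"
proof -
  have le: "v \<le> C" if "v \<in> jt_vals x" for v
    using that assms by (auto simp: jt_vals_alt real_le_lsqrt seg_val_nonneg)
  then have bdd: "bdd_above (jt_vals x)" by (rule bdd_aboveI)
  have "(\<Sum>t<n. (x t)\<^sup>2) \<le> C\<^sup>2" for n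
  proof -
    obtain S where "seg_fam S" "\<forall>x. (\<Sum>j\<in>{..<n}. (\<Sum>t\<in>{j}. x t)\<^sup>2) = seg_val S x"
      using seg_fam_of_family[of "{..<n}" "\<lambda>j. {j}"] by (auto simp: disjoint_family_on_def)
    then show ?thesis using assms(1) by simp
  qed
  then have "summable (\<lambda>t. (x t)\<^sup>2)"
    by (intro summableI_nonneg_bounded) auto
  then have "(\<lambda>t. (x t)\<^sup>2) \<longlonglongrightarrow> 0" by (rule summable_LIMSEQ_zero)
  then have "(\<lambda>t. \<bar>x t\<bar>) \<longlonglongrightarrow> 0" using tendsto_real_sqrt by fastforce
  then have "x \<longlonglongrightarrow> 0" by (rule tendsto_rabs_zero_cancel)
  then show "x \<in> JT" using bdd by (simp add: JT_def)
  have "jt_vals x \<noteq> {}" using seg_fam_empty by (auto simp: jt_vals_alt intro: exI[of _ "{}"])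
  then show "jt_norm x \<le> C" unfolding jt_norm_def using le by (rule cSup_least)
qed

lemma seg_val_L2: "seg_val S x = (L2_set (\<lambda>s. \<Sum>t\<in>s. x t) S)\<^sup>2"
  by (simp add: seg_val_def L2_set_def sum_nonneg)

lemma L2_set_le_norm:
  assumes "x \<in> JT" "seg_fam S"
  shows "L2_set (\<lambda>s. \<Sum>t\<in>s. x t) S \<le> jt_norm x"
  using seg_val_le_norm[OF assms] jt_norm_nonneg[OF assms(1)] unfolding seg_val_L2
  by (rule power2_le_imp_le)

lemma JT_add:
  assumes "x \<in> JT" "y \<in> JT"
  shows "(\<lambda>t. x t + y t) \<in> JT" "jt_norm (\<lambda>t. x t + y t) \<le> jt_norm x + jt_norm y"
proof -
  have *: "seg_val S (\<lambda>t. x t + y t) \<le> (jt_norm x + jt_norm y)\<^sup>2" if "seg_fam S" for S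
  proof -
    have "L2_set (\<lambda>s. \<Sum>t\<in>s. x t + y t) S
        \<le> L2_set (\<lambda>s. \<Sum>t\<in>s. x t) S + L2_set (\<lambda>s. \<Sum>t\<in>s. y t) S"
      by (simp add: sum.distrib L2_set_triangle_ineq)
    also have "\<dots> \<le> jt_norm x + jt_norm y"
      using that assms by (intro add_mono L2_set_le_norm)
    finally show ?thesis unfolding seg_val_L2 by (intro power_mono) auto
  qed
  have "0 \<le> jt_norm x + jt_norm y" using assms jt_norm_nonneg by fastforce
  from JT_I[OF * this]
  show "(\<lambda>t. x t + y t) \<in> JT" "jt_norm (\<lambda>t. x t + y t) \<le> jt_norm x + jt_norm y" by auto
qed

lemma seg_val_scale: "seg_val S (\<lambda>t. c * x t) = c\<^sup>2 * seg_val S x"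
  by (simp add: seg_val_def sum_distrib_left[symmetric] power_mult_distrib)

lemma JT_scale_le:
  assumes "x \<in> JT"
  shows "(\<lambda>t. c * x t) \<in> JT" "jt_norm (\<lambda>t. c * x t) \<le> \<bar>c\<bar> * jt_norm x"
proof -
  have *: "seg_val S (\<lambda>t. c * x t) \<le> (\<bar>c\<bar> * jt_norm x)\<^sup>2" if "seg_fam S" for S
    using seg_val_le_norm[OF assms that]
    by (simp add: seg_val_scale power_mult_distrib mult_left_mono)
  have "0 \<le> \<bar>c\<bar> * jt_norm x" using assms jt_norm_nonneg by fastforce
  from JT_I[OF * this]
  show "(\<lambda>t. c * x t) \<in> JT" "jt_norm (\<lambda>t. c * x t) \<le> \<bar>c\<bar> * jt_norm x" by auto
qed

lemma JT_zero: "(\<lambda>t. 0) \<in> JT" "jt_norm (\<lambda>t. 0) = 0"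
proof -
  have "seg_val S (\<lambda>t. 0) \<le> 0\<^sup>2" for S by (simp add: seg_val_def)
  from JT_I[OF this] show "(\<lambda>t. 0) \<in> JT" "jt_norm (\<lambda>t. 0) = 0"
    using jt_norm_nonneg by fastforce+
qed

lemma JT_scale:
  assumes "x \<in> JT"
  shows "jt_norm (\<lambda>t. c * x t) = \<bar>c\<bar> * jt_norm x"
proof (cases "c = 0")
  case False
  have "jt_norm (\<lambda>t. inverse c * (c * x t)) \<le> \<bar>inverse c\<bar> * jt_norm (\<lambda>t. c * x t)"
    by (rule JT_scale_le(2)[OF JT_scale_le(1)[OF assms]])
  then have "\<bar>c\<bar> * jt_norm x \<le> jt_norm (\<lambda>t. c * x t)"
    using False by (simp add: mult.assoc[symmetric] field_simps)
  then show ?thesis using JT_scale_le(2)[OF assms, of c] by simp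
qed (use JT_zero in simp)

lemma abs_le_jt_norm:
  assumes "x \<in> JT" shows "\<bar>x t\<bar> \<le> jt_norm x"
proof -
  have "seg_val {{t}} x \<le> (jt_norm x)\<^sup>2"
    using assms by (intro seg_val_le_norm) (auto simp: seg_fam_def)
  then have "(x t)\<^sup>2 \<le> (jt_norm x)\<^sup>2" by (simp add: seg_val_def)
  then show ?thesis using jt_norm_nonneg[OF assms] by (metis abs_le_square_iff abs_of_nonneg)
qed

lemma seg_val_approx:
  assumes "x \<in> JT" "0 < e"
  shows "\<exists>S. seg_fam S \<and> (jt_norm x)\<^sup>2 - e < seg_val S x"
proof (rule ccontr)
  assume "\<not> ?thesis"
  then have le: "seg_val S x \<le> (jt_norm x)\<^sup>2 - e" if "seg_fam S" for S using that by force
  have pos: "0 \<le> (jt_norm x)\<^sup>2 - e" using le[OF seg_fam_empty] by (simp add: seg_val_def)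
  have "jt_norm x \<le> sqrt ((jt_norm x)\<^sup>2 - e)"
    using le pos by (intro JT_I(2)) auto
  also have "\<dots> < sqrt ((jt_norm x)\<^sup>2)" using assms(2) by (intro real_sqrt_less_mono) auto
  finally show False using jt_norm_nonneg[OF assms(1)] by simp
qed

lemma sum_rst: "finite s \<Longrightarrow> (\<Sum>t\<in>s. rst I x t) = (\<Sum>t\<in>s \<inter> I. x t)"
  by (simp add: rst_def sum.inter_restrict)

lemma JT_rst:
  assumes "x \<in> JT" "order_convex I"
  shows "rst I x \<in> JT" "jt_norm (rst I x) \<le> jt_norm x"
proof -
  have *: "seg_val S (rst I x) \<le> (jt_norm x)\<^sup>2" if S: "seg_fam S" for S
  proof -
    have "seg_val S (rst I x) = (\<Sum>s\<in>S. (\<Sum>t\<in>s \<inter> I. x t)\<^sup>2)"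
      unfolding seg_val_def using S by (intro sum.cong) (auto simp: seg_fam_def sum_rst)
    also have "\<dots> \<le> (jt_norm x)\<^sup>2"
      using S assms
      by (intro sum_family_le_norm)
         (auto simp: seg_fam_def disjoint_family_on_def disjoint_def segment_Int_convex)
    finally show ?thesis .
  qed
  from JT_I[OF * jt_norm_nonneg[OF assms(1)]]
  show "rst I x \<in> JT" "jt_norm (rst I x) \<le> jt_norm x" by auto
qed

text \<open>The lower l2-estimate. Nearly optimal families for the pieces, each cut down to its own
  piece, together form one disjoint family for \<open>x\<close>.\<close>

lemma sum_norm_rst_le:
  assumes x: "x \<in> JT" and J: "finite J" "\<And>j. j \<in> J \<Longrightarrow> order_convex (I j)"
    "disjoint_family_on I J"
  shows "(\<Sum>j\<in>J. (jt_norm (rst (I j) x))\<^sup>2) \<le> (jt_norm x)\<^sup>2"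
proof (rule field_le_epsilon)
  fix e :: real assume e: "0 < e"
  \<comment> \<open>The tolerance \<open>e\<close> is shared among the pieces; the added 1 covers an
    empty \<open>J\<close>.\<close>
  define d where "d = e / (real (card J) + 1)"
  have d: "0 < d" using e by (simp add: d_def)
  have "\<forall>j\<in>J. \<exists>S. seg_fam S \<and> (jt_norm (rst (I j) x))\<^sup>2 - d < seg_val S (rst (I j) x)"
    using seg_val_approx[OF JT_rst(1)[OF x] d] J by blast
  then obtain S where S: "\<And>j. j \<in> J \<Longrightarrow> seg_fam (S j)"
    "\<And>j. j \<in> J \<Longrightarrow> (jt_norm (rst (I j) x))\<^sup>2 - d < seg_val (S j) (rst (I j) x)"
    by metis
  let ?P = "Sigma J S" and ?s = "\<lambda>(j, s). s \<inter> I j"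
  have fin: "finite (S j)" if "j \<in> J" for j using S(1)[OF that] by (simp add: seg_fam_def)
  have val: "seg_val (S j) (rst (I j) x) = (\<Sum>s\<in>S j. (\<Sum>t\<in>s \<inter> I j. x t)\<^sup>2)" if "j \<in> J" for j
    unfolding seg_val_def using S(1)[OF that]
    by (intro sum.cong) (auto simp: seg_fam_def sum_rst)
  have "(\<Sum>j\<in>J. (jt_norm (rst (I j) x))\<^sup>2) \<le> (\<Sum>j\<in>J. seg_val (S j) (rst (I j) x) + d)"
    using S(2) by (intro sum_mono) force
  also have "\<dots> = (\<Sum>j\<in>J. \<Sum>s\<in>S j. (\<Sum>t\<in>s \<inter> I j. x t)\<^sup>2) + real (card J) * d"
    using val by (simp add: sum.distrib)
  also have "(\<Sum>j\<in>J. \<Sum>s\<in>S j. (\<Sum>t\<in>s \<inter> I j. x t)\<^sup>2) = (\<Sum>p\<in>?P. (\<Sum>t\<in>?s p. x t)\<^sup>2)"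
    using J(1) fin by (subst sum.Sigma) (auto simp: split_beta)
  also have "\<dots> \<le> (jt_norm x)\<^sup>2"
  proof (rule sum_family_le_norm[OF x])
    show "finite ?P" using J(1) fin by auto
    have "?s p \<inter> ?s q = {}" if "p \<in> ?P" "q \<in> ?P" "p \<noteq> q" for p q
    proof (cases "fst p = fst q")
      case True
      then have "snd p \<noteq> snd q" using that(3) by (simp add: prod_eq_iff)
      then have "snd p \<inter> snd q = {}"
        using that True S(1)[of "fst q"] unfolding seg_fam_def disjoint_def
        by (metis (no_types, lifting) mem_Sigma_iff prod.collapse)
      then show ?thesis by (auto simp: split_beta)
    next
      case False
      then have "I (fst p) \<inter> I (fst q) = {}"
        using that J(3) unfolding disjoint_family_on_def
        by (metis (no_types, lifting) mem_Sigma_iff prod.collapse)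
      then show ?thesis by (auto simp: split_beta)
    qed
    then show "disjoint_family_on ?s ?P" unfolding disjoint_family_on_def by blast
    fix p assume "p \<in> ?P"
    then show "finite (?s p) \<and> segment (?s p)"
      using S(1)[of "fst p"] J(2)[of "fst p"] by (auto simp: seg_fam_def segment_Int_convex)
  qed
  also have "real (card J) * d \<le> e" using e by (simp add: d_def field_simps)
  finally show "(\<Sum>j\<in>J. (jt_norm (rst (I j) x))\<^sup>2) \<le> (jt_norm x)\<^sup>2 + e" by simp
qed

text \<open>A nearly norming family is finite, hence contained in some \<open>{..<p}\<close>. It
  already uses up all but \<open>e\<^sup>2\<close> of the squared norm, and the lower l2-estimate
  for two pieces leaves at most this much for the tail.\<close>

lemma JT_tail:
  assumes x: "x \<in> JT" and e: "0 < e"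
  shows "\<exists>p. \<forall>q\<ge>p. jt_norm (rst {q..} x) \<le> e"
proof -
  obtain S where S: "seg_fam S" "(jt_norm x)\<^sup>2 - e\<^sup>2 < seg_val S x"
    using seg_val_approx[OF x, of "e\<^sup>2"] e by force
  have "finite (\<Union>S)" using S(1) by (auto simp: seg_fam_def)
  then obtain p where p: "\<Union>S \<subseteq> {..<p}" using finite_nat_iff_bounded by auto
  have "jt_norm (rst {q..} x) \<le> e" if "p \<le> q" for q
  proof -
    have sub: "s \<inter> {..<q} = s" if "s \<in> S" for s
    proof -
      have "s \<subseteq> {..<p}" using p that by blast
      also have "\<dots> \<subseteq> {..<q}" using \<open>p \<le> q\<close> by simp
      finally show ?thesis by blast
    qed
    have "seg_val S x = seg_val S (rst {..<q} x)"
      unfolding seg_val_def using S(1)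
      by (intro sum.cong refl) (simp add: seg_fam_def sum_rst sub)
    also have "\<dots> \<le> (jt_norm (rst {..<q} x))\<^sup>2"
      using x S(1) by (intro seg_val_le_norm JT_rst) simp_all
    finally have 1: "(jt_norm x)\<^sup>2 - e\<^sup>2 < (jt_norm (rst {..<q} x))\<^sup>2" using S(2) by simp
    have "disjoint_family_on (\<lambda>j. if j then {..<q} else {q..}) {False, True}"
      unfolding disjoint_family_on_def by auto
    then have "(\<Sum>j\<in>{False,True}. (jt_norm (rst (if j then {..<q} else {q..}) x))\<^sup>2) \<le> (jt_norm x)\<^sup>2"
      using x by (intro sum_norm_rst_le) simp_all
    then have "(jt_norm (rst {..<q} x))\<^sup>2 + (jt_norm (rst {q..} x))\<^sup>2 \<le> (jt_norm x)\<^sup>2"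
      by simp
    then have "(jt_norm (rst {q..} x))\<^sup>2 \<le> e\<^sup>2" using 1 by linarith
    then show ?thesis using e by (auto intro: power2_le_imp_le)
  qed
  then show ?thesis by blast
qed

section \<open>Complemented copies of l2 from biorthogonal sequences\<close>

lemma lin_subspace_add: "lin_subspace V \<Longrightarrow> x \<in> V \<Longrightarrow> y \<in> V \<Longrightarrow> (\<lambda>t. x t + y t) \<in> V"
  and lin_subspace_scale: "lin_subspace V \<Longrightarrow> x \<in> V \<Longrightarrow> (\<lambda>t. c * x t) \<in> V"
  and lin_subspace_zero: "lin_subspace V \<Longrightarrow> (\<lambda>t. 0) \<in> V"
  by (auto simp: lin_subspace_def)

lemma lin_subspace_diff:
  assumes "lin_subspace V" "x \<in> V" "y \<in> V" shows "(\<lambda>t. x t - y t) \<in> V"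
  using lin_subspace_add[OF assms(1,2) lin_subspace_scale[OF assms(1,3), of "-1"]] by simp

lemma lin_subspace_sum:
  assumes "lin_subspace V" "finite A" "\<And>k. k \<in> A \<Longrightarrow> z k \<in> V"
  shows "(\<lambda>t. \<Sum>k\<in>A. c k * z k t) \<in> V"
  using assms(2,3)
proof (induction A rule: finite_induct)
  case (insert k A)
  then show ?case
    using lin_subspace_add[OF assms(1) lin_subspace_scale[OF assms(1), of "z k" "c k"]] by simp
qed (use lin_subspace_zero[OF assms(1)] in simp)

definition linf_on :: "('i \<Rightarrow> real) set \<Rightarrow> (('i \<Rightarrow> real) \<Rightarrow> real) \<Rightarrow> bool" where
  "linf_on V f \<longleftrightarrow> (\<forall>x\<in>V. \<forall>y\<in>V. f (\<lambda>t. x t + y t) = f x + f y) \<and>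
                  (\<forall>x\<in>V. \<forall>c. f (\<lambda>t. c * x t) = c * f x)"

lemma linf_on_add: "linf_on V f \<Longrightarrow> x \<in> V \<Longrightarrow> y \<in> V \<Longrightarrow> f (\<lambda>t. x t + y t) = f x + f y"
  and linf_on_scale: "linf_on V f \<Longrightarrow> x \<in> V \<Longrightarrow> f (\<lambda>t. c * x t) = c * f x"
  by (auto simp: linf_on_def)

lemma linf_on_subset: "linf_on V f \<Longrightarrow> W \<subseteq> V \<Longrightarrow> linf_on W f"
  unfolding linf_on_def by blast

lemma linf_on_zero: "linf_on V f \<Longrightarrow> x \<in> V \<Longrightarrow> f (\<lambda>t. 0) = 0"
  using linf_on_scale[of V f x 0] by simp

lemma linf_on_diff:
  assumes "lin_subspace V" "linf_on V f" "x \<in> V" "y \<in> V"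
  shows "f (\<lambda>t. x t - y t) = f x - f y"
  using linf_on_add[OF assms(2,3) lin_subspace_scale[OF assms(1,4), of "-1"]]
    linf_on_scale[OF assms(2,4), of "-1"] by simp

lemma linf_on_sum:
  assumes "lin_subspace V" "linf_on V f" "finite A" "\<And>k. k \<in> A \<Longrightarrow> z k \<in> V"
  shows "f (\<lambda>t. \<Sum>k\<in>A. c k * z k t) = (\<Sum>k\<in>A. c k * f (z k))"
  using assms(3,4)
proof (induction A rule: finite_induct)
  case (insert k A)
  have "f (\<lambda>t. c k * z k t + (\<Sum>k\<in>A. c k * z k t)) = c k * f (z k) + f (\<lambda>t. \<Sum>k\<in>A. c k * z k t)"
    using insert assms
    by (subst linf_on_add[OF assms(2)])
       (auto intro!: lin_subspace_scale lin_subspace_sum simp: linf_on_scale[OF assms(2)])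
  then show ?case using insert by simp
qed (use linf_on_zero[OF assms(2) lin_subspace_zero[OF assms(1)]] in simp)

lemma infinite_dim_nonzero:
  assumes "infinite_dim M" shows "\<exists>x\<in>M. x \<noteq> (\<lambda>t. 0)"
proof (rule ccontr)
  assume "\<not> ?thesis"
  then have "\<forall>y\<in>M. \<exists>c. y = (\<lambda>t. \<Sum>b\<in>{}. c b * b t)" by simp
  then show False using assms unfolding infinite_dim_def by (meson finite.emptyI)
qed

text \<open>A finite spanning set of the kernel together with one vector outside it would span
  \<open>M\<close>.\<close>

lemma infinite_dim_kernel:
  assumes M: "lin_subspace M" "infinite_dim M" and f: "linf_on M f"
  shows "lin_subspace {x\<in>M. f x = 0}" "infinite_dim {x\<in>M. f x = 0}"
proof -
  show "lin_subspace {x\<in>M. f x = 0}"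
    using M(1) f linf_on_zero[OF f] unfolding lin_subspace_def linf_on_def by auto
  show "infinite_dim {x\<in>M. f x = 0}"
  proof (rule ccontr)
    assume "\<not> ?thesis"
    then obtain B where B: "finite B" "\<And>y. y \<in> M \<Longrightarrow> f y = 0 \<Longrightarrow> \<exists>c. y = (\<lambda>t. \<Sum>b\<in>B. c b * b t)"
      unfolding infinite_dim_def by auto
    obtain x0 where x0: "x0 \<in> M" "f x0 \<noteq> 0"
      using B M(2) unfolding infinite_dim_def by meson
    have "\<exists>c. y = (\<lambda>t. \<Sum>b\<in>insert x0 B. c b * b t)" if y: "y \<in> M" for y
    proof -
      let ?r = "f y / f x0"
      have in_M: "(\<lambda>t. ?r * x0 t) \<in> M" by (rule lin_subspace_scale[OF M(1) x0(1)])
      have "f (\<lambda>t. y t - ?r * x0 t) = 0"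
        using linf_on_diff[OF M(1) f y in_M] linf_on_scale[OF f x0(1), of ?r] x0(2) by simp
      then obtain c where c: "(\<lambda>t. y t - ?r * x0 t) = (\<lambda>t. \<Sum>b\<in>B. c b * b t)"
        using B(2)[OF lin_subspace_diff[OF M(1) y in_M]] by blast
      \<comment> \<open>The vector \<open>x0\<close> may itself lie in \<open>B\<close>, so the two
        contributions to its coefficient are added.\<close>
      let ?c = "\<lambda>b. (if b \<in> B then c b else 0) + (if b = x0 then ?r else 0)"
      have "y t = (\<Sum>b\<in>insert x0 B. ?c b * b t)" for t
      proof -
        have "(\<Sum>b\<in>insert x0 B. ?c b * b t) = (\<Sum>b\<in>insert x0 B. (if b \<in> B then c b * b t else 0))
            + (\<Sum>b\<in>insert x0 B. (if b = x0 then ?r * b t else 0))"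
          unfolding sum.distrib[symmetric] by (intro sum.cong) (auto simp: distrib_right)
        also have "(\<Sum>b\<in>insert x0 B. (if b \<in> B then c b * b t else 0)) = (\<Sum>b\<in>B. c b * b t)"
          using B(1) by (intro sum.mono_neutral_cong_right) auto
        also have "(\<Sum>b\<in>insert x0 B. (if b = x0 then ?r * b t else 0)) = ?r * x0 t"
          using B(1) by (subst sum.delta) auto
        finally show ?thesis using fun_cong[OF c, of t] by simp
      qed
      then show ?thesis by (intro exI[of _ ?c] ext)
    qed
    then have "\<forall>y\<in>M. \<exists>c. y = (\<lambda>t. \<Sum>b\<in>insert x0 B. c b * b t)" by blast
    then show False using M(2) B(1) unfolding infinite_dim_def by (meson finite_insert)
  qed
qed

lemma infinite_dim_kernels:
  assumes M: "lin_subspace M" "infinite_dim M" and "finite F" "\<And>f. f \<in> F \<Longrightarrow> linf_on M f"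
  shows "lin_subspace {x\<in>M. \<forall>f\<in>F. f x = 0} \<and> infinite_dim {x\<in>M. \<forall>f\<in>F. f x = 0}"
  using assms(3,4)
proof (induction F rule: finite_induct)
  case (insert f F)
  let ?K = "{x\<in>M. \<forall>f\<in>F. f x = 0}"
  have "linf_on M f" using insert.prems by simp
  then have "linf_on ?K f" by (rule linf_on_subset) blast
  moreover have "lin_subspace ?K" "infinite_dim ?K" using insert.IH insert.prems by simp_all
  ultimately have "lin_subspace {x\<in>?K. f x = 0} \<and> infinite_dim {x\<in>?K. f x = 0}"
    using infinite_dim_kernel[of ?K f] by simp
  moreover have "{x\<in>?K. f x = 0} = {x\<in>M. \<forall>f\<in>insert f F. f x = 0}" by blast
  ultimately show ?case by simp
qed (use M in simp)

section \<open>Upper l2-estimates and biorthogonalisation\<close>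

definition upper2 :: "(('i \<Rightarrow> real) \<Rightarrow> real) \<Rightarrow> (nat \<Rightarrow> 'i \<Rightarrow> real) \<Rightarrow> real \<Rightarrow> bool" where
  "upper2 N z C \<longleftrightarrow> 0 \<le> C \<and>
     (\<forall>n c. N (\<lambda>t. \<Sum>k<n. c k * z k t) \<le> C * sqrt (\<Sum>k<n. (c k)\<^sup>2))"

lemma upper2D: "upper2 N z C \<Longrightarrow> N (\<lambda>t. \<Sum>k<n. c k * z k t) \<le> C * sqrt (\<Sum>k<n. (c k)\<^sup>2)"
  by (simp add: upper2_def)

lemma upper2_scale:
  assumes "upper2 N z C" and "\<And>k. \<bar>s k\<bar> \<le> B" "0 \<le> B"
  shows "upper2 N (\<lambda>k t. s k * z k t) (C * B)"
  unfolding upper2_def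
proof (intro conjI allI)
  have C: "0 \<le> C" using assms(1) by (simp add: upper2_def)
  then show "0 \<le> C * B" using assms(3) by simp
  fix n and c :: "nat \<Rightarrow> real"
  have "N (\<lambda>t. \<Sum>k<n. (c k * s k) * z k t) \<le> C * sqrt (\<Sum>k<n. (c k * s k)\<^sup>2)"
    by (rule upper2D[OF assms(1)])
  also have "\<dots> \<le> C * sqrt (\<Sum>k<n. B\<^sup>2 * (c k)\<^sup>2)"
  proof (intro mult_left_mono C real_sqrt_le_mono sum_mono)
    fix k
    have "(s k)\<^sup>2 \<le> B\<^sup>2" using assms(2)[of k] assms(3) abs_le_square_iff[of "s k" B] by simp
    then show "(c k * s k)\<^sup>2 \<le> B\<^sup>2 * (c k)\<^sup>2"
      by (simp add: power_mult_distrib mult.commute[of "(c k)\<^sup>2"] mult_right_mono)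
  qed
  also have "\<dots> = C * B * sqrt (\<Sum>k<n. (c k)\<^sup>2)"
    using assms(3) by (simp add: sum_distrib_left[symmetric] real_sqrt_mult)
  finally show "N (\<lambda>t. \<Sum>k<n. c k * (s k * z k t)) \<le> C * B * sqrt (\<Sum>k<n. (c k)\<^sup>2)"
    by (simp add: mult.assoc)
qed

lemma upper2_subseq:
  assumes "upper2 N z C" "strict_mono (r :: nat \<Rightarrow> nat)"
  shows "upper2 N (z \<circ> r) C"
  unfolding upper2_def
proof (intro conjI allI)
  show "0 \<le> C" using assms(1) by (simp add: upper2_def)
  fix n and c :: "nat \<Rightarrow> real"
  \<comment> \<open>The coefficients are spread over the range of \<open>r\<close> and padded by 0,
    so the estimate for the whole sequence applies up to index \<open>r n\<close>.\<close>
  define d where "d j = (if j \<in> range r then c (the_inv r j) else 0)" for j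
  have inj: "inj r" using assms(2) by (rule strict_mono_imp_inj_on)
  have d: "d (r k) = c k" for k by (simp add: d_def the_inv_f_f[OF inj])
  have *: "(\<Sum>j<r n. f j) = (\<Sum>k<n. f (r k))" if "\<And>j. j \<notin> range r \<Longrightarrow> f j = 0" for f :: "nat \<Rightarrow> real"
  proof -
    have "(\<Sum>j<r n. f j) = (\<Sum>j\<in>r ` {..<n}. f j)"
    proof (rule sum.mono_neutral_right)
      show "\<forall>i\<in>{..<r n} - r ` {..<n}. f i = 0"
        using that assms(2) by (force simp: strict_mono_less)
    qed (use assms(2) in \<open>auto simp: strict_mono_less\<close>)
    also have "\<dots> = (\<Sum>k<n. f (r k))"
      using inj by (simp add: sum.reindex inj_on_subset)
    finally show ?thesis .
  qed
  have "N (\<lambda>t. \<Sum>j<r n. d j * z j t) \<le> C * sqrt (\<Sum>j<r n. (d j)\<^sup>2)"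
    by (rule upper2D[OF assms(1)])
  also have "(\<lambda>t. \<Sum>j<r n. d j * z j t) = (\<lambda>t. \<Sum>k<n. c k * z (r k) t)"
    by (rule ext, subst *) (auto simp: d, auto simp: d_def)
  also have "(\<Sum>j<r n. (d j)\<^sup>2) = (\<Sum>k<n. (c k)\<^sup>2)"
    by (subst *) (auto simp: d, auto simp: d_def)
  finally show "N (\<lambda>t. \<Sum>k<n. c k * (z \<circ> r) k t) \<le> C * sqrt (\<Sum>k<n. (c k)\<^sup>2)" by simp
qed

text \<open>Forward substitution: when the matrix of the values \<open>g k (z j)\<close> is lower
  triangular with unit diagonal, this applies its inverse to the functionals.\<close>

fun biorth :: "(nat \<Rightarrow> 'a \<Rightarrow> real) \<Rightarrow> (nat \<Rightarrow> 'a) \<Rightarrow> nat \<Rightarrow> 'a \<Rightarrow> real" where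
  "biorth g z k x = g k x - (\<Sum>j<k. g k (z j) * biorth g z j x)"

declare biorth.simps [simp del]

lemma biorth_eq:
  assumes diag: "\<And>k. g k (z k) = 1" and above: "\<And>k j. k < j \<Longrightarrow> g k (z j) = 0"
  shows "biorth g z k (z j) = (if j = k then 1 else 0)"
proof (induction k rule: less_induct)
  case (less k)
  have "biorth g z k (z j) = g k (z j) - (\<Sum>i<k. g k (z i) * (if j = i then 1 else 0))"
    unfolding biorth.simps[of g z k] using less by simp
  also have "(\<Sum>i<k. g k (z i) * (if j = i then 1 else 0)) = (\<Sum>i<k. if i = j then g k (z i) else 0)"
    by (intro sum.cong) auto
  also have "\<dots> = (if j < k then g k (z j) else 0)" by simp
  finally show ?case using diag[of k] above[of k j] by (cases j k rule: linorder_cases) auto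
qed

lemma biorth_linf:
  assumes "\<And>k. linf_on V (g k)" shows "linf_on V (biorth g z k)"
proof (induction k rule: less_induct)
  case (less k)
  show ?case
    unfolding linf_on_def
  proof (intro conjI ballI allI)
    fix x y assume xy: "x \<in> V" "y \<in> V"
    have "(\<Sum>j<k. g k (z j) * biorth g z j (\<lambda>t. x t + y t))
        = (\<Sum>j<k. g k (z j) * biorth g z j x) + (\<Sum>j<k. g k (z j) * biorth g z j y)"
      unfolding sum.distrib[symmetric] using linf_on_add[OF less xy]
      by (intro sum.cong) (auto simp: distrib_left)
    then show "biorth g z k (\<lambda>t. x t + y t) = biorth g z k x + biorth g z k y"
      unfolding biorth.simps[of g z k] using linf_on_add[OF assms xy] by simp
  next
    fix x c assume x: "x \<in> V"
    have "(\<Sum>j<k. g k (z j) * biorth g z j (\<lambda>t. c * x t)) = c * (\<Sum>j<k. g k (z j) * biorth g z j x)"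
      unfolding sum_distrib_left using linf_on_scale[OF less x] by (intro sum.cong) auto
    then show "biorth g z k (\<lambda>t. c * x t) = c * biorth g z k x"
      unfolding biorth.simps[of g z k] using linf_on_scale[OF assms x] by (simp add: algebra_simps)
  qed
qed

text \<open>Covers both \<open>JT\<close> and its dual, so the construction of complemented copies
  is done once. Bounded evaluations (\<open>N_point\<close>) identify norm limits with pointwise
  sums of series and make \<open>N\<close> definite.\<close>

locale fnormed =
  fixes V :: "('i \<Rightarrow> real) set" and N :: "('i \<Rightarrow> real) \<Rightarrow> real"
  assumes V: "lin_subspace V"
    and N_add: "\<And>x y. x \<in> V \<Longrightarrow> y \<in> V \<Longrightarrow> N (\<lambda>t. x t + y t) \<le> N x + N y"
    and N_scale: "\<And>x c. x \<in> V \<Longrightarrow> N (\<lambda>t. c * x t) = \<bar>c\<bar> * N x"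
    and N_point: "\<And>t. \<exists>C. \<forall>x\<in>V. \<bar>x t\<bar> \<le> C * N x"
    and N_complete: "\<And>u. (\<And>n. u n \<in> V) \<Longrightarrow>
       (\<And>e. 0 < e \<Longrightarrow> \<exists>M. \<forall>m n. M \<le> n \<and> n \<le> m \<longrightarrow> N (\<lambda>t. u m t - u n t) < e) \<Longrightarrow>
       \<exists>x\<in>V. (\<lambda>n. N (\<lambda>t. u n t - x t)) \<longlonglongrightarrow> 0"
begin

lemma N_zero: "N (\<lambda>t. 0) = 0"
  using N_scale[OF lin_subspace_zero[OF V], of 0] by simp

lemma N_minus: "x \<in> V \<Longrightarrow> N (\<lambda>t. - x t) = N x"
  using N_scale[of x "-1"] by simp

lemma N_nonneg: assumes "x \<in> V" shows "0 \<le> N x"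
  using N_add[OF assms lin_subspace_scale[OF V assms, of "-1"]] N_zero N_minus[OF assms] by simp

lemma N_diff: assumes "x \<in> V" "y \<in> V" shows "N (\<lambda>t. x t - y t) \<le> N x + N y"
  using N_add[OF assms(1) lin_subspace_scale[OF V assms(2), of "-1"]] N_minus[OF assms(2)] by simp

lemma N_sum_le:
  assumes "finite A" "\<And>k. k \<in> A \<Longrightarrow> z k \<in> V"
  shows "N (\<lambda>t. \<Sum>k\<in>A. c k * z k t) \<le> (\<Sum>k\<in>A. \<bar>c k\<bar> * N (z k))"
  using assms
proof (induction A rule: finite_induct)
  case (insert k A)
  have "N (\<lambda>t. c k * z k t + (\<Sum>k\<in>A. c k * z k t)) \<le> N (\<lambda>t. c k * z k t) + N (\<lambda>t. \<Sum>k\<in>A. c k * z k t)"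
    using insert V by (intro N_add lin_subspace_scale lin_subspace_sum) auto
  then show ?case using insert by (simp add: N_scale)
qed (simp add: N_zero)

lemma N_eq_0D: assumes "x \<in> V" "N x = 0" shows "x = (\<lambda>t. 0)"
proof
  fix t
  obtain C where "\<forall>x\<in>V. \<bar>x t\<bar> \<le> C * N x" using N_point[of t] by blast
  then have "\<bar>x t\<bar> \<le> C * N x" using assms(1) by blast
  then show "x t = 0" using assms(2) by simp
qed

text \<open>Each coefficient is at most the l2-norm of all of them, so geometrically decreasing
  errors add at most \<open>2 * B\<close> to the constant.\<close>

lemma upper2_perturb:
  assumes y: "upper2 N y C" "\<And>k. y k \<in> V" and z: "\<And>k. z k \<in> V"
    and d: "\<And>k. N (\<lambda>t. z k t - y k t) \<le> B * (1/2)^k" "0 \<le> B"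
  shows "upper2 N z (C + 2 * B)"
  unfolding upper2_def
proof (intro conjI allI)
  show "0 \<le> C + 2 * B" using y(1) d(2) by (simp add: upper2_def)
  fix n and c :: "nat \<Rightarrow> real"
  let ?s = "sqrt (\<Sum>k<n. (c k)\<^sup>2)"
  have zy: "(\<lambda>t. z k t - y k t) \<in> V" for k using lin_subspace_diff[OF V z y(2)] .
  have "(\<lambda>t. \<Sum>k<n. c k * z k t) = (\<lambda>t. (\<Sum>k<n. c k * y k t) + (\<Sum>k<n. c k * (z k t - y k t)))"
    by (simp add: sum.distrib[symmetric] algebra_simps)
  moreover have "N (\<lambda>t. (\<Sum>k<n. c k * y k t) + (\<Sum>k<n. c k * (z k t - y k t)))
      \<le> N (\<lambda>t. \<Sum>k<n. c k * y k t) + N (\<lambda>t. \<Sum>k<n. c k * (z k t - y k t))"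
    by (intro N_add lin_subspace_sum[OF V]) (auto intro: y(2) zy)
  ultimately have "N (\<lambda>t. \<Sum>k<n. c k * z k t)
      \<le> N (\<lambda>t. \<Sum>k<n. c k * y k t) + N (\<lambda>t. \<Sum>k<n. c k * (z k t - y k t))"
    by presburger
  also have "N (\<lambda>t. \<Sum>k<n. c k * (z k t - y k t)) \<le> (\<Sum>k<n. \<bar>c k\<bar> * N (\<lambda>t. z k t - y k t))"
    using zy by (intro N_sum_le) auto
  also have "\<dots> \<le> (\<Sum>k<n. ?s * (B * (1/2)^k))"
  proof (intro sum_mono mult_mono d(1))
    fix k assume "k \<in> {..<n}"
    then have "(c k)\<^sup>2 \<le> (\<Sum>k<n. (c k)\<^sup>2)" by (intro member_le_sum) auto
    then show "\<bar>c k\<bar> \<le> ?s" by (metis real_sqrt_abs real_sqrt_le_mono)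
  qed (auto simp: sum_nonneg N_nonneg[OF zy])
  also have "\<dots> = ?s * B * (\<Sum>k<n. (1/2)^k)" by (simp add: sum_distrib_left mult.assoc)
  also have "\<dots> \<le> ?s * B * 2"
  proof (rule mult_left_mono)
    show "(\<Sum>k<n. (1/2::real)^k) \<le> 2" by (simp add: sum_gp_strict)
    show "0 \<le> ?s * B" using d(2) by (simp add: sum_nonneg)
  qed
  finally show "N (\<lambda>t. \<Sum>k<n. c k * z k t) \<le> (C + 2 * B) * ?s"
    using upper2D[OF y(1), of c n] by (simp add: algebra_simps)
qed


text \<open>Synthesis \<open>R\<close> from l2 into \<open>M\<close> is bounded by the upper
  estimate, analysis \<open>T\<close> into l2 by the Bessel inequality \<open>bes\<close>, and
  biorthogonality gives \<open>T (R a) = a\<close>. Hence \<open>R (T x)\<close> defines a bounded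
  projection onto the range of \<open>R\<close>, on which \<open>T\<close> is an
  isomorphism.\<close>

theorem l2_complemented:
  assumes M: "closed_subspace_in V N M" and z: "\<And>k. z k \<in> M"
    and up: "upper2 N z C" and g: "\<And>k. linf_on V (g k)" and D: "0 \<le> D"
    and bes: "\<And>x n. x \<in> V \<Longrightarrow> (\<Sum>k<n. (g k x)\<^sup>2) \<le> (D * N x)\<^sup>2"
    and bi: "\<And>k j. g k (z j) = (if j = k then 1 else 0)"
  shows "\<exists>Y. Y \<subseteq> M \<and> closed_subspace_in V N Y \<and> isomorphic_to_l2 N Y \<and> complemented_in V N Y"
proof -
  define R where "R a = (\<lambda>t. \<Sum>k. a k * z k t)" for a :: "nat \<Rightarrow> real"
  define S where "S a n = (\<lambda>t. \<Sum>k<n. a k * z k t)" for a :: "nat \<Rightarrow> real" and n :: nat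
  have C: "0 \<le> C" using up by (simp add: upper2_def)
  have MV: "M \<subseteq> V" and Msub: "lin_subspace M"
    and Mcl: "\<And>u x. (\<And>n. u n \<in> M) \<Longrightarrow> x \<in> V \<Longrightarrow> (\<lambda>n. N (\<lambda>t. u n t - x t)) \<longlonglongrightarrow> 0 \<Longrightarrow> x \<in> M"
    using M unfolding closed_subspace_in_def by blast+
  have zV: "z k \<in> V" for k using z MV by blast
  have SM: "S a n \<in> M" for a n unfolding S_def using z by (intro lin_subspace_sum[OF Msub]) auto
  have SV: "S a n \<in> V" for a n using SM MV by blast
  have g_cont: "\<bar>g k x\<bar> \<le> D * N x" if "x \<in> V" for k x
  proof -
    have "(g k x)\<^sup>2 \<le> (\<Sum>k<Suc k. (g k x)\<^sup>2)" by (intro member_le_sum) auto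
    also have "\<dots> \<le> (D * N x)\<^sup>2" by (rule bes[OF that])
    finally show ?thesis using D N_nonneg[OF that] abs_le_square_iff[of "g k x" "D * N x"] by simp
  qed
  \<comment> \<open>\<open>R\<close> is given by pointwise series; completeness provides a norm
    limit of the partial sums, and bounded evaluations identify it with \<open>R a\<close>.\<close>
  have main: "R a \<in> M \<and> (\<lambda>n. N (\<lambda>t. S a n t - R a t)) \<longlonglongrightarrow> 0 \<and> (\<forall>t. summable (\<lambda>k. a k * z k t))"
    if a: "a \<in> l2" for a
  proof -
    have sm: "summable (\<lambda>k. (a k)\<^sup>2)" using a by (simp add: l2_def)
    have cauchy: "\<exists>L. \<forall>m n. L \<le> n \<and> n \<le> m \<longrightarrow> N (\<lambda>t. S a m t - S a n t) < e" if e: "0 < e" for e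
    proof -
      \<comment> \<open>Chosen so that \<open>C * sqrt d < e\<close>; adding 1 admits
        \<open>C = 0\<close>.\<close>
      define d where "d = (e / (C + 1))\<^sup>2"
      have d: "0 < d" using e C by (simp add: d_def)
      obtain L where L: "\<And>m n. L \<le> m \<Longrightarrow> norm (sum (\<lambda>k. (a k)\<^sup>2) {m..<n}) < d"
        using sm[unfolded summable_Cauchy] d by blast
      have "N (\<lambda>t. S a m t - S a n t) < e" if "L \<le> n" "n \<le> m" for m n
      proof -
        let ?b = "\<lambda>k. if k < n then 0 else a k"
        have tail: "(\<Sum>k<m. if k < n then 0 else f k) = (\<Sum>k=n..<m. f k)" for f :: "nat \<Rightarrow> real"
          by (intro sum.mono_neutral_cong_right) auto
        have eq: "(\<Sum>k<m. f k) - (\<Sum>k<n. f k) = (\<Sum>k<m. if k < n then 0 else f k)"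
          for f :: "nat \<Rightarrow> real"
          unfolding tail using sum.atLeastLessThan_concat[of 0 n m f] that(2)
          by (simp add: atLeast0LessThan)
        have "(\<lambda>t. S a m t - S a n t) = (\<lambda>t. \<Sum>k<m. ?b k * z k t)"
          unfolding S_def eq by (intro ext sum.cong) auto
        then have "N (\<lambda>t. S a m t - S a n t) \<le> C * sqrt (\<Sum>k<m. (?b k)\<^sup>2)"
          using upper2D[OF up, of ?b m] by simp
        also have "(\<Sum>k<m. (?b k)\<^sup>2) = (\<Sum>k<m. if k < n then 0 else (a k)\<^sup>2)"
          by (intro sum.cong) auto
        also have "\<dots> = (\<Sum>k=n..<m. (a k)\<^sup>2)" by (rule tail)
        also have "C * sqrt (\<Sum>k=n..<m. (a k)\<^sup>2) \<le> C * sqrt d"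
          using L[OF that(1), of m] C by (intro mult_left_mono real_sqrt_le_mono) auto
        also have "\<dots> = C * (e / (C + 1))" using e C by (simp add: d_def)
        also have "\<dots> < e" using e C by (simp add: field_simps)
        finally show ?thesis .
      qed
      then show ?thesis by blast
    qed
    have "\<exists>x\<in>V. (\<lambda>n. N (\<lambda>t. S a n t - x t)) \<longlonglongrightarrow> 0"
      using SV cauchy by (rule N_complete)
    then obtain x where x: "x \<in> V" "(\<lambda>n. N (\<lambda>t. S a n t - x t)) \<longlonglongrightarrow> 0" by blast
    have sums: "(\<lambda>k. a k * z k t) sums x t" for t
    proof -
      obtain K where K: "\<forall>x\<in>V. \<bar>x t\<bar> \<le> K * N x" using N_point[of t] by blast
      have "\<bar>S a n t - x t\<bar> \<le> K * N (\<lambda>t. S a n t - x t)" for n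
        using bspec[OF K lin_subspace_diff[OF V SV x(1)]] .
      then have "\<forall>n. norm (S a n t - x t) \<le> K * N (\<lambda>t. S a n t - x t)" by simp
      then have "(\<lambda>n. S a n t - x t) \<longlonglongrightarrow> 0"
        by (rule Lim_null_comparison[OF always_eventually tendsto_mult_right_zero[OF x(2)]])
      then have "(\<lambda>n. S a n t) \<longlonglongrightarrow> x t" by (rule LIM_zero_cancel)
      then show ?thesis by (simp add: sums_def S_def)
    qed
    then have "R a = x" by (auto simp: R_def sums_iff)
    moreover have "x \<in> M" by (rule Mcl[OF SM x])
    ultimately show ?thesis using x sums by (auto simp: sums_iff)
  qed
  have RM: "R a \<in> M" if "a \<in> l2" for a using main[OF that] by blast
  have RV: "R a \<in> V" if "a \<in> l2" for a using RM[OF that] MV by blast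
  have R_conv: "(\<lambda>n. N (\<lambda>t. S a n t - R a t)) \<longlonglongrightarrow> 0" if "a \<in> l2" for a using main[OF that] by blast
  have R_summ: "summable (\<lambda>k. a k * z k t)" if "a \<in> l2" for a t using main[OF that] by blast
  have R_norm: "N (R a) \<le> C * l2_norm a" if a: "a \<in> l2" for a
  proof -
    have "N (R a) \<le> C * l2_norm a + N (\<lambda>t. S a n t - R a t)" for n
    proof -
      have "N (\<lambda>t. S a n t - (S a n t - R a t)) \<le> N (S a n) + N (\<lambda>t. S a n t - R a t)"
        by (intro N_diff SV lin_subspace_diff[OF V] RV a)
      moreover have "N (S a n) \<le> C * sqrt (\<Sum>k<n. (a k)\<^sup>2)"
        unfolding S_def by (rule upper2D[OF up])
      moreover have "C * sqrt (\<Sum>k<n. (a k)\<^sup>2) \<le> C * l2_norm a"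
        unfolding l2_norm_def using a C
        by (intro mult_left_mono real_sqrt_le_mono sum_le_suminf) (auto simp: l2_def)
      ultimately show ?thesis by simp
    qed
    moreover have "(\<lambda>n. C * l2_norm a + N (\<lambda>t. S a n t - R a t)) \<longlonglongrightarrow> C * l2_norm a + 0"
      by (intro tendsto_intros R_conv a)
    ultimately show ?thesis by (intro LIMSEQ_le_const[where X = "\<lambda>n. C * l2_norm a + N (\<lambda>t. S a n t - R a t)"]) auto
  qed
  have gR: "g k (R a) = a k" if a: "a \<in> l2" for a k
  proof -
    have gS: "g k (S a n) = a k" if "k < n" for n
    proof -
      have "g k (S a n) = (\<Sum>j<n. a j * g k (z j))"
        unfolding S_def using zV by (intro linf_on_sum[OF V g]) auto
      also have "\<dots> = (\<Sum>j<n. if j = k then a j else 0)" by (intro sum.cong) (auto simp: bi)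
      also have "\<dots> = a k" using that by simp
      finally show ?thesis .
    qed
    have "\<bar>a k - g k (R a)\<bar> \<le> D * N (\<lambda>t. S a n t - R a t)" if "k < n" for n
      using g_cont[OF lin_subspace_diff[OF V SV RV[OF a]], of k a n]
        linf_on_diff[OF V g SV RV[OF a], of k a n] gS[OF that] by simp
    then have "\<forall>\<^sub>F n in sequentially. \<bar>a k - g k (R a)\<bar> \<le> D * N (\<lambda>t. S a n t - R a t)"
      unfolding eventually_sequentially by (meson Suc_le_lessD)
    moreover have "(\<lambda>n. D * N (\<lambda>t. S a n t - R a t)) \<longlonglongrightarrow> D * 0"
      by (intro tendsto_intros R_conv a)
    ultimately have "\<bar>a k - g k (R a)\<bar> \<le> D * 0"
      by (intro tendsto_lowerbound[where f = "\<lambda>n. D * N (\<lambda>t. S a n t - R a t)" and F = sequentially]) auto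
    then show ?thesis by simp
  qed
  define T where "T x = (\<lambda>k. g k x)" for x :: "'i \<Rightarrow> real"
  have T_l2: "T x \<in> l2" and T_norm: "l2_norm (T x) \<le> D * N x" if "x \<in> V" for x
  proof -
    have sm: "summable (\<lambda>k. (g k x)\<^sup>2)"
      using bes[OF that] by (intro summableI_nonneg_bounded) auto
    then show "T x \<in> l2" by (simp add: l2_def T_def)
    have "(\<Sum>k. (g k x)\<^sup>2) \<le> (D * N x)\<^sup>2" using bes[OF that] sm by (intro suminf_le_const) auto
    then show "l2_norm (T x) \<le> D * N x"
      unfolding l2_norm_def T_def using D N_nonneg[OF that] by (intro real_le_lsqrt) auto
  qed
  have TR: "T (R a) = a" if "a \<in> l2" for a using gR[OF that] by (simp add: T_def)
  have l2_add: "(\<lambda>k. a k + b k) \<in> l2" if "a \<in> l2" "b \<in> l2" for a b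
  proof -
    have "summable (\<lambda>k. 2 * (a k)\<^sup>2 + 2 * (b k)\<^sup>2)"
      using that by (intro summable_add summable_mult) (auto simp: l2_def)
    moreover have "norm ((a k + b k)\<^sup>2) \<le> 2 * (a k)\<^sup>2 + 2 * (b k)\<^sup>2" for k
    proof -
      have "(a k + b k)\<^sup>2 \<le> 2 * (a k)\<^sup>2 + 2 * (b k)\<^sup>2"
        using sum_squares_bound[of "a k" "b k"] by (simp add: power2_sum)
      then show ?thesis by simp
    qed
    ultimately show ?thesis unfolding l2_def by (auto intro: summable_comparison_test')
  qed
  have l2_scale: "(\<lambda>k. c * a k) \<in> l2" if "a \<in> l2" for a c
    using that by (auto simp: l2_def power_mult_distrib intro: summable_mult)
  have R_add: "R (\<lambda>k. a k + b k) = (\<lambda>t. R a t + R b t)" if "a \<in> l2" "b \<in> l2" for a b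
    unfolding R_def using R_summ that by (simp add: distrib_right suminf_add[symmetric])
  have R_scale: "R (\<lambda>k. c * a k) = (\<lambda>t. c * R a t)" if "a \<in> l2" for a c
    unfolding R_def using R_summ[OF that] by (simp add: mult.assoc suminf_mult)
  define Y where "Y = R ` l2"
  have zero_l2: "(\<lambda>k. 0) \<in> l2" by (simp add: l2_def)
  have YM: "Y \<subseteq> M" using RM by (auto simp: Y_def)
  have YV: "Y \<subseteq> V" using YM MV by blast
  have RT: "R (T y) = y" if "y \<in> Y" for y using that TR by (auto simp: Y_def)
  have Tlin: "lin_on V T"
    unfolding lin_on_def T_def using linf_on_add[OF g] linf_on_scale[OF g] by auto
  have Ysub: "lin_subspace Y"
    unfolding lin_subspace_def
  proof (intro conjI ballI allI)
    have "R (\<lambda>k. 0) = (\<lambda>t. 0)" by (simp add: R_def)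
    then show "(\<lambda>t. 0) \<in> Y" using zero_l2 unfolding Y_def by (metis imageI)
    fix x y assume "x \<in> Y" "y \<in> Y"
    then show "(\<lambda>t. x t + y t) \<in> Y"
      unfolding Y_def using R_add l2_add by (auto simp: image_iff) metis
  next
    fix x c assume "x \<in> Y"
    then show "(\<lambda>t. c * x t) \<in> Y"
      unfolding Y_def using R_scale l2_scale by (auto simp: image_iff) metis
  qed
  define P where "P x = R (T x)" for x
  have PY: "P x \<in> Y" if "x \<in> V" for x using T_l2[OF that] by (simp add: P_def Y_def)
  have P_norm: "N (P x) \<le> C * D * N x" if "x \<in> V" for x
    using R_norm[OF T_l2[OF that]] mult_left_mono[OF T_norm[OF that] C] by (simp add: P_def mult.assoc)
  have Plin: "lin_on V P"
    unfolding lin_on_def P_def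
  proof (intro conjI ballI allI)
    fix x y assume "x \<in> V" "y \<in> V"
    then show "R (T (\<lambda>t. x t + y t)) = (\<lambda>u. R (T x) u + R (T y) u)"
      using Tlin R_add[OF T_l2 T_l2] unfolding lin_on_def by simp
  next
    fix x c assume "x \<in> V"
    then show "R (T (\<lambda>t. c * x t)) = (\<lambda>u. c * R (T x) u)"
      using Tlin R_scale[OF T_l2] unfolding lin_on_def by simp
  qed
  have P_add: "P (\<lambda>t. x t + y t) = (\<lambda>t. P x t + P y t)" if "x \<in> V" "y \<in> V" for x y
    using Plin that unfolding lin_on_def by blast
  have P_scale: "P (\<lambda>t. c * x t) = (\<lambda>t. c * P x t)" if "x \<in> V" for x c
    using Plin that unfolding lin_on_def by blast
  have Pid: "P y = y" if "y \<in> Y" for y using RT[OF that] by (simp add: P_def)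
  have "complemented_in V N Y"
    unfolding complemented_in_def using Plin PY Pid P_norm by blast
  moreover have "closed_subspace_in V N Y"
    unfolding closed_subspace_in_def
  proof (intro conjI allI impI YV Ysub)
    fix u x assume u: "\<forall>n. u n \<in> Y" "x \<in> V" and lim: "(\<lambda>n. N (\<lambda>t. u n t - x t)) \<longlonglongrightarrow> 0"
    have uV: "u n \<in> V" for n using u YV by blast
    have PV: "P x \<in> V" using PY u(2) YV by blast
    \<comment> \<open>\<open>P\<close> fixes \<open>u n\<close>, so subtracting from
      \<open>u n - x\<close> its image under \<open>P\<close> leaves \<open>P x - x\<close>, which
      does not depend on \<open>n\<close>.\<close>
    have bound: "N (\<lambda>t. P x t - x t) \<le> (1 + C * D) * N (\<lambda>t. u n t - x t)" for n
    proof -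
      have d: "(\<lambda>t. u n t - x t) \<in> V" by (rule lin_subspace_diff[OF V uV u(2)])
      have neg: "(\<lambda>t. - 1 * x t) \<in> V" by (rule lin_subspace_scale[OF V u(2)])
      have 1: "P (\<lambda>t. u n t + - 1 * x t) = (\<lambda>t. u n t - P x t)"
      proof -
        have "P (\<lambda>t. u n t + - 1 * x t) = (\<lambda>t. P (u n) t + P (\<lambda>t. - 1 * x t) t)"
          by (rule P_add[OF uV neg])
        moreover have "P (\<lambda>t. - 1 * x t) = (\<lambda>t. - 1 * P x t)"
          by (rule P_scale[OF u(2)])
        moreover have "P (u n) = u n" using Pid u(1) by blast
        ultimately show ?thesis by simp
      qed
      have "N (\<lambda>t. (u n t - x t) - P (\<lambda>t. u n t - x t) t) \<le> N (\<lambda>t. u n t - x t) + N (P (\<lambda>t. u n t - x t))"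
        using PY[OF d] YV by (intro N_diff d) auto
      also have "(\<lambda>t. (u n t - x t) - P (\<lambda>t. u n t - x t) t) = (\<lambda>t. P x t - x t)"
        using 1 by simp
      finally show ?thesis using P_norm[OF d] by (simp add: algebra_simps)
    qed
    have "(\<lambda>n. (1 + C * D) * N (\<lambda>t. u n t - x t)) \<longlonglongrightarrow> (1 + C * D) * 0"
      by (intro tendsto_intros lim)
    then have "N (\<lambda>t. P x t - x t) \<le> (1 + C * D) * 0"
      using bound by (intro LIMSEQ_le_const[where X = "\<lambda>n. (1 + C * D) * N (\<lambda>t. u n t - x t)"]) auto
    then have "N (\<lambda>t. P x t - x t) = 0"
      using N_nonneg[OF lin_subspace_diff[OF V PV u(2)]] by simp
    then have "(\<lambda>t. P x t - x t) = (\<lambda>t. 0)" by (rule N_eq_0D[OF lin_subspace_diff[OF V PV u(2)]])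
    then have "P x = x" by (simp add: fun_eq_iff)
    then show "x \<in> Y" using PY[OF u(2)] by simp
  qed
  moreover have "isomorphic_to_l2 N Y"
    unfolding isomorphic_to_l2_def
  proof (intro exI conjI ballI)
    show "lin_on Y T" using Tlin YV unfolding lin_on_def by blast
    show "bij_betw T Y l2"
      by (rule bij_betw_byWitness[where f' = R]) (use RT TR T_l2 YV in \<open>auto simp: Y_def\<close>)
    show "0 < 1 / (C + 1)" using C by simp
    fix y assume y: "y \<in> Y"
    have "N y \<le> C * l2_norm (T y)" using R_norm[OF T_l2, of y] RT[OF y] y YV by auto
    also have "\<dots> \<le> (C + 1) * l2_norm (T y)"
    proof (rule mult_right_mono)
      show "0 \<le> l2_norm (T y)" using T_l2[of y] y YV unfolding l2_norm_def l2_def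
        by (auto intro!: suminf_nonneg)
    qed simp
    finally show "1 / (C + 1) * N y \<le> l2_norm (T y)" using C by (simp add: field_simps)
    show "l2_norm (T y) \<le> D * N y" using T_norm y YV by blast
  qed
  ultimately show ?thesis using YM by blast
qed


text \<open>The entries below the diagonal are so small that \<open>biorth g z k\<close> differs
  from \<open>g k\<close> by at most \<open>(1/2)^k * (D * N x)\<close> at \<open>x\<close>, and a
  Bessel inequality survives. The constant comes from \<open>2 + 2 * (4/3) \<le> 9\<close>, which
  turns \<open>D\<close> into \<open>3 * D\<close>.\<close>

theorem l2_complemented_triangular:
  assumes M: "closed_subspace_in V N M" and z: "\<And>k. z k \<in> M"
    and up: "upper2 N z C" and g: "\<And>k. linf_on V (g k)" and D: "0 \<le> D"
    and bes: "\<And>x n. x \<in> V \<Longrightarrow> (\<Sum>k<n. (g k x)\<^sup>2) \<le> (D * N x)\<^sup>2"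
    and diag: "\<And>k. g k (z k) = 1" and above: "\<And>k j. k < j \<Longrightarrow> g k (z j) = 0"
    and below: "\<And>k j. j < k \<Longrightarrow> \<bar>g k (z j)\<bar> \<le> (1/4)^k / 2"
  shows "\<exists>Y. Y \<subseteq> M \<and> closed_subspace_in V N Y \<and> isomorphic_to_l2 N Y \<and> complemented_in V N Y"
proof (rule l2_complemented[OF M z up])
  let ?h = "biorth g z"
  show "linf_on V (?h k)" for k by (rule biorth_linf[OF g])
  show "?h k (z j) = (if j = k then 1 else 0)" for k j by (rule biorth_eq) (simp_all add: diag above)
  show "0 \<le> 3 * D" using D by simp
  fix x and n :: nat assume x: "x \<in> V"
  have DN: "0 \<le> D * N x" using D N_nonneg[OF x] by simp
  have g_le: "\<bar>g k x\<bar> \<le> D * N x" for k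
  proof -
    have "(g k x)\<^sup>2 \<le> (\<Sum>k<Suc k. (g k x)\<^sup>2)" by (intro member_le_sum) auto
    also have "\<dots> \<le> (D * N x)\<^sup>2" by (rule bes[OF x])
    finally show ?thesis using DN abs_le_square_iff[of "g k x" "D * N x"] by simp
  qed
  \<comment> \<open>The correction of \<open>g k\<close> has \<open>k\<close> terms; a factor
    \<open>(1/2)^k\<close> of the smallness pays for their number.\<close>
  have k4: "real k * (1/4)^k \<le> (1/2)^k" for k :: nat
  proof -
    have "real k \<le> 2^k" using of_nat_mono[OF less_imp_le[OF less_exp[of k]], where 'a = real] by simp
    then have "real k * (1/4)^k \<le> 2^k * (1/4)^k" by (intro mult_right_mono) auto
    also have "\<dots> = (1/2)^k" by (simp add: power_mult_distrib[symmetric])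
    finally show ?thesis .
  qed
  have diff_aux: "\<bar>?h k x - g k x\<bar> \<le> (1/2)^k * (D * N x)"
    if "\<And>j. j < k \<Longrightarrow> \<bar>?h j x\<bar> \<le> 2 * (D * N x)" for k
  proof -
    have "\<bar>?h k x - g k x\<bar> \<le> (\<Sum>j<k. \<bar>g k (z j) * ?h j x\<bar>)"
      unfolding biorth.simps[of g z k] by simp
    also have "\<dots> \<le> (\<Sum>j<k. (1/4)^k / 2 * (2 * (D * N x)))"
      unfolding abs_mult using that below by (intro sum_mono mult_mono) auto
    also have "\<dots> = real k * (1/4)^k * (D * N x)" by simp
    also have "\<dots> \<le> (1/2)^k * (D * N x)" by (intro mult_right_mono k4 DN)
    finally show ?thesis .
  qed
  \<comment> \<open>The bound on the earlier functionals is what \<open>diff_aux\<close> needs, and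
    its conclusion is at most \<open>D * N x\<close>, so the crude bound
    \<open>2 * (D * N x)\<close> propagates.\<close>
  have h_le: "\<bar>?h k x\<bar> \<le> 2 * (D * N x)" for k
  proof (induction k rule: less_induct)
    case (less k)
    have "(1/2)^k * (D * N x) \<le> 1 * (D * N x)" by (intro mult_right_mono power_le_one DN) auto
    then show ?case using diff_aux[of k, OF less] g_le[of k] by simp
  qed
  have pt: "(?h k x)\<^sup>2 \<le> 2 * (g k x)\<^sup>2 + 2 * ((1/4)^k * (D * N x)\<^sup>2)" for k
  proof -
    have "(?h k x - g k x)\<^sup>2 \<le> ((1/2)^k * (D * N x))\<^sup>2"
      using diff_aux[OF h_le, of k] DN
        abs_le_square_iff[of "?h k x - g k x" "(1/2)^k * (D * N x)"] by simp
    also have "\<dots> = (1/4)^k * (D * N x)\<^sup>2"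
    proof -
      have "((1/2::real)^k)\<^sup>2 = ((1/2)\<^sup>2)^k" by (simp add: power_mult[symmetric] mult.commute)
      then show ?thesis by (simp add: power_mult_distrib power2_eq_square)
    qed
    finally have "(?h k x - g k x)\<^sup>2 \<le> (1/4)^k * (D * N x)\<^sup>2" .
    moreover have "(?h k x)\<^sup>2 \<le> 2 * (g k x)\<^sup>2 + 2 * (?h k x - g k x)\<^sup>2"
      using zero_le_power2[of "?h k x - 2 * g k x"] by (simp add: power2_eq_square algebra_simps)
    ultimately show ?thesis by simp
  qed
  have "(\<Sum>k<n. (?h k x)\<^sup>2) \<le> (\<Sum>k<n. 2 * (g k x)\<^sup>2 + 2 * ((1/4)^k * (D * N x)\<^sup>2))"
    by (intro sum_mono pt)
  also have "\<dots> = 2 * (\<Sum>k<n. (g k x)\<^sup>2) + 2 * (D * N x)\<^sup>2 * (\<Sum>k<n. (1/4)^k)"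
    by (simp add: sum.distrib sum_distrib_left algebra_simps)
  also have "\<dots> \<le> 2 * (D * N x)\<^sup>2 + 2 * (D * N x)\<^sup>2 * (4/3)"
  proof (intro add_mono mult_left_mono bes x)
    show "(\<Sum>k<n. (1/4::real)^k) \<le> 4/3" by (simp add: sum_gp_strict)
  qed auto
  also have "\<dots> \<le> 9 * (D * N x)\<^sup>2" by simp
  finally show "(\<Sum>k<n. (?h k x)\<^sup>2) \<le> (3 * D * N x)\<^sup>2"
    by (simp add: power_mult_distrib mult.assoc)
qed

end

section \<open>Branches\<close>

lemma JT_subspace: "lin_subspace JT"
  unfolding lin_subspace_def using JT_zero(1) JT_add(1) JT_scale_le(1) by blast

lemma seg_val_tendsto:
  assumes "\<And>t. (\<lambda>n. u n t) \<longlonglongrightarrow> x t"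
  shows "(\<lambda>n. seg_val S (u n)) \<longlonglongrightarrow> seg_val S x"
  unfolding seg_val_def by (intro tendsto_sum tendsto_power assms)

text \<open>The norm is lower semicontinuous under pointwise convergence, because every segment
  family tests only finitely many coordinates; so Cauchy estimates pass to the pointwise
  limit.\<close>

lemma JT_complete:
  assumes u: "\<And>n. u n \<in> JT"
    and cau: "\<And>e. 0 < e \<Longrightarrow> \<exists>M. \<forall>m n. M \<le> n \<and> n \<le> m \<longrightarrow> jt_norm (\<lambda>t. u m t - u n t) < e"
  shows "\<exists>x\<in>JT. (\<lambda>n. jt_norm (\<lambda>t. u n t - x t)) \<longlonglongrightarrow> 0"
proof -
  have d: "(\<lambda>t. u m t - u n t) \<in> JT" for m n by (rule lin_subspace_diff[OF JT_subspace u u])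
  have "Cauchy (\<lambda>n. u n t)" for t
    unfolding Cauchy_altdef2
  proof (intro allI impI)
    fix e :: real assume "0 < e"
    then obtain M where M: "\<forall>m n. M \<le> n \<and> n \<le> m \<longrightarrow> jt_norm (\<lambda>t. u m t - u n t) < e"
      using cau by blast
    have "dist (u n t) (u M t) < e" if "M \<le> n" for n
    proof -
      have "\<bar>u n t - u M t\<bar> \<le> jt_norm (\<lambda>t. u n t - u M t)"
        using abs_le_jt_norm[OF d[of n M], of t] .
      also have "\<dots> < e" using M that by blast
      finally show ?thesis by (simp add: dist_real_def)
    qed
    then show "\<exists>N. \<forall>n\<ge>N. dist (u n t) (u N t) < e" by blast
  qed
  then have "\<exists>l. (\<lambda>n. u n t) \<longlonglongrightarrow> l" for t using Cauchy_convergent convergent_def by blast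
  then obtain x where x: "\<And>t. (\<lambda>n. u n t) \<longlonglongrightarrow> x t" by metis
  have est: "\<exists>M. \<forall>n\<ge>M. (\<lambda>t. x t - u n t) \<in> JT \<and> jt_norm (\<lambda>t. x t - u n t) \<le> e" if e: "0 < e" for e
  proof -
    obtain M where M: "\<forall>m n. M \<le> n \<and> n \<le> m \<longrightarrow> jt_norm (\<lambda>t. u m t - u n t) < e"
      using cau[OF e] by blast
    have "(\<lambda>t. x t - u n t) \<in> JT \<and> jt_norm (\<lambda>t. x t - u n t) \<le> e" if n: "M \<le> n" for n
    proof -
      have "seg_val S (\<lambda>t. x t - u n t) \<le> e\<^sup>2" if S: "seg_fam S" for S
      proof (rule tendsto_upperbound)
        show "(\<lambda>m. seg_val S (\<lambda>t. u m t - u n t)) \<longlonglongrightarrow> seg_val S (\<lambda>t. x t - u n t)"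
          by (intro seg_val_tendsto tendsto_diff x tendsto_const)
        have "seg_val S (\<lambda>t. u m t - u n t) \<le> e\<^sup>2" if "n \<le> m" for m
        proof -
          have "seg_val S (\<lambda>t. u m t - u n t) \<le> (jt_norm (\<lambda>t. u m t - u n t))\<^sup>2"
            by (rule seg_val_le_norm[OF d S])
          also have "\<dots> \<le> e\<^sup>2"
            using M n that jt_norm_nonneg[OF d] by (meson less_imp_le power_mono)
          finally show ?thesis .
        qed
        then show "\<forall>\<^sub>F m in sequentially. seg_val S (\<lambda>t. u m t - u n t) \<le> e\<^sup>2"
          unfolding eventually_sequentially by blast
      qed simp
      then show ?thesis using JT_I[of "\<lambda>t. x t - u n t" e] e by simp
    qed
    then show ?thesis by blast
  qed
  obtain M where "(\<lambda>t. x t - u M t) \<in> JT" using est[of 1] by auto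
  then have "(\<lambda>t. (x t - u M t) + u M t) \<in> JT" using u by (rule JT_add(1))
  then have xJ: "x \<in> JT" by simp
  have "(\<lambda>n. jt_norm (\<lambda>t. u n t - x t)) \<longlonglongrightarrow> 0"
  proof (rule LIMSEQ_I)
    fix e :: real assume e: "0 < e"
    then obtain M where M: "\<forall>n\<ge>M. (\<lambda>t. x t - u n t) \<in> JT \<and> jt_norm (\<lambda>t. x t - u n t) \<le> e / 2"
      using est[of "e/2"] by auto
    have "norm (jt_norm (\<lambda>t. u n t - x t) - 0) < e" if "M \<le> n" for n
    proof -
      have "jt_norm (\<lambda>t. u n t - x t) = jt_norm (\<lambda>t. x t - u n t)"
        using JT_scale[OF lin_subspace_diff[OF JT_subspace xJ u], of "-1" n] by simp
      then show ?thesis using M that e jt_norm_nonneg[of "\<lambda>t. x t - u n t"] by fastforce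
    qed
    then show "\<exists>no. \<forall>n\<ge>no. norm (jt_norm (\<lambda>t. u n t - x t) - 0) < e" by blast
  qed
  then show ?thesis using xJ by blast
qed

interpretation JT: fnormed JT jt_norm
proof (unfold_locales)
  show "\<exists>C. \<forall>x\<in>JT. \<bar>x t\<bar> \<le> C * jt_norm x" for t
    using abs_le_jt_norm by (intro exI[of _ 1]) simp
qed (simp_all add: JT_subspace JT_add JT_scale JT_complete)

text \<open>\<open>\<sigma> n\<close> is the node at level \<open>n\<close>; after adding 1 a node
  is a binary index, and halving this index gives the parent.\<close>

definition branch :: "(nat \<Rightarrow> nat) \<Rightarrow> bool" where
  "branch \<sigma> \<longleftrightarrow> \<sigma> 0 = 0 \<and> (\<forall>n. \<sigma> n + 1 = (\<sigma> (Suc n) + 1) div 2)"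

lemma branch_step: "branch \<sigma> \<Longrightarrow> \<sigma> n + 1 = (\<sigma> (Suc n) + 1) div 2"
  unfolding branch_def by blast

lemma branch_div:
  assumes "branch \<sigma>" "i \<le> j"
  shows "\<sigma> i + 1 = (\<sigma> j + 1) div 2 ^ (j - i)"
  using assms(2)
proof (induction j rule: dec_induct)
  case (step j)
  have "(\<sigma> (Suc j) + 1) div 2 ^ (Suc j - i) = (\<sigma> (Suc j) + 1) div 2 div 2 ^ (j - i)"
    using step(1) by (simp add: Suc_diff_le div_mult2_eq)
  also have "\<dots> = (\<sigma> j + 1) div 2 ^ (j - i)"
    using branch_step[OF assms(1), of j] by simp
  finally show ?case using step by simp
qed simp

lemma branch_bounds:
  assumes "branch \<sigma>" shows "2 ^ n \<le> \<sigma> n + 1" "\<sigma> n + 1 < 2 ^ Suc n"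
proof -
  have "2 ^ n \<le> \<sigma> n + 1 \<and> \<sigma> n + 1 < 2 ^ Suc n"
  proof (induction n)
    case (Suc n)
    have "\<sigma> n + 1 = (\<sigma> (Suc n) + 1) div 2" by (rule branch_step[OF assms])
    then show ?case using Suc by auto
  qed (use assms[unfolded branch_def] in simp)
  then show "2 ^ n \<le> \<sigma> n + 1" "\<sigma> n + 1 < 2 ^ Suc n" by auto
qed

lemma branch_strict_mono: assumes "branch \<sigma>" shows "strict_mono \<sigma>"
proof (rule strict_monoI_Suc)
  fix n
  have "\<sigma> n + 1 = (\<sigma> (Suc n) + 1) div 2" by (rule branch_step[OF assms])
  then show "\<sigma> n < \<sigma> (Suc n)" by linarith
qed

lemma branch_inj: "branch \<sigma> \<Longrightarrow> inj_on \<sigma> A"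
  by (rule inj_on_subset[OF strict_mono_imp_inj_on[OF branch_strict_mono]]) auto

lemma branch_ge: "branch \<sigma> \<Longrightarrow> n \<le> \<sigma> n"
  by (rule strict_mono_imp_increasing[OF branch_strict_mono])

lemma branch_agree:
  assumes "branch \<sigma>" "branch \<tau>" "\<sigma> R = \<tau> R" "i \<le> R"
  shows "\<sigma> i = \<tau> i"
  using branch_div[OF assms(1,4)] branch_div[OF assms(2,4)] assms(3) by simp

text \<open>Shifted by 1, the nodes of level \<open>n\<close> lie between \<open>2 ^ n\<close> and
  \<open>2 ^ Suc n - 1\<close>, and these ranges are disjoint for different levels.\<close>

lemma branch_same_level:
  assumes "branch \<sigma>" "branch \<tau>" "\<sigma> i = \<tau> j" shows "i = j"
proof -
  have "(2::nat) ^ i < 2 ^ Suc j" "(2::nat) ^ j < 2 ^ Suc i"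
    using branch_bounds[OF assms(1), of i] branch_bounds[OF assms(2), of j] assms(3) by linarith+
  then have "i < Suc j" "j < Suc i" using power_less_imp_less_exp[of "2::nat"] one_less_numeral_iff semiring_norm(76) by blast+
  then show ?thesis by simp
qed

lemma tree_le_branch:
  assumes "branch \<sigma>"
  shows "tree_le t (\<sigma> n) \<longleftrightarrow> (\<exists>i\<le>n. t = \<sigma> i)"
proof
  assume "tree_le t (\<sigma> n)"
  then obtain k where k: "(\<sigma> n + 1) div 2 ^ k = t + 1" by (auto simp: tree_le_def)
  have "k \<le> n"
  proof (rule ccontr)
    assume "\<not> k \<le> n"
    then have "(2::nat) ^ Suc n \<le> 2 ^ k" by (intro power_increasing) auto
    then have "(\<sigma> n + 1) div 2 ^ k = 0" using branch_bounds(2)[OF assms, of n] by (intro div_less) simp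
    then show False using k by simp
  qed
  then have "t = \<sigma> (n - k)" using branch_div[OF assms, of "n - k" n] k by simp
  then show "\<exists>i\<le>n. t = \<sigma> i" by (intro exI[of _ "n - k"]) simp
next
  assume "\<exists>i\<le>n. t = \<sigma> i"
  then show "tree_le t (\<sigma> n)" unfolding tree_le_def using branch_div[OF assms, of _ n] by metis
qed

lemma branch_through: "\<exists>\<sigma> n. branch \<sigma> \<and> \<sigma> n = e"
proof -
  obtain n where n: "2 ^ n \<le> e + 1" "e + 1 < 2 ^ (n + 1)"
    using ex_power_ivl1[of 2 "e + 1"] by auto
  define m where "m = e + 1"
  \<comment> \<open>Shifted indices: up to level \<open>n\<close> the ancestors of \<open>e\<close>,
    beyond it repeatedly the left child.\<close>
  define f where "f k = (if k \<le> n then m div 2 ^ (n - k) else m * 2 ^ (k - n))" for k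
  have pos: "1 \<le> f k" for k
  proof (cases "k \<le> n")
    case True
    have "(2::nat) ^ (n - k) \<le> 2 ^ n" by (intro power_increasing) auto
    then have "2 ^ (n - k) \<le> m" using n(1) unfolding m_def by (rule order_trans)
    then have "0 < m div 2 ^ (n - k)" by (simp add: div_greater_zero_iff)
    then show ?thesis using True by (simp add: f_def)
  qed (simp add: f_def m_def Suc_le_eq)
  have step: "f k = f (Suc k) div 2" for k
  proof (cases "Suc k \<le> n")
    case True
    then have "n - k = Suc (n - Suc k)" by simp
    then have "m div 2 ^ (n - k) = m div 2 ^ (n - Suc k) div 2"
      by (simp add: div_mult2_eq[symmetric] mult.commute)
    then show ?thesis using True by (simp add: f_def)
  next
    case False
    then have "f (Suc k) = 2 * f k" by (auto simp: f_def le_Suc_eq Suc_diff_le not_le)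
    then show ?thesis by simp
  qed
  have f0: "f 0 = 1"
  proof -
    have "m div 2 ^ n = 1" using n by (intro div_nat_eqI) (auto simp: m_def)
    then show ?thesis by (simp add: f_def)
  qed
  have "branch (\<lambda>k. f k - 1)" unfolding branch_def
  proof (intro conjI allI)
    show "f 0 - 1 = 0" using f0 by simp
    show "f k - 1 + 1 = (f (Suc k) - 1 + 1) div 2" for k using pos[of k] pos[of "Suc k"] step[of k] by simp
  qed
  moreover have "f n - 1 = e" by (simp add: f_def m_def)
  ultimately show ?thesis by blast
qed

lemma segment_branch: assumes "branch \<sigma>" shows "segment (\<sigma> ` {..<n})"
  unfolding segment_def
proof (intro conjI ballI allI impI)
  fix a b assume "a \<in> \<sigma> ` {..<n}" "b \<in> \<sigma> ` {..<n}"
  then obtain i j where "a = \<sigma> i" "b = \<sigma> j" by blast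
  then show "tree_le a b \<or> tree_le b a"
    using tree_le_branch[OF assms] nat_le_linear[of i j] by blast
next
  fix a b k assume "a \<in> \<sigma> ` {..<n}" and b: "b \<in> \<sigma> ` {..<n}" and k: "tree_le a k \<and> tree_le k b"
  then obtain j where "b = \<sigma> j" "j < n" by blast
  then show "k \<in> \<sigma> ` {..<n}" using k tree_le_branch[OF assms] by fastforce
qed

text \<open>The largest number in a finite segment is also its largest node in the tree order, so a
  branch through it contains the segment; convexity in the tree order fills the part from the least
  node on.\<close>

lemma finite_segment_branch:
  assumes "finite s" "segment s" "s \<noteq> {}"
  shows "\<exists>\<sigma> i n. branch \<sigma> \<and> i \<le> n \<and> s = \<sigma> ` {i..n}"
proof -
  obtain \<sigma> n where \<sigma>: "branch \<sigma>" "\<sigma> n = Max s" using branch_through by blast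
  have "\<exists>j\<le>n. t = \<sigma> j" if t: "t \<in> s" for t
  proof -
    have "tree_le t (Max s) \<or> tree_le (Max s) t" using assms t Max_in unfolding segment_def by blast
    moreover have "t \<le> Max s" using assms t by simp
    ultimately have "tree_le t (Max s)" using tree_le_imp_le[of "Max s" t] by fastforce
    then show ?thesis using tree_le_branch[OF \<sigma>(1), of t n] \<sigma>(2) by simp
  qed
  note in_br = this
  obtain i where i: "i \<le> n" "Min s = \<sigma> i" using in_br[of "Min s"] assms Min_in by blast
  have "s = \<sigma> ` {i..n}"
  proof (intro set_eqI iffI)
    fix t assume t: "t \<in> s"
    then obtain j where j: "j \<le> n" "t = \<sigma> j" using in_br by blast
    have "\<sigma> i \<le> \<sigma> j" using Min_le[OF assms(1) t] i j by simp
    then have "i \<le> j" using strict_mono_less_eq[OF branch_strict_mono[OF \<sigma>(1)]] by simp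
    then show "t \<in> \<sigma> ` {i..n}" using j by auto
  next
    fix t assume "t \<in> \<sigma> ` {i..n}"
    then obtain j where j: "i \<le> j" "j \<le> n" "t = \<sigma> j" by auto
    have "tree_le (Min s) t" "tree_le t (Max s)"
      using tree_le_branch[OF \<sigma>(1)] i j \<sigma>(2) by metis+
    moreover have "Min s \<in> s" "Max s \<in> s" using assms by auto
    ultimately show "t \<in> s" using assms(2) unfolding segment_def by blast
  qed
  then show ?thesis using \<sigma>(1) i(1) by blast
qed

text \<open>An infinite series only to keep bounds on supports out of the notation: it is applied to
  finitely supported vectors.\<close>

definition bsum :: "(nat \<Rightarrow> real) \<Rightarrow> (nat \<Rightarrow> nat) \<Rightarrow> real" where
  "bsum x \<sigma> = (\<Sum>k. x (\<sigma> k))"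

lemma bsum_finite:
  assumes "branch \<sigma>" "\<And>t. q \<le> t \<Longrightarrow> x t = 0"
  shows "bsum x \<sigma> = (\<Sum>k<q. x (\<sigma> k))"
  unfolding bsum_def
proof (rule suminf_finite)
  fix k assume "k \<notin> {..<q}"
  then have "q \<le> \<sigma> k" using branch_ge[OF assms(1), of k] by simp
  then show "x (\<sigma> k) = 0" by (rule assms(2))
qed simp

text \<open>Since \<open>x\<close> is supported from \<open>p\<close> on, a branch may be cut down
  to its nodes from \<open>p\<close> on; branches that meet only below \<open>p\<close> then become
  disjoint segments.\<close>

lemma bsum_sum_family_le:
  assumes x: "x \<in> JT" "\<And>t. x t \<noteq> 0 \<Longrightarrow> p \<le> t \<and> t < q"
    and G: "finite G" "\<And>\<sigma>. \<sigma> \<in> G \<Longrightarrow> branch \<sigma>"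
    and sep: "\<And>\<sigma> \<tau>. \<sigma> \<in> G \<Longrightarrow> \<tau> \<in> G \<Longrightarrow> \<sigma> \<noteq> \<tau> \<Longrightarrow> range \<sigma> \<inter> range \<tau> \<subseteq> {..<p}"
  shows "(\<Sum>\<sigma>\<in>G. (bsum x \<sigma>)\<^sup>2) \<le> (jt_norm x)\<^sup>2"
proof -
  let ?s = "\<lambda>\<sigma>. \<sigma> ` {..<q} \<inter> {p..}"
  have "bsum x \<sigma> = (\<Sum>t\<in>?s \<sigma>. x t)" if "\<sigma> \<in> G" for \<sigma>
  proof -
    have "bsum x \<sigma> = (\<Sum>k<q. x (\<sigma> k))"
      by (rule bsum_finite[OF G(2)[OF that]]) (use x(2) not_less in blast)
    also have "\<dots> = (\<Sum>t\<in>\<sigma> ` {..<q}. x t)" using branch_inj[OF G(2)[OF that]] by (simp add: sum.reindex)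
    also have "\<dots> = (\<Sum>t\<in>?s \<sigma>. x t)"
      by (rule sum.mono_neutral_right) (use x(2) in auto)
    finally show ?thesis .
  qed
  then have "(\<Sum>\<sigma>\<in>G. (bsum x \<sigma>)\<^sup>2) = (\<Sum>\<sigma>\<in>G. (\<Sum>t\<in>?s \<sigma>. x t)\<^sup>2)" by simp
  also have "\<dots> \<le> (jt_norm x)\<^sup>2"
  proof (rule sum_family_le_norm[OF x(1) G(1)])
    show "disjoint_family_on ?s G"
      unfolding disjoint_family_on_def
    proof (intro ballI impI)
      fix \<sigma> \<tau> assume "\<sigma> \<in> G" "\<tau> \<in> G" "\<sigma> \<noteq> \<tau>"
      from sep[OF this] show "?s \<sigma> \<inter> ?s \<tau> = {}" by fastforce
    qed
    show "finite (?s \<sigma>) \<and> segment (?s \<sigma>)" if "\<sigma> \<in> G" for \<sigma>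
      using segment_Int_convex[OF segment_branch[OF G(2)[OF that]]] by simp
  qed
  finally show ?thesis .
qed

lemma bsum_le_norm:
  assumes "x \<in> JT" "\<And>t. x t \<noteq> 0 \<Longrightarrow> p \<le> t \<and> t < q" "branch \<sigma>"
  shows "\<bar>bsum x \<sigma>\<bar> \<le> jt_norm x"
proof -
  have "(\<Sum>\<sigma>\<in>{\<sigma>}. (bsum x \<sigma>)\<^sup>2) \<le> (jt_norm x)\<^sup>2"
    by (rule bsum_sum_family_le[OF assms(1,2)]) (use assms(3) in auto)
  then show ?thesis using jt_norm_nonneg[OF assms(1)] abs_le_square_iff[of "bsum x \<sigma>" "jt_norm x"] by simp
qed

text \<open>A node with shifted index at least \<open>2 ^ Suc R\<close> lies at a level greater than
  \<open>R\<close>, and two branches through one node share all its ancestors.\<close>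

lemma branch_shared_node:
  assumes "branch \<sigma>" "branch \<tau>" "t \<in> range \<sigma>" "t \<in> range \<tau>" "2 ^ Suc R \<le> t + 1"
  shows "\<sigma> R = \<tau> R"
proof -
  obtain i j where ij: "t = \<sigma> i" "t = \<tau> j" using assms(3,4) by blast
  then have "i = j" using branch_same_level[OF assms(1,2)] by simp
  have "(2::nat) ^ Suc R < 2 ^ Suc i"
    using branch_bounds(2)[OF assms(1), of i] assms(5) unfolding ij(1) by linarith
  then have "R < i" by simp
  then show ?thesis using branch_agree[OF assms(1,2), of i R] ij \<open>i = j\<close> by simp
qed

text \<open>Successive intervals share an end point and only containment of the supports is asked,
  so subsequences are block sequences again, the gaps being absorbed into the intervals.\<close>

definition blocks :: "(nat \<Rightarrow> nat) \<Rightarrow> (nat \<Rightarrow> nat \<Rightarrow> real) \<Rightarrow> real \<Rightarrow> bool" where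
  "blocks p x K \<longleftrightarrow> strict_mono p \<and>
     (\<forall>n. x n \<in> JT \<and> jt_norm (x n) \<le> K \<and> (\<forall>t. x n t \<noteq> 0 \<longrightarrow> p n \<le> t \<and> t < p (Suc n)))"

lemma blocksD:
  assumes "blocks p x K"
  shows "strict_mono p" "x n \<in> JT" "jt_norm (x n) \<le> K" "x n t \<noteq> 0 \<Longrightarrow> p n \<le> t \<and> t < p (Suc n)"
  using assms unfolding blocks_def by blast+

lemma blocks_bsum_finite:
  assumes "blocks p x K" "branch \<sigma>"
  shows "bsum (x n) \<sigma> = (\<Sum>k<p (Suc n). x n (\<sigma> k))"
  by (rule bsum_finite[OF assms(2)]) (use blocksD(4)[OF assms(1)] not_less in blast)

section \<open>Branches carrying much of a block, and compactness of the set of branches\<close>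

lemma leftmost_branch: "branch (\<lambda>n. 2 ^ n - 1)"
  by (auto simp: branch_def)

text \<open>Take a largest family of heavy branches that pairwise meet only below \<open>p\<close>.
  The lower l2-estimate bounds its size by \<open>K\<^sup>2 / e\<^sup>2\<close>, and by maximality
  any further heavy branch meets a member at or beyond \<open>p\<close>, hence shares its initial
  part.\<close>

lemma heavy_branches_cover:
  assumes x: "x \<in> JT" "jt_norm x \<le> K" "\<And>t. x t \<noteq> 0 \<Longrightarrow> p \<le> t \<and> t < q" and e: "0 < e"
    and m: "K\<^sup>2 / e\<^sup>2 < real m"
  shows "\<exists>c. (\<forall>i. branch (c i)) \<and>
    (\<forall>\<tau>. branch \<tau> \<longrightarrow> e \<le> \<bar>bsum x \<tau>\<bar> \<longrightarrow> (\<exists>i<m. \<forall>R. 2 ^ Suc R \<le> p + 1 \<longrightarrow> \<tau> R = c i R))"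
proof -
  define Q where "Q G \<longleftrightarrow> finite G \<and> (\<forall>\<sigma>\<in>G. branch \<sigma> \<and> e \<le> \<bar>bsum x \<sigma>\<bar>) \<and>
    (\<forall>\<sigma>\<in>G. \<forall>\<tau>\<in>G. \<sigma> \<noteq> \<tau> \<longrightarrow> range \<sigma> \<inter> range \<tau> \<subseteq> {..<p})" for G
  have card: "card G < m" if "Q G" for G
  proof -
    have "real (card G) * e\<^sup>2 = (\<Sum>\<sigma>\<in>G. e\<^sup>2)" by simp
    also have "\<dots> \<le> (\<Sum>\<sigma>\<in>G. (bsum x \<sigma>)\<^sup>2)"
    proof (rule sum_mono)
      fix \<sigma> assume "\<sigma> \<in> G"
      then have "e \<le> \<bar>bsum x \<sigma>\<bar>" using that by (simp add: Q_def)
      then show "e\<^sup>2 \<le> (bsum x \<sigma>)\<^sup>2" using e abs_le_square_iff[of e "bsum x \<sigma>"] by simp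
    qed
    also have "\<dots> \<le> (jt_norm x)\<^sup>2"
      using that unfolding Q_def by (intro bsum_sum_family_le[OF x(1,3)]) blast+
    also have "\<dots> \<le> K\<^sup>2" using x(2) jt_norm_nonneg[OF x(1)] by (intro power_mono)
    finally have "real (card G) \<le> K\<^sup>2 / e\<^sup>2" using e by (simp add: field_simps)
    then show ?thesis using m by linarith
  qed
  have "Q {}" by (simp add: Q_def)
  then obtain G where G: "Q G" "\<And>H. Q H \<Longrightarrow> card H \<le> card G"
    using ex_has_greatest_nat[of Q "{}" card m] card less_imp_le by metis
  have fin: "finite G" using G(1) by (simp add: Q_def)
  obtain h where h: "bij_betw h {0..<card G} G" using ex_bij_betw_nat_finite[OF fin] by blast
  \<comment> \<open>The enumeration is filled up with the leftmost branch, so that every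
    \<open>c i\<close> is a branch and limits of such enumerations consist of branches.\<close>
  define c where "c i = (if i < card G then h i else (\<lambda>n. 2 ^ n - 1))" for i
  have "branch (c i)" for i
    using G(1) h bij_betwE[OF h] leftmost_branch by (auto simp: c_def Q_def)
  moreover have "\<exists>i<m. \<forall>R. 2 ^ Suc R \<le> p + 1 \<longrightarrow> \<tau> R = c i R"
    if \<tau>: "branch \<tau>" "e \<le> \<bar>bsum x \<tau>\<bar>" for \<tau>
  proof -
    have "\<exists>\<sigma>\<in>G. \<not> range \<sigma> \<inter> range \<tau> \<subseteq> {..<p} \<or> \<sigma> = \<tau>"
    proof (rule ccontr)
      assume neg: "\<not> ?thesis"
      then have "\<tau> \<notin> G" by blast
      have "Q (insert \<tau> G)"
        unfolding Q_def
      proof (intro conjI ballI impI)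
        show "finite (insert \<tau> G)" using fin by simp
        fix \<sigma> assume \<sigma>: "\<sigma> \<in> insert \<tau> G"
        then show "branch \<sigma>" "e \<le> \<bar>bsum x \<sigma>\<bar>" using \<tau> G(1) unfolding Q_def by blast+
        fix \<sigma>' assume \<sigma>': "\<sigma>' \<in> insert \<tau> G" "\<sigma> \<noteq> \<sigma>'"
        show "range \<sigma> \<inter> range \<sigma>' \<subseteq> {..<p}"
        proof (cases "\<sigma> = \<tau> \<or> \<sigma>' = \<tau>")
          case True
          then show ?thesis using neg \<sigma> \<sigma>' by (metis inf_commute insertE)
        next
          case False
          then show ?thesis using G(1) \<sigma> \<sigma>' unfolding Q_def by blast
        qed
      qed
      then have "card (insert \<tau> G) \<le> card G" by (rule G(2))
      then show False using fin \<open>\<tau> \<notin> G\<close> by simp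
    qed
    then obtain \<sigma> where \<sigma>: "\<sigma> \<in> G" "\<not> range \<sigma> \<inter> range \<tau> \<subseteq> {..<p} \<or> \<sigma> = \<tau>" by blast
    have br: "branch \<sigma>" using \<sigma>(1) G(1) by (simp add: Q_def)
    have "\<sigma> \<in> h ` {0..<card G}" using h \<sigma>(1) by (simp add: bij_betw_def)
    then obtain i where i: "i < card G" "\<sigma> = c i" by (auto simp: c_def)
    have "\<tau> R = \<sigma> R" if R: "2 ^ Suc R \<le> p + 1" for R
    proof (cases "\<sigma> = \<tau>")
      case False
      then obtain t where t: "t \<in> range \<sigma>" "t \<in> range \<tau>" "p \<le> t" using \<sigma>(2) by fastforce
      have "2 ^ Suc R \<le> t + 1" using R t(3) by linarith
      then show ?thesis using branch_shared_node[OF br \<tau>(1) t(1,2)] by simp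
    qed simp
    then show ?thesis using i card[OF G(1)] by (intro exI[of _ i]) auto
  qed
  ultimately show ?thesis by blast
qed

text \<open>Sequential compactness of a countable product of finite sets, by a diagonal argument.
  The coordinates will be pairs of a branch number and a level.\<close>

lemma pointwise_constant_subseq:
  fixes f :: "nat \<Rightarrow> 'b::countable \<Rightarrow> nat"
  assumes "\<And>k b. f k b \<le> B b"
  shows "\<exists>r l. strict_mono r \<and> (\<forall>b. \<forall>\<^sub>F n in sequentially. f (r n) b = l b)"
proof -
  \<comment> \<open>Natural numbers stand for the coordinates they encode; a number encoding no
    coordinate imposes no condition.\<close>
  define P where "P n s \<longleftrightarrow> (\<forall>b. to_nat b = n \<longrightarrow> (\<exists>v. \<forall>k. f (s k) b = v))" for n and s :: "nat \<Rightarrow> nat"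
  interpret subseqs P
  proof
    fix n and s :: "nat \<Rightarrow> nat" assume s: "strict_mono s"
    show "\<exists>r'. strict_mono r' \<and> P n (s \<circ> r')"
    proof (cases "\<exists>b::'b. to_nat b = n")
      case True
      then obtain b :: 'b where b: "to_nat b = n" by blast
      have "finite (range (\<lambda>k. f (s k) b))"
      proof (rule finite_subset)
        show "range (\<lambda>k. f (s k) b) \<subseteq> {..B b}" using assms[of _ b] by blast
      qed simp
      then obtain k where inf: "infinite {j \<in> UNIV. f (s j) b = f (s k) b}"
        using pigeonhole_infinite[of UNIV "\<lambda>k. f (s k) b"] by auto
      define r where "r = enumerate {j. f (s j) b = f (s k) b}"
      have "strict_mono r" unfolding r_def using inf by (intro strict_mono_enumerate) simp
      moreover have fr: "f (s (r j)) b = f (s k) b" for j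
        using enumerate_in_set[of "{j. f (s j) b = f (s k) b}" j] inf by (simp add: r_def)
      have "P n (s \<circ> r)"
        unfolding P_def
      proof (intro allI impI)
        fix b' :: 'b assume "to_nat b' = n"
        then have "b' = b" using b by (metis from_nat_to_nat)
        then show "\<exists>v. \<forall>k. f ((s \<circ> r) k) b' = v" using fr by auto
      qed
      ultimately show ?thesis by blast
    next
      case False
      then show ?thesis unfolding P_def using strict_mono_id by blast
    qed
  qed
  have dP: "P k (diagseq \<circ> ((+) (Suc k)))" for k
  proof (rule diagseq_holds)
    fix n and r s :: "nat \<Rightarrow> nat" assume "P n s"
    then show "P n (s \<circ> r)" unfolding P_def by auto
  qed
  have "\<exists>v. \<forall>k. f (diagseq (Suc (to_nat b) + k)) b = v" for b
    using dP[of "to_nat b"] unfolding P_def by simp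
  then obtain l where l: "\<And>b k. f (diagseq (Suc (to_nat b) + k)) b = l b" by metis
  have "\<forall>\<^sub>F n in sequentially. f (diagseq n) b = l b" for b
    unfolding eventually_sequentially
  proof (intro exI allI impI)
    fix n assume "Suc (to_nat b) \<le> n"
    then show "f (diagseq n) b = l b" using l[of b "n - Suc (to_nat b)"] by simp
  qed
  then show ?thesis using subseq_diagseq by blast
qed

section \<open>Upper l2-estimates for branch-null block sequences\<close>

text \<open>The branches covering the heavy ones of \<open>x k\<close> converge levelwise, along a
  subsequence, to \<open>m\<close> limit branches. An index \<open>j\<close> is taken at which all
  limit branches are light. For late \<open>k\<close>, a branch heavy for \<open>x k\<close> agrees
  with a limit branch throughout the support of \<open>x j\<close>, so it is light for
  \<open>x j\<close>.\<close>

lemma greedy_step: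
  assumes B: "blocks p x K" and null: "\<And>\<sigma>. branch \<sigma> \<Longrightarrow> (\<lambda>n. bsum (x n) \<sigma>) \<longlonglongrightarrow> 0"
    and A: "infinite A" and e: "0 < e"
  shows "\<exists>j A'. j \<in> A \<and> A' \<subseteq> A \<and> infinite A' \<and>
    (\<forall>k\<in>A'. j < k \<and> (\<forall>\<sigma>. branch \<sigma> \<longrightarrow> \<bar>bsum (x j) \<sigma>\<bar> < e \<or> \<bar>bsum (x k) \<sigma>\<bar> < e))"
proof -
  note p = blocksD(1)[OF B]
  obtain m :: nat where m: "K\<^sup>2 / e\<^sup>2 < real m" using reals_Archimedean2 by blast
  have "\<exists>c. (\<forall>i. branch (c i)) \<and> (\<forall>\<tau>. branch \<tau> \<longrightarrow> e \<le> \<bar>bsum (x k) \<tau>\<bar> \<longrightarrow>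
      (\<exists>i<m. \<forall>R. 2 ^ Suc R \<le> p k + 1 \<longrightarrow> \<tau> R = c i R))" for k
    by (rule heavy_branches_cover[OF blocksD(2-4)[OF B] e m])
  then obtain c where c: "\<And>k i. branch (c k i)"
    and cover: "\<And>k \<tau>. branch \<tau> \<Longrightarrow> e \<le> \<bar>bsum (x k) \<tau>\<bar> \<Longrightarrow>
      \<exists>i<m. \<forall>R. 2 ^ Suc R \<le> p k + 1 \<longrightarrow> \<tau> R = c k i R"
    by metis
  define a where "a = enumerate A"
  have a: "strict_mono a" "\<And>n. a n \<in> A"
    unfolding a_def using A by (auto intro: strict_mono_enumerate enumerate_in_set)
  define f where "f k = (\<lambda>(i, R). c (a k) i R)" for k
  have "f k b \<le> 2 ^ Suc (snd b)" for k b
    using branch_bounds(2)[OF c, of "a k" "fst b" "snd b"] unfolding f_def split_beta by linarith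
  then obtain r l where r: "strict_mono r" and l: "\<And>b. \<forall>\<^sub>F n in sequentially. f (r n) b = l b"
    using pointwise_constant_subseq[of f "\<lambda>b. 2 ^ Suc (snd b)"] by blast
  define \<sigma> where "\<sigma> i R = l (i, R)" for i R
  define b where "b = a \<circ> r"
  have b: "strict_mono b" "\<And>n. b n \<in> A" using a r by (auto simp: b_def strict_mono_o)
  have lim: "\<forall>\<^sub>F n in sequentially. c (b n) i R = \<sigma> i R" for i R
    using l[of "(i, R)"] by (simp add: f_def b_def \<sigma>_def)
  have br: "branch (\<sigma> i)" for i
    unfolding branch_def
  proof (intro conjI allI)
    obtain n where "c (b n) i 0 = \<sigma> i 0"
      using eventually_happens[OF lim[of i 0]] by auto
    then show "\<sigma> i 0 = 0" using c[of "b n" i] unfolding branch_def by simp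
    fix R
    obtain n where "c (b n) i R = \<sigma> i R" "c (b n) i (Suc R) = \<sigma> i (Suc R)"
      using eventually_happens[OF eventually_conj[OF lim[of i R] lim[of i "Suc R"]]] by auto
    then show "\<sigma> i R + 1 = (\<sigma> i (Suc R) + 1) div 2"
      using branch_step[OF c[of "b n" i], of R] by simp
  qed
  have small: "\<forall>\<^sub>F n in sequentially. \<forall>i\<in>{..<m}. \<bar>bsum (x (b n)) (\<sigma> i)\<bar> < e"
  proof (intro eventually_ball_finite ballI)
    fix i
    have "(\<lambda>n. bsum (x (b n)) (\<sigma> i)) \<longlonglongrightarrow> 0"
      using LIMSEQ_subseq_LIMSEQ[OF null[OF br[of i]] b(1)] by (simp add: comp_def)
    then have "(\<lambda>n. \<bar>bsum (x (b n)) (\<sigma> i)\<bar>) \<longlonglongrightarrow> 0" by (rule tendsto_rabs_zero)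
    then show "\<forall>\<^sub>F n in sequentially. \<bar>bsum (x (b n)) (\<sigma> i)\<bar> < e"
      using e by (rule order_tendstoD(2))
  qed simp
  obtain n0 where n0: "\<And>i. i < m \<Longrightarrow> \<bar>bsum (x (b n0)) (\<sigma> i)\<bar> < e"
    using eventually_happens[OF small] by auto
  define j where "j = b n0"
  \<comment> \<open>The node of a branch at level \<open>R\<close> has number at least
    \<open>R\<close>, so agreement up to this level fixes the branch sum of
    \<open>x j\<close>.\<close>
  define R where "R = p (Suc j)"
  have "\<forall>\<^sub>F n in sequentially. \<forall>i\<in>{..<m}. c (b n) i R = \<sigma> i R"
    using lim by (intro eventually_ball_finite) auto
  then obtain n1 where n1: "\<And>n i. n1 \<le> n \<Longrightarrow> i < m \<Longrightarrow> c (b n) i R = \<sigma> i R"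
    unfolding eventually_sequentially by auto
  \<comment> \<open>The last bound makes \<open>x k\<close> start so far out that a heavy branch
    agrees with its covering branch at level \<open>R\<close>.\<close>
  define n2 where "n2 = max (max n1 (Suc n0)) (2 ^ Suc R)"
  let ?A' = "b ` {n2..}"
  have "infinite ?A'" using b(1) by (simp add: finite_image_iff strict_mono_imp_inj_on inj_on_subset infinite_Ici)
  moreover have "j < k \<and> (\<forall>\<tau>. branch \<tau> \<longrightarrow> \<bar>bsum (x j) \<tau>\<bar> < e \<or> \<bar>bsum (x k) \<tau>\<bar> < e)" if k: "k \<in> ?A'" for k
  proof (intro conjI allI impI)
    obtain n where n: "k = b n" "n2 \<le> n" using k by auto
    have ge: "n1 \<le> n" "n0 < n" "2 ^ Suc R \<le> n" using n(2) unfolding n2_def by linarith+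
    show "j < k" unfolding j_def n(1) using b(1) ge(2) by (rule strict_monoD)
    fix \<tau> assume \<tau>: "branch \<tau>"
    show "\<bar>bsum (x j) \<tau>\<bar> < e \<or> \<bar>bsum (x k) \<tau>\<bar> < e"
    proof (cases "e \<le> \<bar>bsum (x k) \<tau>\<bar>")
      case True
      then obtain i where i: "i < m" "\<forall>R. 2 ^ Suc R \<le> p k + 1 \<longrightarrow> \<tau> R = c k i R" using cover[OF \<tau>] by blast
      have "n \<le> k" "k \<le> p k" unfolding n(1) using strict_mono_imp_increasing b(1) p by blast+
      then have "2 ^ Suc R \<le> p k + 1" using ge(3) by linarith
      then have "\<tau> R = c k i R" using i(2) by blast
      also have "\<dots> = \<sigma> i R" using n1[OF ge(1) i(1)] n(1) by simp
      finally have agree: "\<tau> q = \<sigma> i q" if "q \<le> R" for q using branch_agree[OF \<tau> br _ that] by blast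
      have "bsum (x j) \<tau> = bsum (x j) (\<sigma> i)"
        unfolding blocks_bsum_finite[OF B \<tau>] blocks_bsum_finite[OF B br]
        using agree by (intro sum.cong) (auto simp: R_def)
      then show ?thesis using n0[OF i(1)] by (simp add: j_def)
    qed auto
  qed
  moreover have "?A' \<subseteq> A" "j \<in> A" using b(2) by (auto simp: j_def)
  ultimately show ?thesis by blast
qed

text \<open>Each element of \<open>H\<close> except the least is controlled by its predecessor, so
  the sum is dominated after a shift of the index.\<close>

lemma sum_heavy_le:
  fixes v :: "nat \<Rightarrow> real"
  assumes "finite H" "\<And>j k. j \<in> H \<Longrightarrow> k \<in> H \<Longrightarrow> j < k \<Longrightarrow> (v k)\<^sup>2 \<le> (d j)\<^sup>2"
  shows "(\<Sum>k\<in>H - {Min H}. (v k)\<^sup>2) \<le> (\<Sum>j\<in>H. (d j)\<^sup>2)"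
proof (cases "H = {}")
  case False
  \<comment> \<open>The right side omits the maximum, so that the induction can spend
    \<open>d (Max A)\<close> on the newly added largest element.\<close>
  have "(\<Sum>k\<in>H - {Min H}. (v k)\<^sup>2) \<le> (\<Sum>j\<in>H - {Max H}. (d j)\<^sup>2)"
    using assms(1) False assms(2)
  proof (induction H rule: finite_linorder_max_induct)
    case (insert b A)
    show ?case
    proof (cases "A = {}")
      case False
      let ?m = "Max A"
      have A: "finite A" "?m \<in> A" "Min A \<in> A" using insert False by auto
      have bA: "b \<notin> A" using insert by auto
      have max: "Max (insert b A) = b" using insert False by (simp add: max_absorb1 less_imp_le)
      have min: "Min (insert b A) = Min A"
      proof (rule Min_eqI)
        fix y assume "y \<in> insert b A"
        then show "Min A \<le> y" using insert.hyps(2) A by (auto intro: less_imp_le)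
      qed (use A in auto)
      have "(\<Sum>k\<in>insert b A - {Min A}. (v k)\<^sup>2) = (v b)\<^sup>2 + (\<Sum>k\<in>A - {Min A}. (v k)\<^sup>2)"
        using A bA by (subst insert_Diff_if) auto
      also have "\<dots> \<le> (d ?m)\<^sup>2 + (\<Sum>j\<in>A - {?m}. (d j)\<^sup>2)"
        using insert A False by (intro add_mono insert.prems(2) insert.IH) auto
      also have "\<dots> = (\<Sum>j\<in>A. (d j)\<^sup>2)" using A by (simp add: sum.remove)
      finally have "(\<Sum>k\<in>insert b A - {Min A}. (v k)\<^sup>2) \<le> (\<Sum>j\<in>A. (d j)\<^sup>2)" .
      moreover have "insert b A - {b} = A" using bA by auto
      ultimately show ?thesis by (simp only: max min)
    qed simp
  qed simp
  also have "\<dots> \<le> (\<Sum>j\<in>H. (d j)\<^sup>2)" using assms(1) by (intro sum_mono2) auto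
  finally show ?thesis .
qed simp

text \<open>A segment crossing whole blocks sees at most one of them substantially; the exceptional set consists of
  that block and of the two blocks containing the end points of the segment.\<close>
lemma segment_exceptional_blocks:
  assumes B: "blocks p x K" and d: "\<And>j. 0 < d j"
    and sep: "\<And>j k \<sigma>. j < k \<Longrightarrow> branch \<sigma> \<Longrightarrow> \<bar>bsum (x j) \<sigma>\<bar> < d j \<or> \<bar>bsum (x k) \<sigma>\<bar> < d j"
    and s: "finite s" "segment s" "s \<noteq> {}"
  shows "\<exists>E\<subseteq>{..<n}. card E \<le> 3 \<and>
    (\<Sum>k\<in>{..<n} - E. (\<Sum>t\<in>s. x k t)\<^sup>2) \<le> 2 * (\<Sum>j\<in>{j\<in>{..<n}. Min s < p j}. (d j)\<^sup>2)"
proof -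
  note p = blocksD(1)[OF B]
  obtain \<sigma> i m where \<sigma>: "branch \<sigma>" "i \<le> m" "s = \<sigma> ` {i..m}"
    using finite_segment_branch[OF s] by blast
  note mono = branch_strict_mono[OF \<sigma>(1)]
  define v where "v k = (\<Sum>t\<in>s. x k t)" for k
  have Min: "Min s = \<sigma> i"
    unfolding \<sigma>(3) using \<sigma>(2) strict_mono_less_eq[OF mono] by (intro Min_eqI) auto
  \<comment> \<open>\<open>Cr\<close> contains the blocks traversed completely, where the segment
    sum is the full branch sum; \<open>E1\<close> and \<open>E2\<close> catch the blocks in which
    the segment starts and ends.\<close>
  define Cr where "Cr = {k\<in>{..<n}. \<sigma> i < p k \<and> p (Suc k) \<le> \<sigma> m}"
  define E1 where "E1 = {k\<in>{..<n}. p k \<le> \<sigma> i \<and> \<sigma> i < p (Suc k)}"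
  define E2 where "E2 = {k\<in>{..<n}. p k \<le> \<sigma> m \<and> \<sigma> m < p (Suc k)}"
  have uniq: "card {k\<in>{..<n}. p k \<le> t \<and> t < p (Suc k)} \<le> 1" for t
  proof -
    have "a = b" if "p a \<le> t" "t < p (Suc a)" "p b \<le> t" "t < p (Suc b)" for a b
    proof -
      have "p a < p (Suc b)" "p b < p (Suc a)" using that by linarith+
      then show ?thesis using strict_mono_less[OF p] by simp
    qed
    then show ?thesis by (subst card_le_Suc0_iff_eq[simplified One_nat_def[symmetric]]) auto
  qed
  have v0: "v k = 0" if "k < n" "k \<notin> Cr" "k \<notin> E1" "k \<notin> E2" for k
  proof -
    have "x k t = 0" if t: "t \<in> s" for t
    proof (rule ccontr)
      assume "x k t \<noteq> 0"
      then have *: "p k \<le> t" "t < p (Suc k)" using blocksD(4)[OF B] by blast+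
      obtain j where j: "t = \<sigma> j" "i \<le> j" "j \<le> m" using t \<sigma>(3) by auto
      have "\<sigma> i \<le> t" "t \<le> \<sigma> m" using j strict_mono_less_eq[OF mono] by auto
      then show False
        using * \<open>k < n\<close> \<open>k \<notin> Cr\<close> \<open>k \<notin> E1\<close> \<open>k \<notin> E2\<close> unfolding Cr_def E1_def E2_def by auto
    qed
    then show ?thesis by (simp add: v_def)
  qed
  have vCr: "v k = bsum (x k) \<sigma>" if k: "k \<in> Cr" for k
  proof -
    have "v k = (\<Sum>j\<in>{i..m}. x k (\<sigma> j))"
      unfolding v_def \<sigma>(3) using branch_inj[OF \<sigma>(1)] by (simp add: sum.reindex)
    also have "\<dots> = (\<Sum>j. x k (\<sigma> j))"
    proof (rule suminf_finite[symmetric])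
      fix j assume j: "j \<notin> {i..m}"
      show "x k (\<sigma> j) = 0"
      proof (rule ccontr)
        assume "x k (\<sigma> j) \<noteq> 0"
        then have "p k \<le> \<sigma> j" "\<sigma> j < p (Suc k)" using blocksD(4)[OF B] by blast+
        then have "\<sigma> i < \<sigma> j" "\<sigma> j < \<sigma> m" using k unfolding Cr_def by auto
        then show False using j strict_mono_less[OF mono] by auto
      qed
    qed simp
    finally show ?thesis by (simp add: bsum_def)
  qed
  define H where "H = {k\<in>Cr. d k \<le> \<bar>v k\<bar>}"
  have fin: "finite Cr" "finite H" by (auto simp: Cr_def H_def)
  \<comment> \<open>Besides the two end blocks only the first heavy block is exceptional: by
    \<open>sep\<close>, at a later heavy block \<open>k\<close> the sum \<open>v k\<close> is below
    \<open>d j\<close> for every earlier heavy \<open>j\<close>.\<close>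
  define E where "E = E1 \<union> E2 \<union> (if H = {} then {} else {Min H})"
  have "E \<subseteq> {..<n}" using Min_in[OF fin(2)] by (auto simp: E_def E1_def E2_def H_def Cr_def)
  moreover have "card E \<le> 3"
  proof -
    have "card E \<le> card (E1 \<union> E2) + card (if H = {} then {} else {Min H})"
      unfolding E_def by (rule card_Un_le)
    also have "\<dots> \<le> (card E1 + card E2) + 1" by (intro add_mono card_Un_le) auto
    also have "\<dots> \<le> 3" using uniq[of "\<sigma> i"] uniq[of "\<sigma> m"] by (simp add: E1_def E2_def)
    finally show ?thesis .
  qed
  moreover have "(\<Sum>k\<in>{..<n} - E. (v k)\<^sup>2) \<le> 2 * (\<Sum>j\<in>{j\<in>{..<n}. Min s < p j}. (d j)\<^sup>2)"
  proof -
    let ?J = "{j\<in>{..<n}. Min s < p j}"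
    have CrJ: "Cr \<subseteq> ?J" by (auto simp: Cr_def Min)
    have heavy: "(\<Sum>k\<in>H - {Min H}. (v k)\<^sup>2) \<le> (\<Sum>j\<in>H. (d j)\<^sup>2)"
    proof (rule sum_heavy_le[OF fin(2)])
      fix j k assume jk: "j \<in> H" "k \<in> H" "j < k"
      then have "\<not> \<bar>bsum (x j) \<sigma>\<bar> < d j" using vCr by (auto simp: H_def)
      then have "\<bar>v k\<bar> \<le> d j" using sep[OF jk(3) \<sigma>(1)] vCr[of k] jk by (auto simp: H_def)
      then show "(v k)\<^sup>2 \<le> (d j)\<^sup>2" using d[of j] abs_le_square_iff[of "v k" "d j"] by simp
    qed
    have light: "(\<Sum>k\<in>Cr - H. (v k)\<^sup>2) \<le> (\<Sum>k\<in>Cr - H. (d k)\<^sup>2)"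
    proof (rule sum_mono)
      fix k assume "k \<in> Cr - H"
      then have "\<bar>v k\<bar> \<le> d k" by (auto simp: H_def)
      then show "(v k)\<^sup>2 \<le> (d k)\<^sup>2" using d[of k] abs_le_square_iff[of "v k" "d k"] by simp
    qed
    have "(\<Sum>k\<in>{..<n} - E. (v k)\<^sup>2) \<le> (\<Sum>k\<in>(H - {Min H}) \<union> (Cr - H). (v k)\<^sup>2)"
    proof -
      have "(\<Sum>k\<in>{..<n} - E. (v k)\<^sup>2) = (\<Sum>k\<in>Cr - E. (v k)\<^sup>2)"
      proof (rule sum.mono_neutral_right)
        show "\<forall>k\<in>{..<n} - E - (Cr - E). (v k)\<^sup>2 = 0" using v0 by (auto simp: E_def)
      qed (auto simp: Cr_def)
      also have "\<dots> \<le> (\<Sum>k\<in>(H - {Min H}) \<union> (Cr - H). (v k)\<^sup>2)"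
        using fin by (intro sum_mono2) (auto simp: E_def split: if_splits)
      finally show ?thesis .
    qed
    also have "\<dots> = (\<Sum>k\<in>H - {Min H}. (v k)\<^sup>2) + (\<Sum>k\<in>Cr - H. (v k)\<^sup>2)"
      using fin by (intro sum.union_disjoint) auto
    also have "\<dots> \<le> (\<Sum>j\<in>H. (d j)\<^sup>2) + (\<Sum>k\<in>Cr - H. (d k)\<^sup>2)" by (rule add_mono[OF heavy light])
    also have "\<dots> \<le> (\<Sum>j\<in>?J. (d j)\<^sup>2) + (\<Sum>j\<in>?J. (d j)\<^sup>2)"
      using CrJ by (intro add_mono sum_mono2) (auto simp: H_def)
    finally show ?thesis by simp
  qed
  ultimately show ?thesis unfolding v_def by blast
qed

text \<open>Disjoint nonempty segments have distinct least nodes.\<close>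

lemma card_segments_le:
  assumes "seg_fam S"
  shows "card {s\<in>S. s \<noteq> {} \<and> Min s < q} \<le> q"
proof -
  have "inj_on Min {s\<in>S. s \<noteq> {} \<and> Min s < q}"
  proof (rule inj_onI)
    fix s s' assume *: "s \<in> {s\<in>S. s \<noteq> {} \<and> Min s < q}" "s' \<in> {s\<in>S. s \<noteq> {} \<and> Min s < q}" "Min s = Min s'"
    then have "Min s \<in> s" "Min s \<in> s'" using assms Min_in[of s] Min_in[of s'] by (auto simp: seg_fam_def)
    then have "s \<inter> s' \<noteq> {}" by blast
    then show "s = s'" using * assms unfolding seg_fam_def disjoint_def by blast
  qed
  then have "card {s\<in>S. s \<noteq> {} \<and> Min s < q} \<le> card {..<q}"
    by (rule card_inj_on_le) auto
  then show ?thesis by simp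
qed

text \<open>For one segment, split the sum into the at most three exceptional blocks and the rest.
  Squaring the split costs 2 and Cauchy-Schwarz on three terms costs 3, which gives
  \<open>6 * K\<^sup>2\<close> after summation over disjoint segments. The rest contributes
  \<open>4 * W\<close> times the sum of \<open>(d j)\<^sup>2\<close> over the segments and the
  blocks after their starts; \<open>d j\<close> occurs for at most \<open>p j\<close> segments, so
  this is at most \<open>8 * W\<close>.\<close>

lemma upper2_separated:
  assumes B: "blocks p x K" and d: "\<And>j. 0 < d j" "\<And>j. real (p j) * (d j)\<^sup>2 \<le> (1/2) ^ j"
    and sep: "\<And>j k \<sigma>. j < k \<Longrightarrow> branch \<sigma> \<Longrightarrow> \<bar>bsum (x j) \<sigma>\<bar> < d j \<or> \<bar>bsum (x k) \<sigma>\<bar> < d j"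
  shows "upper2 jt_norm x (sqrt (6 * K\<^sup>2 + 8))"
  unfolding upper2_def
proof (intro conjI allI)
  show "0 \<le> sqrt (6 * K\<^sup>2 + 8)" by simp
  fix n and c :: "nat \<Rightarrow> real"
  define z where "z = (\<lambda>t. \<Sum>k<n. c k * x k t)"
  define W where "W = (\<Sum>k<n. (c k)\<^sup>2)"
  have W: "0 \<le> W" by (simp add: W_def sum_nonneg)
  have "seg_val S z \<le> (sqrt (6 * K\<^sup>2 + 8) * sqrt W)\<^sup>2" if S: "seg_fam S" for S
  proof -
    define v where "v s k = (\<Sum>t\<in>s. x k t)" for s k
    define S' where "S' = {s\<in>S. s \<noteq> {}}"
    let ?J = "\<lambda>s. {j\<in>{..<n}. Min s < p j}"
    have finS: "finite S" "finite S'" using S by (auto simp: seg_fam_def S'_def)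
    have z_sum: "(\<Sum>t\<in>s. z t) = (\<Sum>k<n. c k * v s k)" for s
      unfolding z_def v_def by (subst sum.swap) (simp add: sum_distrib_left)
    have per: "(\<Sum>t\<in>s. z t)\<^sup>2 \<le> 6 * (\<Sum>k<n. (c k)\<^sup>2 * (v s k)\<^sup>2) + 4 * W * (\<Sum>j\<in>?J s. (d j)\<^sup>2)"
      if s: "s \<in> S'" for s
    proof -
      have "finite s" "segment s" "s \<noteq> {}" using s S by (auto simp: S'_def seg_fam_def)
      from segment_exceptional_blocks[of p x K d, OF B d(1) sep this, of n]
      obtain E where E: "E \<subseteq> {..<n}" "card E \<le> 3"
        "(\<Sum>k\<in>{..<n} - E. (v s k)\<^sup>2) \<le> 2 * (\<Sum>j\<in>?J s. (d j)\<^sup>2)"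
        unfolding v_def by blast
      let ?a = "\<Sum>k\<in>E. c k * v s k" and ?b = "\<Sum>k\<in>{..<n} - E. c k * v s k"
      have "(\<Sum>t\<in>s. z t) = ?b + ?a" unfolding z_sum using E(1) by (intro sum.subset_diff) auto
      moreover have "(?b + ?a)\<^sup>2 \<le> 2 * ?a\<^sup>2 + 2 * ?b\<^sup>2"
        using sum_squares_bound[of ?b ?a] by (simp add: power2_sum)
      moreover have "?a\<^sup>2 \<le> 3 * (\<Sum>k<n. (c k)\<^sup>2 * (v s k)\<^sup>2)"
      proof -
        have "?a\<^sup>2 \<le> (\<Sum>k\<in>E. (c k * v s k)\<^sup>2) * real (card E)"
          by (rule sum_squared_le_sum_of_squares)
        also have "\<dots> \<le> (\<Sum>k<n. (c k * v s k)\<^sup>2) * 3"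
          using E by (intro mult_mono sum_mono2) (auto simp: sum_nonneg)
        finally show ?thesis by (simp add: power_mult_distrib mult.commute)
      qed
      moreover have "?b\<^sup>2 \<le> W * (2 * (\<Sum>j\<in>?J s. (d j)\<^sup>2))"
      proof -
        have "?b\<^sup>2 \<le> (\<Sum>k\<in>{..<n} - E. (c k)\<^sup>2) * (\<Sum>k\<in>{..<n} - E. (v s k)\<^sup>2)"
          by (rule Cauchy_Schwarz_ineq_sum)
        also have "\<dots> \<le> W * (2 * (\<Sum>j\<in>?J s. (d j)\<^sup>2))"
          unfolding W_def using E(3) by (intro mult_mono sum_mono2) (auto simp: sum_nonneg)
        finally show ?thesis .
      qed
      ultimately show ?thesis by simp
    qed
    have "seg_val S z = (\<Sum>s\<in>S'. (\<Sum>t\<in>s. z t)\<^sup>2)"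
      unfolding seg_val_def S'_def using finS by (intro sum.mono_neutral_right) auto
    also have "\<dots> \<le> (\<Sum>s\<in>S'. 6 * (\<Sum>k<n. (c k)\<^sup>2 * (v s k)\<^sup>2) + 4 * W * (\<Sum>j\<in>?J s. (d j)\<^sup>2))"
      by (rule sum_mono[OF per])
    also have "\<dots> = 6 * (\<Sum>s\<in>S'. \<Sum>k<n. (c k)\<^sup>2 * (v s k)\<^sup>2) + 4 * W * (\<Sum>s\<in>S'. \<Sum>j\<in>?J s. (d j)\<^sup>2)"
      by (simp add: sum.distrib sum_distrib_left)
    also have "(\<Sum>s\<in>S'. \<Sum>k<n. (c k)\<^sup>2 * (v s k)\<^sup>2) \<le> K\<^sup>2 * W"
    proof -
      have "(\<Sum>s\<in>S'. \<Sum>k<n. (c k)\<^sup>2 * (v s k)\<^sup>2) = (\<Sum>k<n. (c k)\<^sup>2 * (\<Sum>s\<in>S'. (v s k)\<^sup>2))"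
        by (subst sum.swap) (simp add: sum_distrib_left)
      also have "\<dots> \<le> (\<Sum>k<n. (c k)\<^sup>2 * K\<^sup>2)"
      proof (intro sum_mono mult_left_mono)
        fix k
        have "(\<Sum>s\<in>S'. (v s k)\<^sup>2) \<le> seg_val S (x k)"
          unfolding seg_val_def v_def using finS by (intro sum_mono2) (auto simp: S'_def)
        also have "\<dots> \<le> (jt_norm (x k))\<^sup>2" by (rule seg_val_le_norm[OF blocksD(2)[OF B] S])
        also have "\<dots> \<le> K\<^sup>2" by (rule power_mono[OF blocksD(3)[OF B] jt_norm_nonneg[OF blocksD(2)[OF B]]])
        finally show "(\<Sum>s\<in>S'. (v s k)\<^sup>2) \<le> K\<^sup>2" .
      qed simp
      finally show ?thesis by (simp add: W_def sum_distrib_left mult.commute)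
    qed
    also have "(\<Sum>s\<in>S'. \<Sum>j\<in>?J s. (d j)\<^sup>2) \<le> 2"
    proof -
      have "(\<Sum>s\<in>S'. \<Sum>j\<in>?J s. (d j)\<^sup>2) = (\<Sum>j\<in>{..<n}. \<Sum>s\<in>{s\<in>S'. Min s < p j}. (d j)\<^sup>2)"
        by (rule sum.swap_restrict) (use finS in auto)
      also have "\<dots> \<le> (\<Sum>j<n. (1/2) ^ j)"
      proof (rule sum_mono)
        fix j
        have "{s\<in>S'. Min s < p j} = {s\<in>S. s \<noteq> {} \<and> Min s < p j}" by (auto simp: S'_def)
        then have "card {s\<in>S'. Min s < p j} \<le> p j" using card_segments_le[OF S] by simp
        then have "(\<Sum>s\<in>{s\<in>S'. Min s < p j}. (d j)\<^sup>2) \<le> real (p j) * (d j)\<^sup>2"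
          by (simp add: mult_right_mono)
        also have "\<dots> \<le> (1/2) ^ j" by (rule d(2))
        finally show "(\<Sum>s\<in>{s\<in>S'. Min s < p j}. (d j)\<^sup>2) \<le> (1/2) ^ j" .
      qed
      also have "\<dots> \<le> 2" by (simp add: sum_gp_strict)
      finally show ?thesis .
    qed
    finally have "seg_val S z \<le> 6 * (K\<^sup>2 * W) + 4 * W * 2" using W by (simp add: mult_left_mono)
    also have "\<dots> = (sqrt (6 * K\<^sup>2 + 8) * sqrt W)\<^sup>2"
      using W by (simp add: power_mult_distrib algebra_simps)
    finally show ?thesis .
  qed
  then have "jt_norm z \<le> sqrt (6 * K\<^sup>2 + 8) * sqrt W"
    by (rule JT_I(2)) (use W in \<open>auto intro!: mult_nonneg_nonneg\<close>)
  then show "jt_norm (\<lambda>t. \<Sum>k<n. c k * x k t) \<le> sqrt (6 * K\<^sup>2 + 8) * sqrt (\<Sum>k<n. (c k)\<^sup>2)"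
    by (simp add: z_def W_def)
qed

text \<open>Iterating the greedy step yields the indices \<open>r n\<close> together with the
  infinite sets from which later ones are taken. The tolerance for a block has to be fixed before
  its index is known, so it refers to the end of the previously chosen block.\<close>

lemma branch_null_upper2:
  assumes B: "blocks p x K" and null: "\<And>\<sigma>. branch \<sigma> \<Longrightarrow> (\<lambda>n. bsum (x n) \<sigma>) \<longlonglongrightarrow> 0"
  shows "\<exists>r C. strict_mono r \<and> upper2 jt_norm (x \<circ> r) C"
proof -
  note p = blocksD(1)[OF B]
  \<comment> \<open>Makes \<open>real q * (e k q)\<^sup>2\<close> at most \<open>(1/2) ^ k\<close>,
    the hypothesis of \<open>upper2_separated\<close>; the added 1 covers
    \<open>q = 0\<close>.\<close>
  define e where "e k q = 1 / sqrt (2 ^ k * (real q + 1))" for k q :: nat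
  have e_pos: "0 < e k q" for k q by (simp add: e_def)
  have e_sq: "real q * (e k q)\<^sup>2 \<le> (1/2) ^ k" for k q
  proof -
    have "real q * (e k q)\<^sup>2 = (1/2) ^ k * (real q / (real q + 1))"
      by (simp add: e_def power_divide power_one_over)
    also have "\<dots> \<le> (1/2) ^ k * 1" by (intro mult_left_mono) auto
    finally show ?thesis by simp
  qed
  define good where "good E j A \<longleftrightarrow> infinite A \<and>
      (\<forall>k\<in>A. j < k \<and> (\<forall>\<sigma>. branch \<sigma> \<longrightarrow> \<bar>bsum (x j) \<sigma>\<bar> < E \<or> \<bar>bsum (x k) \<sigma>\<bar> < E))" for E :: real and j A
  have step: "\<exists>j A'. j \<in> A \<and> A' \<subseteq> A \<and> good E j A'" if "infinite A" "0 < E" for A E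
    using greedy_step[OF B null that] unfolding good_def by blast
  have "\<exists>f. \<forall>n. (infinite (snd (f n))) \<and> (n = 0 \<longrightarrow> good (e 0 0) (fst (f 0)) (snd (f 0))) \<and>
      (fst (f (Suc n)) \<in> snd (f n) \<and> snd (f (Suc n)) \<subseteq> snd (f n) \<and>
        good (e (Suc n) (p (Suc (fst (f n))))) (fst (f (Suc n))) (snd (f (Suc n))))"
  proof -
    obtain f where f: "\<And>n. infinite (snd (f n)) \<and> (n = 0 \<longrightarrow> good (e 0 0) (fst (f n)) (snd (f n)))"
      "\<And>n. fst (f (Suc n)) \<in> snd (f n) \<and> snd (f (Suc n)) \<subseteq> snd (f n) \<and>
        good (e (Suc n) (p (Suc (fst (f n))))) (fst (f (Suc n))) (snd (f (Suc n)))"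
    proof (rule exE[OF dependent_nat_choice[of
        "\<lambda>n a. infinite (snd a) \<and> (n = 0 \<longrightarrow> good (e 0 0) (fst a) (snd a))"
        "\<lambda>n a b. fst b \<in> snd a \<and> snd b \<subseteq> snd a \<and> good (e (Suc n) (p (Suc (fst a)))) (fst b) (snd b)"]])
      obtain j A where "good (e 0 0) j A" using step[of UNIV "e 0 0"] e_pos by blast
      then show "\<exists>a. infinite (snd a) \<and> (0 = 0 \<longrightarrow> good (e 0 0) (fst a) (snd a))"
        by (intro exI[of _ "(j, A)"]) (simp add: good_def)
      fix a :: "nat \<times> nat set" and n :: nat
      assume a: "infinite (snd a) \<and> (n = 0 \<longrightarrow> good (e 0 0) (fst a) (snd a))"
      then obtain j A where "j \<in> snd a" "A \<subseteq> snd a" "good (e (Suc n) (p (Suc (fst a)))) j A"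
        using step[of "snd a" "e (Suc n) (p (Suc (fst a)))"] e_pos by blast
      then show "\<exists>b. (infinite (snd b) \<and> (Suc n = 0 \<longrightarrow> good (e 0 0) (fst b) (snd b))) \<and>
          fst b \<in> snd a \<and> snd b \<subseteq> snd a \<and> good (e (Suc n) (p (Suc (fst a)))) (fst b) (snd b)"
        by (intro exI[of _ "(j, A)"]) (simp add: good_def)
    qed blast
    then show ?thesis by blast
  qed
  then obtain f where f: "\<And>n. infinite (snd (f n))" "good (e 0 0) (fst (f 0)) (snd (f 0))"
    "\<And>n. fst (f (Suc n)) \<in> snd (f n)" "\<And>n. snd (f (Suc n)) \<subseteq> snd (f n)"
    "\<And>n. good (e (Suc n) (p (Suc (fst (f n))))) (fst (f (Suc n))) (snd (f (Suc n)))"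
    by metis
  define r where "r n = fst (f n)" for n
  \<comment> \<open>Each interval is extended to the left down to the end of the preceding chosen
    block. This left end is known before \<open>r n\<close> is selected, as the tolerance
    \<open>d n\<close> requires.\<close>
  define q where "q n = (case n of 0 \<Rightarrow> 0 | Suc k \<Rightarrow> p (Suc (r k)))" for n
  define d where "d n = e n (q n)" for n
  have goodn: "good (d n) (r n) (snd (f n))" for n
    by (cases n) (use f(2,5) in \<open>simp_all add: d_def q_def r_def\<close>)
  have dec: "snd (f m) \<subseteq> snd (f n)" if "n \<le> m" for n m
    using lift_Suc_antimono_le[of "\<lambda>n. snd (f n)", OF f(4) that] .
  have later: "r k \<in> snd (f j)" if "j < k" for j k
  proof -
    define k' where "k' = k - 1"
    have k': "k = Suc k'" "j \<le> k'" using that by (simp_all add: k'_def)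
    then show ?thesis using f(3)[of k'] dec[of j k'] by (auto simp: r_def)
  qed
  have r: "strict_mono r"
    using goodn later unfolding good_def by (intro strict_monoI) blast
  have "blocks q (x \<circ> r) K"
    unfolding blocks_def
  proof (intro conjI allI impI)
    show "strict_mono q"
    proof (rule strict_monoI_Suc)
      fix n show "q n < q (Suc n)"
      proof (cases n)
        case 0
        have "0 \<le> p (r 0)" "p (r 0) < p (Suc (r 0))" using strict_monoD[OF p, of "r 0" "Suc (r 0)"] by auto
        then show ?thesis using 0 by (simp add: q_def)
      next
        case (Suc k)
        then show ?thesis using strict_monoD[OF r, of k n] strict_monoD[OF p] by (simp add: q_def)
      qed
    qed
    fix n
    show "(x \<circ> r) n \<in> JT" "jt_norm ((x \<circ> r) n) \<le> K" using blocksD(2,3)[OF B] by auto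
    fix t assume t: "(x \<circ> r) n t \<noteq> 0"
    then have t': "p (r n) \<le> t" "t < p (Suc (r n))" using blocksD(4)[OF B] by auto
    show "t < q (Suc n)" using t' by (simp add: q_def)
    show "q n \<le> t"
    proof (cases n)
      case (Suc k)
      have "Suc (r k) \<le> r n" using strict_monoD[OF r, of k n] Suc by simp
      then have "p (Suc (r k)) \<le> p (r n)" using strict_mono_less_eq[OF p] by simp
      then show ?thesis using t' Suc by (simp add: q_def)
    qed (simp add: q_def)
  qed
  then have "upper2 jt_norm (x \<circ> r) (sqrt (6 * K\<^sup>2 + 8))"
  proof (rule upper2_separated[where d = d])
    show "0 < d j" "real (q j) * (d j)\<^sup>2 \<le> (1/2) ^ j" for j
      using e_pos e_sq by (simp_all add: d_def)
    fix j k :: nat and \<sigma> assume "j < k" "branch \<sigma>"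
    then show "\<bar>bsum ((x \<circ> r) j) \<sigma>\<bar> < d j \<or> \<bar>bsum ((x \<circ> r) k) \<sigma>\<bar> < d j"
      using goodn[of j] later unfolding good_def by auto
  qed
  then show ?thesis using r by blast
qed

section \<open>Convergence along branches\<close>

text \<open>The Bessel inequality makes \<open>g k (z j)\<close> tend to 0 in \<open>k\<close> for
  each fixed \<open>j\<close>; thinning out therefore makes the entries below the diagonal as small
  as \<open>l2_complemented_triangular\<close> wants.\<close>

lemma (in fnormed) l2_complemented_above:
  assumes M: "closed_subspace_in V N M" and z: "\<And>k. z k \<in> M"
    and up: "upper2 N z C" and g: "\<And>k. linf_on V (g k)" and D: "0 \<le> D"
    and bes: "\<And>x n. x \<in> V \<Longrightarrow> (\<Sum>k<n. (g k x)\<^sup>2) \<le> (D * N x)\<^sup>2"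
    and diag: "\<And>k. g k (z k) = 1" and above: "\<And>k j. k < j \<Longrightarrow> g k (z j) = 0"
  shows "\<exists>Y. Y \<subseteq> M \<and> closed_subspace_in V N Y \<and> isomorphic_to_l2 N Y \<and> complemented_in V N Y"
proof -
  have zV: "z k \<in> V" for k using M z unfolding closed_subspace_in_def by blast
  have lim: "(\<lambda>k. g k (z j)) \<longlonglongrightarrow> 0" for j
  proof -
    have "summable (\<lambda>k. (g k (z j))\<^sup>2)"
      using bes[OF zV[of j]] by (intro summableI_nonneg_bounded) auto
    then have "(\<lambda>k. (g k (z j))\<^sup>2) \<longlonglongrightarrow> 0" by (rule summable_LIMSEQ_zero)
    then have "(\<lambda>k. \<bar>g k (z j)\<bar>) \<longlonglongrightarrow> 0" using tendsto_real_sqrt by fastforce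
    then show ?thesis by (rule tendsto_rabs_zero_cancel)
  qed
  have small: "\<exists>m>n. \<forall>i\<in>{..n}. \<bar>g m (z i)\<bar> < e" if "0 < e" for n e
  proof -
    have "\<forall>\<^sub>F m in sequentially. \<forall>i\<in>{..n}. \<bar>g m (z i)\<bar> < e"
      using order_tendstoD(2)[OF tendsto_rabs_zero[OF lim] that] by (intro eventually_ball_finite) auto
    then have "\<forall>\<^sub>F m in sequentially. n < m \<and> (\<forall>i\<in>{..n}. \<bar>g m (z i)\<bar> < e)"
      using eventually_gt_at_top[of n] by (intro eventually_conj)
    then show ?thesis using eventually_happens by force
  qed
  obtain r where r: "\<And>n. r n < r (Suc n)" "\<And>n i. i \<le> r n \<Longrightarrow> \<bar>g (r (Suc n)) (z i)\<bar> < (1/4) ^ Suc n / 2"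
  proof (rule exE[OF dependent_nat_choice[of "\<lambda>n a. True"
      "\<lambda>n a b. a < b \<and> (\<forall>i\<in>{..a}. \<bar>g b (z i)\<bar> < (1/4) ^ Suc n / 2)"]])
    show "\<exists>b. True \<and> a < b \<and> (\<forall>i\<in>{..a}. \<bar>g b (z i)\<bar> < (1/4) ^ Suc n / 2)" for a :: nat and n :: nat
      using small[of "(1/4) ^ Suc n / 2" a] by auto
  qed (use that in auto)
  have sm: "strict_mono r" using r(1) by (rule strict_monoI_Suc)
  show ?thesis
  proof (rule l2_complemented_triangular[of M "z \<circ> r" C "g \<circ> r" D])
    show "upper2 N (z \<circ> r) C" by (rule upper2_subseq[OF up sm])
    show "(g \<circ> r) k ((z \<circ> r) k) = 1" for k using diag by simp
    show "(g \<circ> r) k ((z \<circ> r) j) = 0" if "k < j" for k j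
      using above strict_monoD[OF sm that] by simp
    show "\<bar>(g \<circ> r) k ((z \<circ> r) j)\<bar> \<le> (1/4) ^ k / 2" if "j < k" for k j
    proof -
      define k' where "k' = k - 1"
      have k': "k = Suc k'" "j \<le> k'" using that by (simp_all add: k'_def)
      have "r j \<le> r k'" using k'(2) strict_mono_less_eq[OF sm] by simp
      then show ?thesis using r(2)[of "r j" k'] unfolding k'(1) by simp
    qed
    show "(\<Sum>k<n. ((g \<circ> r) k x)\<^sup>2) \<le> (D * N x)\<^sup>2" if "x \<in> V" for x n
    proof -
      have "(\<Sum>k<n. ((g \<circ> r) k x)\<^sup>2) = (\<Sum>k\<in>r ` {..<n}. (g k x)\<^sup>2)"
        using strict_mono_imp_inj_on[OF sm] by (simp add: sum.reindex inj_on_subset)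
      also have "\<dots> \<le> (\<Sum>k<r n. (g k x)\<^sup>2)"
        using strict_monoD[OF sm] by (intro sum_mono2) auto
      also have "\<dots> \<le> (D * N x)\<^sup>2" by (rule bes[OF that])
      finally show ?thesis .
    qed
  qed (use M z g D in auto)
qed

section \<open>Subsequences whose branch sums converge\<close>

lemma eventually_branches_distinct:
  assumes "finite G" "\<And>\<sigma>. \<sigma> \<in> G \<Longrightarrow> branch \<sigma>"
  shows "\<forall>\<^sub>F R in sequentially. inj_on (\<lambda>\<sigma>. \<sigma> R) G"
proof -
  have "\<forall>\<^sub>F R in sequentially. \<sigma> \<noteq> \<tau> \<longrightarrow> \<sigma> R \<noteq> \<tau> R" if "\<sigma> \<in> G" "\<tau> \<in> G" for \<sigma> \<tau>
  proof (cases "\<sigma> = \<tau>")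
    case False
    then obtain i where i: "\<sigma> i \<noteq> \<tau> i" by auto
    have "\<sigma> R \<noteq> \<tau> R" if "i \<le> R" for R
      using branch_agree[OF assms(2)[OF \<open>\<sigma> \<in> G\<close>] assms(2)[OF \<open>\<tau> \<in> G\<close>] _ that] i by blast
    then show ?thesis unfolding eventually_sequentially by blast
  qed simp
  then have "\<forall>\<^sub>F R in sequentially. \<forall>\<sigma>\<in>G. \<forall>\<tau>\<in>G. \<sigma> \<noteq> \<tau> \<longrightarrow> \<sigma> R \<noteq> \<tau> R"
    using assms(1) by (simp add: eventually_ball_finite_distrib)
  then show ?thesis by (rule eventually_mono) (auto simp: inj_on_def)
qed

lemma bsum_sum_distinct_le:
  assumes x: "x \<in> JT" "\<And>t. x t \<noteq> 0 \<Longrightarrow> p \<le> t \<and> t < q"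
    and G: "finite G" "\<And>\<sigma>. \<sigma> \<in> G \<Longrightarrow> branch \<sigma>" "inj_on (\<lambda>\<sigma>. \<sigma> R) G" and R: "2 ^ Suc R \<le> p + 1"
  shows "(\<Sum>\<sigma>\<in>G. (bsum x \<sigma>)\<^sup>2) \<le> (jt_norm x)\<^sup>2"
proof (rule bsum_sum_family_le[OF x G(1,2)])
  fix \<sigma> \<tau> assume st: "\<sigma> \<in> G" "\<tau> \<in> G" "\<sigma> \<noteq> \<tau>"
  show "range \<sigma> \<inter> range \<tau> \<subseteq> {..<p}"
  proof (rule subsetI, rule ccontr)
    fix t assume t: "t \<in> range \<sigma> \<inter> range \<tau>" "t \<notin> {..<p}"
    then have "2 ^ Suc R \<le> t + 1" using R by (simp add: not_less)
    then have "\<sigma> R = \<tau> R" using branch_shared_node[OF G(2)[OF st(1)] G(2)[OF st(2)]] t by blast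
    then show False using inj_onD[OF G(3)] st by blast
  qed
qed

lemma finite_convergent_subseq:
  fixes h :: "nat \<Rightarrow> 'b \<Rightarrow> real"
  assumes "finite G" "\<And>n b. b \<in> G \<Longrightarrow> \<bar>h n b\<bar> \<le> K"
  shows "\<exists>r. strict_mono r \<and> (\<forall>b\<in>G. convergent (\<lambda>n. h (r n) b))"
  using assms
proof (induction G rule: finite_induct)
  case empty
  then show ?case using strict_mono_id by auto
next
  case (insert b G)
  then obtain r where r: "strict_mono r" "\<forall>b\<in>G. convergent (\<lambda>n. h (r n) b)" by auto
  have "\<forall>n. h (r n) b \<in> {-K..K}" using insert.prems[of b] by (auto simp: abs_le_iff minus_le_iff)
  then obtain l s where s: "strict_mono s" "((\<lambda>n. h (r n) b) \<circ> s) \<longlonglongrightarrow> l"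
    using compact_Icc[of "-K" K, THEN compact_imp_seq_compact] unfolding seq_compact_def by metis
  have "convergent (\<lambda>n. h ((r \<circ> s) n) c)" if "c \<in> insert b G" for c
  proof (cases "c = b")
    case True
    then show ?thesis using s(2) unfolding convergent_def comp_def by blast
  next
    case False
    then have "convergent (\<lambda>n. h (r n) c)" using that r(2) by blast
    then have "convergent ((\<lambda>n. h (r n) c) \<circ> s)" using s(1) by (rule convergent_subseq_convergent)
    then show ?thesis by (simp add: comp_def)
  qed
  then show ?case using strict_mono_o[OF r(1) s(1)] by blast
qed

lemma blocks_bsum_le:
  assumes B: "blocks p x K" and "branch \<sigma>" shows "\<bar>bsum (x n) \<sigma>\<bar> \<le> K"
proof -
  have "\<bar>bsum (x n) \<sigma>\<bar> \<le> jt_norm (x n)"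
    using blocksD(2)[OF B] blocksD(4)[OF B] assms(2) by (rule bsum_le_norm)
  then show ?thesis using blocksD(3)[OF B, of n] by linarith
qed

text \<open>Take a largest set \<open>G\<close> of branches that are heavy on all terms of a common
  subsequence; beyond the level where they separate, the lower l2-estimate bounds its size. By
  maximality any other branch is eventually light, which bounds its oscillation by
  \<open>2 * e\<close>, and the finitely many branches in \<open>G\<close> are made convergent by a
  further subsequence.\<close>

lemma small_oscillation_subseq:
  fixes s :: "nat \<Rightarrow> nat"
  assumes B: "blocks p x K" and s: "strict_mono s" and e: "0 < e"
  shows "\<exists>r :: nat \<Rightarrow> nat. strict_mono r \<and> (\<forall>\<sigma>. branch \<sigma> \<longrightarrow>
    (\<exists>M. \<forall>m\<ge>M. \<forall>n\<ge>M. \<bar>bsum (x (s (r m))) \<sigma> - bsum (x (s (r n))) \<sigma>\<bar> \<le> 2 * e))"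
proof -
  note p = blocksD(1)[OF B]
  define Q where "Q G \<longleftrightarrow> finite G \<and> (\<forall>\<sigma>\<in>G. branch \<sigma>) \<and>
    (\<exists>r :: nat \<Rightarrow> nat. strict_mono r \<and> (\<forall>\<sigma>\<in>G. \<forall>n. e \<le> \<bar>bsum (x (s (r n))) \<sigma>\<bar>))" for G
  obtain m :: nat where m: "K\<^sup>2 / e\<^sup>2 < real m" using reals_Archimedean2 by blast
  have card: "card G < m" if G: "Q G" for G
  proof -
    have fin: "finite G" and br: "\<And>\<sigma>. \<sigma> \<in> G \<Longrightarrow> branch \<sigma>"
      using G unfolding Q_def by blast+
    obtain r :: "nat \<Rightarrow> nat" where r0: "strict_mono r" "\<forall>\<sigma>\<in>G. \<forall>n. e \<le> \<bar>bsum (x (s (r n))) \<sigma>\<bar>"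
      using G unfolding Q_def by blast
    note r = r0(1) r0(2)[rule_format]
    obtain R where R: "inj_on (\<lambda>\<sigma>. \<sigma> R) G"
      using eventually_happens[OF eventually_branches_distinct[OF fin br]] by auto
    \<comment> \<open>A term so late that its support starts beyond the level \<open>R\<close> on
      which the branches of \<open>G\<close> are distinct.\<close>
    let ?n = "s (r (2 ^ Suc R))"
    have "2 ^ Suc R \<le> ?n" using strict_mono_imp_increasing[OF strict_mono_o[OF s r(1)], of "2 ^ Suc R"] by simp
    also have "?n \<le> p ?n" by (rule strict_mono_imp_increasing[OF p])
    finally have le: "2 ^ Suc R \<le> p ?n + 1" by simp
    have "real (card G) * e\<^sup>2 = (\<Sum>\<sigma>\<in>G. e\<^sup>2)" by simp
    also have "\<dots> \<le> (\<Sum>\<sigma>\<in>G. (bsum (x ?n) \<sigma>)\<^sup>2)"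
    proof (rule sum_mono)
      fix \<sigma> assume "\<sigma> \<in> G"
      then show "e\<^sup>2 \<le> (bsum (x ?n) \<sigma>)\<^sup>2" using e r(2) abs_le_square_iff[of e "bsum (x ?n) \<sigma>"] by simp
    qed
    also have "\<dots> \<le> (jt_norm (x ?n))\<^sup>2"
      by (rule bsum_sum_distinct_le[OF blocksD(2,4)[OF B] fin br R le])
    also have "\<dots> \<le> K\<^sup>2" by (rule power_mono[OF blocksD(3)[OF B] jt_norm_nonneg[OF blocksD(2)[OF B]]])
    finally have "real (card G) \<le> K\<^sup>2 / e\<^sup>2" using e by (simp add: field_simps)
    then show ?thesis using m by linarith
  qed
  have "Q {}" unfolding Q_def using strict_mono_id by auto
  then obtain G where G: "Q G" "\<And>H. Q H \<Longrightarrow> card H \<le> card G"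
    using ex_has_greatest_nat[of Q "{}" card m] card less_imp_le by metis
  have fin: "finite G" and br: "\<And>\<sigma>. \<sigma> \<in> G \<Longrightarrow> branch \<sigma>"
    using G(1) unfolding Q_def by blast+
  obtain r :: "nat \<Rightarrow> nat" where r0: "strict_mono r" "\<forall>\<sigma>\<in>G. \<forall>n. e \<le> \<bar>bsum (x (s (r n))) \<sigma>\<bar>"
    using G(1) unfolding Q_def by blast
  note r = r0(1) r0(2)[rule_format]
  have light: "\<exists>M. \<forall>n\<ge>M. \<bar>bsum (x (s (r n))) \<sigma>\<bar> < e" if \<sigma>: "branch \<sigma>" "\<sigma> \<notin> G" for \<sigma>
  proof (rule ccontr)
    assume neg: "\<not> ?thesis"
    let ?A = "{n. e \<le> \<bar>bsum (x (s (r n))) \<sigma>\<bar>}"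
    have inf: "infinite ?A" unfolding infinite_nat_iff_unbounded_le using neg by (auto simp: not_less)
    let ?a = "enumerate ?A"
    have a: "strict_mono ?a" "\<And>n. ?a n \<in> ?A"
      by (rule strict_mono_enumerate[OF inf], rule enumerate_in_set[OF inf])
    have "Q (insert \<sigma> G)"
      unfolding Q_def
    proof (intro conjI exI[of _ "r \<circ> ?a"] ballI allI)
      show "strict_mono (r \<circ> ?a)" by (rule strict_mono_o[OF r(1) a(1)])
      show "e \<le> \<bar>bsum (x (s ((r \<circ> ?a) n))) \<tau>\<bar>" if "\<tau> \<in> insert \<sigma> G" for \<tau> n
        using that a(2)[of n] r(2) by auto
    qed (use fin br \<sigma> in auto)
    then have "card (insert \<sigma> G) \<le> card G" by (rule G(2))
    then show False using fin \<sigma>(2) by simp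
  qed
  have "\<bar>bsum (x (s (r n))) \<sigma>\<bar> \<le> K" if "\<sigma> \<in> G" for n \<sigma>
    by (rule blocks_bsum_le[OF B br[OF that]])
  then obtain r' where r': "strict_mono r'" "\<forall>\<sigma>\<in>G. convergent (\<lambda>n. bsum (x (s (r (r' n)))) \<sigma>)"
    using finite_convergent_subseq[OF fin, of "\<lambda>n \<sigma>. bsum (x (s (r n))) \<sigma>" K] by blast
  have "\<exists>M. \<forall>m\<ge>M. \<forall>n\<ge>M. \<bar>bsum (x (s ((r \<circ> r') m))) \<sigma> - bsum (x (s ((r \<circ> r') n))) \<sigma>\<bar> \<le> 2 * e"
    if \<sigma>: "branch \<sigma>" for \<sigma>
  proof (cases "\<sigma> \<in> G")
    case True
    then have "Cauchy (\<lambda>n. bsum (x (s (r (r' n)))) \<sigma>)" using r'(2) convergent_Cauchy by blast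
    then obtain M where "\<forall>m\<ge>M. \<forall>n\<ge>M. dist (bsum (x (s (r (r' m)))) \<sigma>) (bsum (x (s (r (r' n)))) \<sigma>) < 2 * e"
      using e unfolding Cauchy_def by (metis mult_pos_pos zero_less_numeral)
    then show ?thesis by (intro exI[of _ M]) (auto simp: dist_real_def intro: less_imp_le)
  next
    case False
    obtain M where M: "\<forall>n\<ge>M. \<bar>bsum (x (s (r n))) \<sigma>\<bar> < e" using light[OF \<sigma> False] by blast
    have *: "\<bar>bsum (x (s (r (r' n)))) \<sigma>\<bar> < e" if "M \<le> n" for n
      using M that strict_mono_imp_increasing[OF r'(1), of n] by simp
    have "\<bar>bsum (x (s (r (r' m)))) \<sigma> - bsum (x (s (r (r' n)))) \<sigma>\<bar> \<le> 2 * e" if "M \<le> m" "M \<le> n" for m n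
      using *[OF that(1)] *[OF that(2)] by linarith
    then show ?thesis by auto
  qed
  then show ?thesis using strict_mono_o[OF r(1) r'(1)] by blast
qed

text \<open>There are uncountably many branches, so the diagonal argument runs over the tolerances
  \<open>1 / real (Suc k)\<close> instead, each of them handled for all branches.\<close>

lemma branch_convergent_subseq:
  assumes B: "blocks p x K"
  shows "\<exists>r. strict_mono r \<and> (\<forall>\<sigma>. branch \<sigma> \<longrightarrow> convergent (\<lambda>n. bsum (x (r n)) \<sigma>))"
proof -
  define P where "P k s \<longleftrightarrow> (\<forall>\<sigma>. branch \<sigma> \<longrightarrow>
    (\<exists>M. \<forall>m\<ge>M. \<forall>n\<ge>M. \<bar>bsum (x (s m)) \<sigma> - bsum (x (s n)) \<sigma>\<bar> \<le> 2 * (1 / real (Suc k))))"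
    for k and s :: "nat \<Rightarrow> nat"
  interpret subseqs P
  proof
    fix k and s :: "nat \<Rightarrow> nat" assume s: "strict_mono s"
    show "\<exists>r. strict_mono r \<and> P k (s \<circ> r)"
      using small_oscillation_subseq[OF B s, of "1 / real (Suc k)"] by (simp add: P_def)
  qed
  have dP: "P k (diagseq \<circ> ((+) (Suc k)))" for k
  proof (rule diagseq_holds)
    fix n and r s :: "nat \<Rightarrow> nat" assume r: "strict_mono r" and P: "P n s"
    show "P n (s \<circ> r)"
      unfolding P_def
    proof (intro allI impI)
      fix \<sigma> assume "branch \<sigma>"
      then obtain M where M: "\<forall>m\<ge>M. \<forall>k\<ge>M. \<bar>bsum (x (s m)) \<sigma> - bsum (x (s k)) \<sigma>\<bar> \<le> 2 * (1 / real (Suc n))"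
        using P unfolding P_def by blast
      have "M \<le> r m" if "M \<le> m" for m using that strict_mono_imp_increasing[OF r, of m] by linarith
      then show "\<exists>M. \<forall>m\<ge>M. \<forall>k\<ge>M. \<bar>bsum (x ((s \<circ> r) m)) \<sigma> - bsum (x ((s \<circ> r) k)) \<sigma>\<bar> \<le> 2 * (1 / real (Suc n))"
        using M by (intro exI[of _ M]) simp
    qed
  qed
  have "Cauchy (\<lambda>n. bsum (x (diagseq n)) \<sigma>)" if \<sigma>: "branch \<sigma>" for \<sigma>
    unfolding Cauchy_def
  proof (intro allI impI)
    fix e :: real assume e: "0 < e"
    obtain k where k: "inverse (real (Suc k)) < e / 2" using reals_Archimedean[of "e/2"] e by auto
    obtain M where M: "\<forall>m\<ge>M. \<forall>n\<ge>M. \<bar>bsum (x (diagseq (Suc k + m))) \<sigma> - bsum (x (diagseq (Suc k + n))) \<sigma>\<bar> \<le> 2 * (1 / real (Suc k))"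
      using dP[of k] \<sigma> unfolding P_def by auto
    have "dist (bsum (x (diagseq m)) \<sigma>) (bsum (x (diagseq n)) \<sigma>) < e"
      if "Suc k + M \<le> m" "Suc k + M \<le> n" for m n
    proof -
      have "M \<le> m - Suc k" "M \<le> n - Suc k" using that by auto
      then have "\<bar>bsum (x (diagseq (Suc k + (m - Suc k)))) \<sigma> - bsum (x (diagseq (Suc k + (n - Suc k)))) \<sigma>\<bar> \<le> 2 * (1 / real (Suc k))"
        using M by blast
      moreover have "Suc k + (m - Suc k) = m" "Suc k + (n - Suc k) = n" using that by auto
      ultimately have "\<bar>bsum (x (diagseq m)) \<sigma> - bsum (x (diagseq n)) \<sigma>\<bar> \<le> 2 * (1 / real (Suc k))" by simp
      also have "\<dots> < e" using k by (simp add: inverse_eq_divide)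
      finally show ?thesis by (simp add: dist_real_def)
    qed
    then show "\<exists>M. \<forall>m\<ge>M. \<forall>n\<ge>M. dist (bsum (x (diagseq m)) \<sigma>) (bsum (x (diagseq n)) \<sigma>) < e" by blast
  qed
  then show ?thesis using subseq_diagseq Cauchy_convergent by blast
qed

lemma blocks_subseq:
  assumes B: "blocks p x K" and r: "strict_mono r"
  shows "blocks (p \<circ> r) (x \<circ> r) K"
  unfolding blocks_def
proof (intro conjI allI impI)
  show "strict_mono (p \<circ> r)" by (rule strict_mono_o[OF blocksD(1)[OF B] r])
  fix n
  show "(x \<circ> r) n \<in> JT" "jt_norm ((x \<circ> r) n) \<le> K" using blocksD(2,3)[OF B] by auto
  fix t assume "(x \<circ> r) n t \<noteq> 0"
  then have t: "p (r n) \<le> t" "t < p (Suc (r n))" using blocksD(4)[OF B] by auto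
  then show "(p \<circ> r) n \<le> t" by simp
  have "p (Suc (r n)) \<le> p (r (Suc n))"
    using strict_mono_less_eq[OF blocksD(1)[OF B]] strict_monoD[OF r, of n "Suc n"] by simp
  then show "t < (p \<circ> r) (Suc n)" using t by simp
qed

lemma bsum_diff:
  assumes "branch \<sigma>" "\<And>t. q \<le> t \<Longrightarrow> x t = 0" "\<And>t. q \<le> t \<Longrightarrow> y t = 0"
  shows "bsum (\<lambda>t. x t - y t) \<sigma> = bsum x \<sigma> - bsum y \<sigma>"
  using bsum_finite[OF assms(1,2)] bsum_finite[OF assms(1,3)]
    bsum_finite[OF assms(1), of q "\<lambda>t. x t - y t"] assms(2,3) by (simp add: sum_subtractf)

text \<open>Pairing consecutive terms of a subsequence with convergent branch sums produces a
  branch-null sequence. The indices are returned explicitly, because the same differences are later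
  formed from vectors that are only close to the blocks, and because their order makes the matrix of
  values triangular.\<close>

lemma blocks_diff_upper2:
  assumes B: "blocks p x K"
  shows "\<exists>a b C. strict_mono a \<and> (\<forall>k. a k < b k \<and> b k < a (Suc k)) \<and>
    upper2 jt_norm (\<lambda>k t. x (a k) t - x (b k) t) C"
proof -
  obtain s where s: "strict_mono s" "\<And>\<sigma>. branch \<sigma> \<Longrightarrow> convergent (\<lambda>n. bsum (x (s n)) \<sigma>)"
    using branch_convergent_subseq[OF B] by blast
  note B' = blocks_subseq[OF B s(1)]
  define y where "y k = (\<lambda>t. x (s (2 * k)) t - x (s (2 * k + 1)) t)" for k
  have sup: "p (s n) \<le> t \<and> t < p (s (Suc n))" if "x (s n) t \<noteq> 0" for n t
    using blocksD(4)[OF B', of n t] that by simp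
  have pm: "p (s m) \<le> p (s n)" if "m \<le> n" for m n
    using strict_mono_less_eq[OF blocksD(1)[OF B']] that by simp
  have By: "blocks (\<lambda>k. p (s (2 * k))) y (2 * K)"
    unfolding blocks_def
  proof (intro conjI allI impI)
    show "strict_mono (\<lambda>k. p (s (2 * k)))"
      using strict_monoD[OF blocksD(1)[OF B']] by (intro strict_monoI) simp
    fix k
    show "y k \<in> JT" unfolding y_def by (intro lin_subspace_diff[OF JT_subspace] blocksD(2)[OF B])
    have "jt_norm (y k) \<le> jt_norm (x (s (2 * k))) + jt_norm (x (s (2 * k + 1)))"
      unfolding y_def by (intro JT.N_diff blocksD(2)[OF B])
    then show "jt_norm (y k) \<le> 2 * K"
      using blocksD(3)[OF B, of "s (2 * k)"] blocksD(3)[OF B, of "s (2 * k + 1)"] by linarith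
    fix t assume "y k t \<noteq> 0"
    then have "x (s (2 * k)) t \<noteq> 0 \<or> x (s (Suc (2 * k))) t \<noteq> 0" by (auto simp: y_def)
    then have *: "(p (s (2 * k)) \<le> t \<and> t < p (s (Suc (2 * k)))) \<or> (p (s (Suc (2 * k))) \<le> t \<and> t < p (s (Suc (Suc (2 * k)))))"
      using sup[of "2 * k" t] sup[of "Suc (2 * k)" t] by blast
    have "p (s (2 * k)) \<le> p (s (Suc (2 * k)))" "p (s (Suc (2 * k))) \<le> p (s (2 * Suc k))" "p (s (Suc (Suc (2 * k)))) \<le> p (s (2 * Suc k))"
      by (intro pm, simp)+
    then show "p (s (2 * k)) \<le> t" "t < p (s (2 * Suc k))" using * by linarith+
  qed
  have null: "(\<lambda>k. bsum (y k) \<sigma>) \<longlonglongrightarrow> 0" if \<sigma>: "branch \<sigma>" for \<sigma>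
  proof -
    obtain l where l: "(\<lambda>n. bsum (x (s n)) \<sigma>) \<longlonglongrightarrow> l" using s(2)[OF \<sigma>] by (auto simp: convergent_def)
    have "strict_mono (\<lambda>k::nat. 2 * k)" "strict_mono (\<lambda>k::nat. 2 * k + 1)" by (auto simp: strict_mono_def)
    from LIMSEQ_subseq_LIMSEQ[OF l this(1)] LIMSEQ_subseq_LIMSEQ[OF l this(2)]
    have "(\<lambda>k. bsum (x (s (2 * k))) \<sigma> - bsum (x (s (2 * k + 1))) \<sigma>) \<longlonglongrightarrow> l - l"
      by (intro tendsto_diff) (auto simp: comp_def)
    moreover have "bsum (y k) \<sigma> = bsum (x (s (2 * k))) \<sigma> - bsum (x (s (2 * k + 1))) \<sigma>" for k
      unfolding y_def
    proof (rule bsum_diff[OF \<sigma>])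
      fix t assume t: "p (s (Suc (Suc (2 * k)))) \<le> t"
      then show "x (s (2 * k)) t = 0" using sup[of "2 * k" t] pm[of "Suc (2 * k)" "Suc (Suc (2 * k))"] by fastforce
      show "x (s (2 * k + 1)) t = 0" using sup[of "2 * k + 1" t] t by fastforce
    qed
    ultimately show ?thesis by simp
  qed
  obtain r C where r: "strict_mono r" "upper2 jt_norm (y \<circ> r) C" using branch_null_upper2[OF By null] by blast
  have "upper2 jt_norm (\<lambda>k t. x (s (2 * r k)) t - x (s (2 * r k + 1)) t) C"
    using r(2) by (simp add: y_def comp_def)
  moreover have "strict_mono (\<lambda>k. s (2 * r k))"
    using strict_monoD[OF s(1)] strict_monoD[OF r(1)] by (intro strict_monoI) simp
  moreover have "s (2 * r k) < s (2 * r k + 1) \<and> s (2 * r k + 1) < s (2 * r (Suc k))" for k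
    using strict_monoD[OF s(1)] strict_monoD[OF r(1), of k "Suc k"] by simp
  ultimately show ?thesis by (intro exI[of _ "\<lambda>k. s (2 * r k)"] exI[of _ "\<lambda>k. s (2 * r k + 1)"]) blast
qed

section \<open>Subspaces of JT\<close>

text \<open>The functional pairs the segment sums of \<open>x\<close> and \<open>u\<close> over a
  nearly norming family. Cauchy-Schwarz bounds it by the norm of \<open>u\<close> on
  \<open>I\<close> divided by the root of \<open>seg_val S x\<close>.\<close>

lemma norming_functional:
  assumes x: "x \<in> JT" "rst I x = x" "3/4 \<le> jt_norm x" and I: "order_convex I"
  shows "\<exists>\<phi>. linf_on JT \<phi> \<and> \<phi> x = 1 \<and> (\<forall>u\<in>JT. \<bar>\<phi> u\<bar> \<le> 2 * jt_norm (rst I u))"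
proof -
  \<comment> \<open>\<open>9/16 - 5/16 = 1/4\<close>, whose root gives the bound 2.\<close>
  obtain S where S: "seg_fam S" "(jt_norm x)\<^sup>2 - 5/16 < seg_val S x"
    using seg_val_approx[OF x(1), of "5/16"] by auto
  have "(3/4)\<^sup>2 \<le> (jt_norm x)\<^sup>2" using x(3) by (intro power_mono) auto
  then have v: "1/4 < seg_val S x" using S(2) by (simp add: power2_eq_square)
  define \<phi> where "\<phi> u = (\<Sum>s\<in>S. (\<Sum>t\<in>s. x t) * (\<Sum>t\<in>s. rst I u t)) / seg_val S x" for u
  have "linf_on JT \<phi>"
    unfolding linf_on_def
  proof (intro conjI ballI allI)
    fix u w
    have "rst I (\<lambda>t. u t + w t) = (\<lambda>t. rst I u t + rst I w t)" by (auto simp: rst_def)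
    then show "\<phi> (\<lambda>t. u t + w t) = \<phi> u + \<phi> w"
      by (simp add: \<phi>_def sum.distrib distrib_left add_divide_distrib)
  next
    fix u c
    have "rst I (\<lambda>t. c * u t) = (\<lambda>t. c * rst I u t)" by (auto simp: rst_def)
    then show "\<phi> (\<lambda>t. c * u t) = c * \<phi> u"
      by (simp add: \<phi>_def sum_distrib_left[symmetric] mult.left_commute)
  qed
  moreover have "\<phi> x = 1"
    unfolding \<phi>_def x(2) using v by (simp add: seg_val_def power2_eq_square)
  moreover have "\<bar>\<phi> u\<bar> \<le> 2 * jt_norm (rst I u)" if u: "u \<in> JT" for u
  proof -
    let ?w = "rst I u" and ?v = "seg_val S x"
    have w: "?w \<in> JT" using JT_rst(1)[OF u I] .
    have "(\<Sum>s\<in>S. (\<Sum>t\<in>s. x t) * (\<Sum>t\<in>s. ?w t))\<^sup>2 \<le> ?v * seg_val S ?w"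
      unfolding seg_val_def by (rule Cauchy_Schwarz_ineq_sum)
    also have "\<dots> \<le> ?v * (jt_norm ?w)\<^sup>2"
      using v by (intro mult_left_mono seg_val_le_norm w S(1)) simp
    finally have "(\<phi> u)\<^sup>2 \<le> ?v * (jt_norm ?w)\<^sup>2 / ?v\<^sup>2"
      unfolding \<phi>_def power_divide using v by (intro divide_right_mono) auto
    also have "\<dots> = (jt_norm ?w)\<^sup>2 / ?v" using v by (simp add: power2_eq_square)
    also have "\<dots> \<le> (jt_norm ?w)\<^sup>2 / (1/4)" using v by (intro divide_left_mono) auto
    also have "\<dots> = (2 * jt_norm ?w)\<^sup>2" by (simp add: power_mult_distrib)
    finally show ?thesis using jt_norm_nonneg[OF w] abs_le_square_iff[of "\<phi> u" "2 * jt_norm ?w"] by simp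
  qed
  ultimately show ?thesis by blast
qed

lemma block_intervals_disjoint:
  fixes a p :: "nat \<Rightarrow> nat"
  assumes p: "strict_mono p" and a: "strict_mono a"
  shows "disjoint_family_on (\<lambda>k. {p (a k)..<p (Suc (a k))}) A"
  unfolding disjoint_family_on_def
proof (intro ballI impI)
  fix j k :: nat assume "j \<noteq> k"
  then have "a j \<noteq> a k" using strict_mono_eq[OF a] by simp
  then have "p (Suc (a j)) \<le> p (a k) \<or> p (Suc (a k)) \<le> p (a j)"
    using strict_mono_less_eq[OF p] by auto
  then show "{p (a j)..<p (Suc (a j))} \<inter> {p (a k)..<p (Suc (a k))} = {}" by auto
qed

lemma vanishing_unit_vector:
  assumes M: "lin_subspace M" "M \<subseteq> JT" "infinite_dim M"
  shows "\<exists>z\<in>M. jt_norm z = 1 \<and> (\<forall>t<p. z t = 0)"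
proof -
  let ?F = "(\<lambda>t x. x t) ` {..<p}"
  have "linf_on M f" if "f \<in> ?F" for f using that by (auto simp: linf_on_def)
  then have "infinite_dim {x\<in>M. \<forall>f\<in>?F. f x = 0}" using infinite_dim_kernels[OF M(1,3), of ?F] by blast
  then obtain x where x: "x \<in> M" "\<forall>f\<in>?F. f x = 0" "x \<noteq> (\<lambda>t. 0)" using infinite_dim_nonzero by blast
  have xJ: "x \<in> JT" using x M by blast
  have n: "0 < jt_norm x" using JT.N_eq_0D[OF xJ] x(3) jt_norm_nonneg[OF xJ] by fastforce
  let ?z = "\<lambda>t. inverse (jt_norm x) * x t"
  have "?z \<in> M" by (rule lin_subspace_scale[OF M(1) x(1)])
  moreover have "jt_norm ?z = 1" using JT_scale[OF xJ] n by simp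
  moreover have "\<forall>t<p. ?z t = 0" using x(2) by auto
  ultimately show ?thesis by blast
qed

text \<open>A gliding hump: unit vectors \<open>z n\<close> of \<open>M\<close> that start where the
  previous ones have essentially ended are close to blocks \<open>x n\<close>. The upper estimate
  comes from differences of blocks by perturbation, the Bessel inequality from functionals living on
  disjoint intervals.\<close>

theorem JT_complemented_l2:
  assumes M: "closed_subspace_in JT jt_norm M" "infinite_dim M"
  shows "\<exists>Y. Y \<subseteq> M \<and> closed_subspace_in JT jt_norm Y \<and>
    isomorphic_to_l2 jt_norm Y \<and> complemented_in JT jt_norm Y"
proof -
  have M': "lin_subspace M" "M \<subseteq> JT" using M(1) by (auto simp: closed_subspace_in_def)
  define good where "good n z p q \<longleftrightarrow> z \<in> M \<and> jt_norm z = 1 \<and> (\<forall>t<p. z t = 0) \<and> p < q \<and>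
    jt_norm (rst {q..} z) \<le> 1/4 * (1/2) ^ n" for n z and p q :: nat
  have step: "\<exists>z q. good n z p q" for n p
  proof -
    obtain z where z: "z \<in> M" "jt_norm z = 1" "\<forall>t<p. z t = 0"
      using vanishing_unit_vector[OF M' M(2)] by blast
    obtain q0 where "\<forall>q\<ge>q0. jt_norm (rst {q..} z) \<le> 1/4 * (1/2) ^ n"
      using JT_tail[of z "1/4 * (1/2) ^ n"] z(1) M' by auto
    then have "good n z p (max q0 (Suc p))" using z by (auto simp: good_def)
    then show ?thesis by blast
  qed
  obtain f :: "nat \<Rightarrow> (nat \<Rightarrow> real) \<times> nat \<times> nat" where f:
    "\<And>n. good n (fst (f n)) (fst (snd (f n))) (snd (snd (f n)))"
    "\<And>n. fst (snd (f (Suc n))) = snd (snd (f n))"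
  proof (rule exE[OF dependent_nat_choice[of "\<lambda>n a. good n (fst a) (fst (snd a)) (snd (snd a))"
      "\<lambda>n a b. fst (snd b) = snd (snd a)"]])
    obtain z q where "good 0 z 0 q" using step by blast
    then show "\<exists>a. good 0 (fst a) (fst (snd a)) (snd (snd a))" by (intro exI[of _ "(z, 0, q)"]) simp
    fix a :: "(nat \<Rightarrow> real) \<times> nat \<times> nat" and n
    obtain z q where "good (Suc n) z (snd (snd a)) q" using step by blast
    then show "\<exists>b. good (Suc n) (fst b) (fst (snd b)) (snd (snd b)) \<and> fst (snd b) = snd (snd a)"
      by (intro exI[of _ "(z, snd (snd a), q)"]) simp
  qed blast
  define z where "z n = fst (f n)" for n
  define p where "p n = fst (snd (f n))" for n
  have zp: "z n \<in> M" "jt_norm (z n) = 1" "\<And>t. t < p n \<Longrightarrow> z n t = 0" "p n < p (Suc n)"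
    "jt_norm (rst {p (Suc n)..} (z n)) \<le> 1/4 * (1/2) ^ n" for n
    using f(1)[of n] f(2)[of n] by (auto simp: good_def z_def p_def)
  have zJ: "z n \<in> JT" for n using zp(1) M' by blast
  have p: "strict_mono p" using zp(4) by (rule strict_monoI_Suc)
  define I where "I n = {p n..<p (Suc n)}" for n
  define x where "x n = rst (I n) (z n)" for n
  have xJ: "x n \<in> JT" "jt_norm (x n) \<le> 1" for n
    using JT_rst[OF zJ[of n], of "I n"] zp(2)[of n] by (auto simp: x_def I_def)
  have zx: "(\<lambda>t. z n t - x n t) = rst {p (Suc n)..} (z n)" for n
    using zp(3)[of _ n] by (fastforce simp: x_def I_def rst_def)
  have zx_le: "jt_norm (\<lambda>t. z n t - x n t) \<le> 1/4 * (1/2) ^ n" for n using zp(5) zx by simp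
  have x_ge: "3/4 \<le> jt_norm (x n)" for n
  proof -
    have "jt_norm (\<lambda>t. (z n t - x n t) + x n t) \<le> jt_norm (\<lambda>t. z n t - x n t) + jt_norm (x n)"
      by (intro JT.N_add lin_subspace_diff[OF JT_subspace] zJ xJ)
    moreover have "1/4 * (1/2::real) ^ n \<le> 1/4" by (simp add: power_le_one)
    ultimately show ?thesis using zx_le[of n] zp(2)[of n] by simp
  qed
  have B: "blocks p x 1"
    unfolding blocks_def using p xJ by (auto simp: x_def I_def rst_def split: if_splits)
  obtain a b C where ab: "strict_mono a" "\<And>k. a k < b k" "\<And>k. b k < a (Suc k)"
    and up: "upper2 jt_norm (\<lambda>k t. x (a k) t - x (b k) t) C"
    using blocks_diff_upper2[OF B] by blast
  have "\<exists>\<phi>. linf_on JT \<phi> \<and> \<phi> (x n) = 1 \<and> (\<forall>u\<in>JT. \<bar>\<phi> u\<bar> \<le> 2 * jt_norm (rst (I n) u))" for n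
  proof (rule norming_functional[OF xJ(1) _ x_ge])
    show "rst (I n) (x n) = x n" by (auto simp: x_def rst_def)
    show "order_convex (I n)" by (simp add: I_def)
  qed
  then obtain \<phi> where \<phi>: "\<And>n. linf_on JT (\<phi> n)" "\<And>n. \<phi> n (x n) = 1"
    "\<And>n u. u \<in> JT \<Longrightarrow> \<bar>\<phi> n u\<bar> \<le> 2 * jt_norm (rst (I n) u)" by metis
  have \<phi>0: "\<phi> n u = 0" if "u \<in> JT" "\<And>t. t \<in> I n \<Longrightarrow> u t = 0" for n u
  proof -
    have "rst (I n) u = (\<lambda>t. 0)" using that(2) by (auto simp: rst_def)
    then show ?thesis using \<phi>(3)[OF that(1), of n] JT_zero(2) by simp
  qed
  \<comment> \<open>\<open>z m\<close> vanishes exactly, not just approximately, below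
    \<open>p m\<close>; this makes the matrix of values exactly triangular.\<close>
  have late: "\<phi> n (z m) = 0" if "n < m" for n m
  proof (rule \<phi>0[OF zJ])
    fix t assume "t \<in> I n"
    then have "t < p m" using strict_mono_less_eq[OF p, of "Suc n" m] that by (auto simp: I_def)
    then show "z m t = 0" by (rule zp(3))
  qed
  have \<phi>z: "\<phi> n (z n) = 1" for n
  proof -
    have "\<phi> n (\<lambda>t. z n t - x n t) = 0"
    proof (rule \<phi>0[OF lin_subspace_diff[OF JT_subspace zJ xJ(1)]])
      show "z n t - x n t = 0" if "t \<in> I n" for t using that by (simp add: x_def rst_def)
    qed
    then show ?thesis using linf_on_diff[OF JT_subspace \<phi>(1) zJ xJ(1), of n n n] \<phi>(2)[of n] by simp
  qed
  \<comment> \<open>Differences of the vectors of \<open>M\<close>, not of the blocks, so that they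
    stay in \<open>M\<close>. Testing with \<open>\<phi> (a k)\<close> still gives 1, since
    \<open>z (b k)\<close> starts after the interval of \<open>a k\<close>.\<close>
  define w where "w k = (\<lambda>t. z (a k) t - z (b k) t)" for k
  have amono: "a j < a k" if "j < k" for j k using strict_monoD[OF ab(1) that] .
  have \<phi>w: "\<phi> n (w k) = \<phi> n (z (a k)) - \<phi> n (z (b k))" for n k
    unfolding w_def by (rule linf_on_diff[OF JT_subspace \<phi>(1) zJ zJ])
  \<comment> \<open>The two terms of \<open>w k\<close> have errors of at most
    \<open>1/4 * (1/2) ^ k\<close> each, so the perturbation is used with \<open>B = 1\<close>; the
    final 2 is the bound in the choice of \<open>\<phi>\<close>.\<close>
  show ?thesis
  proof (rule JT.l2_complemented_above[OF M(1), of w "C + 2 * 1" "\<lambda>k. \<phi> (a k)" 2])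
    show "w k \<in> M" for k unfolding w_def by (intro lin_subspace_diff[OF M'(1)] zp(1))
    show "\<phi> (a k) (w k) = 1" for k using \<phi>w \<phi>z late[OF ab(2)] by simp
    show "\<phi> (a k) (w j) = 0" if "k < j" for k j
      using \<phi>w late[OF amono[OF that]] late[of "a k" "b j"] amono[OF that] ab(2)[of j] by simp
    show "upper2 jt_norm w (C + 2 * 1)"
    proof (rule JT.upper2_perturb[OF up])
      show "(\<lambda>t. x (a k) t - x (b k) t) \<in> JT" for k by (intro lin_subspace_diff[OF JT_subspace] xJ)
      show "w k \<in> JT" for k unfolding w_def by (intro lin_subspace_diff[OF JT_subspace] zJ)
      fix k
      have "k \<le> a k" by (rule strict_mono_imp_increasing[OF ab(1)])
      then have pw: "(1/2::real) ^ a k \<le> (1/2) ^ k" "(1/2::real) ^ b k \<le> (1/2) ^ k"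
        using ab(2)[of k] by (auto intro!: power_decreasing)
      have "jt_norm (\<lambda>t. (z (a k) t - x (a k) t) - (z (b k) t - x (b k) t))
          \<le> jt_norm (\<lambda>t. z (a k) t - x (a k) t) + jt_norm (\<lambda>t. z (b k) t - x (b k) t)"
        by (intro JT.N_diff lin_subspace_diff[OF JT_subspace] zJ xJ)
      also have "\<dots> \<le> 1 * (1/2) ^ k"
        using zx_le[of "a k"] zx_le[of "b k"] pw zero_le_power[of "1/2::real" k] by linarith
      also have "(\<lambda>t. (z (a k) t - x (a k) t) - (z (b k) t - x (b k) t)) = (\<lambda>t. w k t - (x (a k) t - x (b k) t))"
        by (auto simp: w_def)
      finally show "jt_norm (\<lambda>t. w k t - (x (a k) t - x (b k) t)) \<le> 1 * (1/2) ^ k" .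
    qed simp
    fix u n assume u: "u \<in> JT"
    have "(\<Sum>k<n. (\<phi> (a k) u)\<^sup>2) \<le> (\<Sum>k<n. 4 * (jt_norm (rst (I (a k)) u))\<^sup>2)"
    proof (rule sum_mono)
      fix k
      have "(\<phi> (a k) u)\<^sup>2 \<le> (2 * jt_norm (rst (I (a k)) u))\<^sup>2"
        using \<phi>(3)[OF u, of "a k"] abs_le_square_iff[of "\<phi> (a k) u" "2 * jt_norm (rst (I (a k)) u)"] by simp
      then show "(\<phi> (a k) u)\<^sup>2 \<le> 4 * (jt_norm (rst (I (a k)) u))\<^sup>2" by (simp add: power_mult_distrib)
    qed
    also have "\<dots> = 4 * (\<Sum>k<n. (jt_norm (rst (I (a k)) u))\<^sup>2)" by (simp add: sum_distrib_left)
    also have "\<dots> \<le> 4 * (jt_norm u)\<^sup>2"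
    proof (intro mult_left_mono sum_norm_rst_le[OF u])
      show "disjoint_family_on (\<lambda>k. I (a k)) {..<n}"
        unfolding I_def by (rule block_intervals_disjoint[OF p ab(1)])
    qed (auto simp: I_def)
    finally show "(\<Sum>k<n. (\<phi> (a k) u)\<^sup>2) \<le> (2 * jt_norm u)\<^sup>2" by (simp add: power_mult_distrib)
  qed (use \<phi>(1) in auto)
qed

section \<open>The dual of JT\<close>

definition ev :: "nat \<Rightarrow> nat \<Rightarrow> real" where
  "ev t = (\<lambda>s. if s = t then 1 else 0)"

text \<open>Different nodes on one level are incomparable, so a segment contains at most one of
  them, and disjoint segments never see the same one.\<close>

lemma level_combination:
  assumes G: "finite G" "\<And>\<sigma>. \<sigma> \<in> G \<Longrightarrow> branch \<sigma>" "inj_on (\<lambda>\<sigma>. \<sigma> R) G"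
  shows "(\<lambda>t. \<Sum>\<sigma>\<in>G. c \<sigma> * ev (\<sigma> R) t) \<in> JT"
    and "jt_norm (\<lambda>t. \<Sum>\<sigma>\<in>G. c \<sigma> * ev (\<sigma> R) t) \<le> sqrt (\<Sum>\<sigma>\<in>G. (c \<sigma>)\<^sup>2)"
proof -
  let ?x = "\<lambda>t. \<Sum>\<sigma>\<in>G. c \<sigma> * ev (\<sigma> R) t"
  have *: "seg_val S ?x \<le> (sqrt (\<Sum>\<sigma>\<in>G. (c \<sigma>)\<^sup>2))\<^sup>2" if S: "seg_fam S" for S
  proof -
    have finS: "finite S" using S by (simp add: seg_fam_def)
    have per: "(\<Sum>t\<in>s. ?x t)\<^sup>2 = (\<Sum>\<sigma>\<in>{\<sigma>\<in>G. \<sigma> R \<in> s}. (c \<sigma>)\<^sup>2)" if s: "s \<in> S" for s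
    proof -
      have fs: "finite s" "segment s" using s S by (auto simp: seg_fam_def)
      let ?Gs = "{\<sigma>\<in>G. \<sigma> R \<in> s}"
      have "(\<Sum>t\<in>s. ?x t) = (\<Sum>\<sigma>\<in>G. \<Sum>t\<in>s. c \<sigma> * ev (\<sigma> R) t)" by (rule sum.swap)
      also have "\<dots> = (\<Sum>\<sigma>\<in>G. if \<sigma> R \<in> s then c \<sigma> else 0)"
        using fs by (intro sum.cong) (simp_all add: ev_def sum_distrib_left[symmetric])
      also have "\<dots> = (\<Sum>\<sigma>\<in>?Gs. c \<sigma>)" using G(1) by (simp add: sum.inter_filter)
      finally have 1: "(\<Sum>t\<in>s. ?x t) = (\<Sum>\<sigma>\<in>?Gs. c \<sigma>)" .
      have uniq: "\<sigma> = \<tau>" if "\<sigma> \<in> ?Gs" "\<tau> \<in> ?Gs" for \<sigma> \<tau>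
      proof -
        have br: "branch \<sigma>" "branch \<tau>" using that G(2) by auto
        have "tree_le (\<sigma> R) (\<tau> R) \<or> tree_le (\<tau> R) (\<sigma> R)" using that fs(2) unfolding segment_def by blast
        then have "\<sigma> R = \<tau> R"
          using tree_le_branch[OF br(2), of "\<sigma> R" R] tree_le_branch[OF br(1), of "\<tau> R" R]
            branch_same_level[OF br] branch_same_level[OF br(2,1)] by metis
        then show ?thesis using inj_onD[OF G(3)] that by blast
      qed
      show ?thesis
      proof (cases "?Gs = {}")
        case True
        show ?thesis unfolding 1 True by simp
      next
        case False
        then obtain \<sigma> where "\<sigma> \<in> ?Gs" by blast
        then have "?Gs = {\<sigma>}" using uniq by blast
        then show ?thesis using 1 by simp
      qed
    qed
    have "seg_val S ?x = (\<Sum>s\<in>S. \<Sum>\<sigma>\<in>{\<sigma>\<in>G. \<sigma> R \<in> s}. (c \<sigma>)\<^sup>2)"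
      unfolding seg_val_def using per by (rule sum.cong[OF refl])
    also have "\<dots> = (\<Sum>\<sigma>\<in>G. \<Sum>s\<in>{s\<in>S. \<sigma> R \<in> s}. (c \<sigma>)\<^sup>2)"
      by (rule sum.swap_restrict[OF finS G(1)])
    also have "\<dots> \<le> (\<Sum>\<sigma>\<in>G. (c \<sigma>)\<^sup>2)"
    proof (rule sum_mono)
      fix \<sigma>
      have "s = s'" if "s \<in> S" "s' \<in> S" "\<sigma> R \<in> s" "\<sigma> R \<in> s'" for s s'
        using S that unfolding seg_fam_def disjoint_def by blast
      then have "card {s\<in>S. \<sigma> R \<in> s} \<le> Suc 0" using finS by (subst card_le_Suc0_iff_eq) auto
      then have "real (card {s\<in>S. \<sigma> R \<in> s}) * (c \<sigma>)\<^sup>2 \<le> 1 * (c \<sigma>)\<^sup>2" by (intro mult_right_mono) auto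
      then show "(\<Sum>s\<in>{s\<in>S. \<sigma> R \<in> s}. (c \<sigma>)\<^sup>2) \<le> (c \<sigma>)\<^sup>2" by simp
    qed
    finally show ?thesis by (simp add: sum_nonneg)
  qed
  show "?x \<in> JT" "jt_norm ?x \<le> sqrt (\<Sum>\<sigma>\<in>G. (c \<sigma>)\<^sup>2)"
    by (rule JT_I[OF *]; simp add: sum_nonneg)+
qed

lemma ev_JT: "ev t \<in> JT" "jt_norm (ev t) \<le> 1"
proof -
  obtain \<sigma> n where "branch \<sigma>" "\<sigma> n = t" using branch_through by blast
  then show "ev t \<in> JT" "jt_norm (ev t) \<le> 1"
    using level_combination[of "{\<sigma>}" n "\<lambda>_. 1"] by auto
qed

section \<open>The dual norm and completeness of the dual\<close>

lemma JT_dual_linf: "f \<in> JT_dual \<Longrightarrow> linf_on JT f"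
  by (simp add: JT_dual_def linf_on_def)

lemma JT_dual_le:
  assumes f: "f \<in> JT_dual" and x: "x \<in> JT"
  shows "\<bar>f x\<bar> \<le> dual_norm f * jt_norm x"
proof (cases "jt_norm x = 0")
  case True
  obtain C where "\<forall>x\<in>JT. \<bar>f x\<bar> \<le> C * jt_norm x" using f by (auto simp: JT_dual_def)
  then have "\<bar>f x\<bar> \<le> C * jt_norm x" using x by blast
  then show ?thesis using True by simp
next
  case False
  then have n: "0 < jt_norm x" using jt_norm_nonneg[OF x] by simp
  let ?y = "\<lambda>t. inverse (jt_norm x) * x t"
  have y: "?y \<in> JT" "jt_norm ?y \<le> 1" using JT_scale_le(1)[OF x] JT_scale[OF x] n by auto
  obtain C where C: "\<forall>x\<in>JT. \<bar>f x\<bar> \<le> C * jt_norm x" using f by (auto simp: JT_dual_def)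
  have "bdd_above {\<bar>f x\<bar> |x. x \<in> JT \<and> jt_norm x \<le> 1}"
  proof (rule bdd_aboveI[of _ "\<bar>C\<bar>"])
    fix v assume "v \<in> {\<bar>f x\<bar> |x. x \<in> JT \<and> jt_norm x \<le> 1}"
    then obtain u where u: "v = \<bar>f u\<bar>" "u \<in> JT" "jt_norm u \<le> 1" by blast
    have "v \<le> C * jt_norm u" using C u by blast
    also have "\<dots> \<le> \<bar>C\<bar> * 1" using u jt_norm_nonneg[OF u(2)] by (intro mult_mono) auto
    finally show "v \<le> \<bar>C\<bar>" by simp
  qed
  then have "\<bar>f ?y\<bar> \<le> dual_norm f"
    unfolding dual_norm_def by (rule cSup_upper[rotated]) (use y in blast)
  moreover have "f ?y = inverse (jt_norm x) * f x" by (rule linf_on_scale[OF JT_dual_linf[OF f] x])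
  ultimately have "inverse (jt_norm x) * \<bar>f x\<bar> \<le> dual_norm f" using n by (simp add: abs_mult)
  then have "jt_norm x * (inverse (jt_norm x) * \<bar>f x\<bar>) \<le> jt_norm x * dual_norm f"
    using n by (intro mult_left_mono) auto
  then show ?thesis using n by (simp add: mult.assoc[symmetric] mult.commute)
qed

lemma dual_norm_le:
  assumes "\<And>x. x \<in> JT \<Longrightarrow> \<bar>f x\<bar> \<le> C * jt_norm x" "0 \<le> C"
  shows "dual_norm f \<le> C"
  unfolding dual_norm_def
proof (rule cSup_least)
  show "{\<bar>f x\<bar> |x. x \<in> JT \<and> jt_norm x \<le> 1} \<noteq> {}" using JT_zero by force
  fix v assume "v \<in> {\<bar>f x\<bar> |x. x \<in> JT \<and> jt_norm x \<le> 1}"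
  then obtain u where u: "v = \<bar>f u\<bar>" "u \<in> JT" "jt_norm u \<le> 1" by blast
  have "v \<le> C * jt_norm u" using assms(1) u by blast
  also have "\<dots> \<le> C * 1" using u assms(2) by (intro mult_left_mono)
  finally show "v \<le> C" by simp
qed

lemma dual_norm_nonneg:
  assumes "f \<in> JT_dual" shows "0 \<le> dual_norm f"
proof (rule ccontr)
  assume neg: "\<not> ?thesis"
  have "1 \<le> jt_norm (ev 0)" using abs_le_jt_norm[OF ev_JT(1), of 0 0] by (simp add: ev_def)
  then have "dual_norm f * jt_norm (ev 0) < 0" using neg by (simp add: mult_neg_pos)
  then show False using JT_dual_le[OF assms ev_JT(1), of 0] by linarith
qed

lemma JT_dualI:
  assumes "linf_on JT f" "\<And>x. x \<in> JT \<Longrightarrow> \<bar>f x\<bar> \<le> C * jt_norm x" "\<And>x. x \<notin> JT \<Longrightarrow> f x = 0"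
  shows "f \<in> JT_dual"
  using assms unfolding JT_dual_def linf_on_def by blast

lemma JT_dual_add:
  assumes "f \<in> JT_dual" "g \<in> JT_dual"
  shows "(\<lambda>x. f x + g x) \<in> JT_dual" "dual_norm (\<lambda>x. f x + g x) \<le> dual_norm f + dual_norm g"
proof -
  have le: "\<bar>f x + g x\<bar> \<le> (dual_norm f + dual_norm g) * jt_norm x" if "x \<in> JT" for x
    using JT_dual_le[OF assms(1) that] JT_dual_le[OF assms(2) that] by (simp add: distrib_right)
  show "(\<lambda>x. f x + g x) \<in> JT_dual"
  proof (rule JT_dualI[OF _ le])
    show "linf_on JT (\<lambda>x. f x + g x)"
      using assms[THEN JT_dual_linf] by (simp add: linf_on_def algebra_simps)
    show "f x + g x = 0" if "x \<notin> JT" for x using assms that by (simp add: JT_dual_def)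
  qed
  show "dual_norm (\<lambda>x. f x + g x) \<le> dual_norm f + dual_norm g"
    using assms by (intro dual_norm_le le add_nonneg_nonneg dual_norm_nonneg)
qed

lemma JT_dual_scale_le:
  assumes "f \<in> JT_dual"
  shows "(\<lambda>x. c * f x) \<in> JT_dual" "dual_norm (\<lambda>x. c * f x) \<le> \<bar>c\<bar> * dual_norm f"
proof -
  have le: "\<bar>c * f x\<bar> \<le> (\<bar>c\<bar> * dual_norm f) * jt_norm x" if "x \<in> JT" for x
    using mult_left_mono[OF JT_dual_le[OF assms that], of "\<bar>c\<bar>"] by (simp add: abs_mult mult.assoc)
  show "(\<lambda>x. c * f x) \<in> JT_dual"
  proof (rule JT_dualI[OF _ le])
    show "linf_on JT (\<lambda>x. c * f x)"
      using JT_dual_linf[OF assms] by (simp add: linf_on_def algebra_simps)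
    show "c * f x = 0" if "x \<notin> JT" for x using assms that by (simp add: JT_dual_def)
  qed
  show "dual_norm (\<lambda>x. c * f x) \<le> \<bar>c\<bar> * dual_norm f"
    using assms by (intro dual_norm_le le mult_nonneg_nonneg dual_norm_nonneg) auto
qed

lemma JT_dual_zero: "(\<lambda>x. 0) \<in> JT_dual" "dual_norm (\<lambda>x. 0) = 0"
proof -
  show z: "(\<lambda>x. 0) \<in> JT_dual" unfolding JT_dual_def using jt_norm_nonneg by (auto intro!: exI[of _ 0])
  have "dual_norm (\<lambda>x. 0) \<le> 0" by (rule dual_norm_le) auto
  then show "dual_norm (\<lambda>x. 0) = 0" using dual_norm_nonneg[OF z] by simp
qed

lemma JT_dual_scale:
  assumes "f \<in> JT_dual"
  shows "dual_norm (\<lambda>x. c * f x) = \<bar>c\<bar> * dual_norm f"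
proof (cases "c = 0")
  case False
  have "dual_norm (\<lambda>x. inverse c * (c * f x)) \<le> \<bar>inverse c\<bar> * dual_norm (\<lambda>x. c * f x)"
    by (rule JT_dual_scale_le(2)[OF JT_dual_scale_le(1)[OF assms]])
  then have "\<bar>c\<bar> * dual_norm f \<le> dual_norm (\<lambda>x. c * f x)"
    using False by (simp add: mult.assoc[symmetric] field_simps)
  then show ?thesis using JT_dual_scale_le(2)[OF assms, of c] by simp
qed (use JT_dual_zero in simp)

lemma JT_dual_subspace: "lin_subspace JT_dual"
  unfolding lin_subspace_def using JT_dual_zero(1) JT_dual_add(1) JT_dual_scale_le(1) by blast

text \<open>Pointwise limits exist at every sequence: off \<open>JT\<close> all functionals are 0 by
  the normalisation, which the limit inherits, and on \<open>JT\<close> the Cauchy estimates hold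
  relative to the norm of the argument.\<close>

lemma JT_dual_complete:
  assumes u: "\<And>n. u n \<in> JT_dual"
    and cau: "\<And>e. 0 < e \<Longrightarrow> \<exists>M. \<forall>m n. M \<le> n \<and> n \<le> m \<longrightarrow> dual_norm (\<lambda>t. u m t - u n t) < e"
  shows "\<exists>g\<in>JT_dual. (\<lambda>n. dual_norm (\<lambda>t. u n t - g t)) \<longlonglongrightarrow> 0"
proof -
  have d: "(\<lambda>t. u m t - u n t) \<in> JT_dual" for m n by (rule lin_subspace_diff[OF JT_dual_subspace u u])
  have est0: "\<exists>M. \<forall>m n. M \<le> n \<and> n \<le> m \<longrightarrow> (\<forall>x\<in>JT. \<bar>u m x - u n x\<bar> \<le> e * jt_norm x)" if e: "0 < e" for e
  proof -
    obtain M where M: "\<forall>m n. M \<le> n \<and> n \<le> m \<longrightarrow> dual_norm (\<lambda>t. u m t - u n t) < e"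
      using cau[OF e] by blast
    have "\<bar>u m x - u n x\<bar> \<le> e * jt_norm x" if "M \<le> n" "n \<le> m" "x \<in> JT" for m n x
    proof -
      have "\<bar>u m x - u n x\<bar> \<le> dual_norm (\<lambda>t. u m t - u n t) * jt_norm x"
        by (rule JT_dual_le[OF d that(3)])
      also have "\<dots> \<le> e * jt_norm x"
        using M that by (intro mult_right_mono jt_norm_nonneg) (auto intro: less_imp_le)
      finally show ?thesis .
    qed
    then show ?thesis by blast
  qed
  have "\<exists>l. (\<lambda>n. u n x) \<longlonglongrightarrow> l" for x
  proof (cases "x \<in> JT")
    case True
    have "Cauchy (\<lambda>n. u n x)"
      unfolding Cauchy_altdef2
    proof (intro allI impI)
      fix e :: real assume e: "0 < e"
      let ?d = "e / (jt_norm x + 1)"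
      have n: "0 < jt_norm x + 1" using jt_norm_nonneg[OF True] by simp
      obtain M where M: "\<forall>m n. M \<le> n \<and> n \<le> m \<longrightarrow> (\<forall>x\<in>JT. \<bar>u m x - u n x\<bar> \<le> ?d * jt_norm x)"
        using est0[of ?d] e n by auto
      have "dist (u n x) (u M x) < e" if "M \<le> n" for n
      proof -
        have "\<bar>u n x - u M x\<bar> \<le> ?d * jt_norm x" using M that True by blast
        also have "\<dots> < e" using e n by (simp add: field_simps)
        finally show ?thesis by (simp add: dist_real_def)
      qed
      then show "\<exists>N. \<forall>n\<ge>N. dist (u n x) (u N x) < e" by blast
    qed
    then show ?thesis using Cauchy_convergent convergent_def by blast
  next
    case False
    then have "u n x = 0" for n using u[of n] by (simp add: JT_dual_def)
    then show ?thesis by (intro exI[of _ 0]) simp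
  qed
  then obtain g where g: "\<And>x. (\<lambda>n. u n x) \<longlonglongrightarrow> g x" by metis
  have est: "\<exists>M. \<forall>n\<ge>M. \<forall>x\<in>JT. \<bar>u n x - g x\<bar> \<le> e * jt_norm x" if e: "0 < e" for e
  proof -
    obtain M where M: "\<forall>m n. M \<le> n \<and> n \<le> m \<longrightarrow> (\<forall>x\<in>JT. \<bar>u m x - u n x\<bar> \<le> e * jt_norm x)"
      using est0[OF e] by blast
    have "\<bar>u n x - g x\<bar> \<le> e * jt_norm x" if "M \<le> n" "x \<in> JT" for n x
    proof (rule tendsto_upperbound)
      show "(\<lambda>m. \<bar>u n x - u m x\<bar>) \<longlonglongrightarrow> \<bar>u n x - g x\<bar>" by (intro tendsto_intros g)
      have "\<bar>u n x - u m x\<bar> \<le> e * jt_norm x" if "n \<le> m" for m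
        using M \<open>M \<le> n\<close> \<open>x \<in> JT\<close> that by (metis abs_minus_commute)
      then show "\<forall>\<^sub>F m in sequentially. \<bar>u n x - u m x\<bar> \<le> e * jt_norm x"
        unfolding eventually_sequentially by blast
    qed simp
    then show ?thesis by blast
  qed
  have lin: "linf_on JT g"
    unfolding linf_on_def
  proof (intro conjI ballI allI)
    fix x y assume xy: "x \<in> JT" "y \<in> JT"
    have "(\<lambda>n. u n (\<lambda>t. x t + y t)) \<longlonglongrightarrow> g x + g y"
      using tendsto_add[OF g g, of x y] linf_on_add[OF JT_dual_linf[OF u] xy] by simp
    then show "g (\<lambda>t. x t + y t) = g x + g y" using g LIMSEQ_unique by blast
  next
    fix x c assume x: "x \<in> JT"
    have "(\<lambda>n. u n (\<lambda>t. c * x t)) \<longlonglongrightarrow> c * g x"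
      using tendsto_mult_left[OF g, of c x] linf_on_scale[OF JT_dual_linf[OF u] x] by simp
    then show "g (\<lambda>t. c * x t) = c * g x" using g LIMSEQ_unique by blast
  qed
  have gJ: "g \<in> JT_dual"
  proof -
    obtain M where M: "\<forall>n\<ge>M. \<forall>x\<in>JT. \<bar>u n x - g x\<bar> \<le> 1 * jt_norm x" using est[of 1] by auto
    have le: "\<bar>g x\<bar> \<le> (dual_norm (u M) + 1) * jt_norm x" if "x \<in> JT" for x
    proof -
      have "\<bar>u M x - g x\<bar> \<le> 1 * jt_norm x" using M that by blast
      then show ?thesis using JT_dual_le[OF u[of M] that] by (simp add: distrib_right)
    qed
    show ?thesis
    proof (rule JT_dualI[OF lin le])
      fix x :: "nat \<Rightarrow> real" assume "x \<notin> JT"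
      then have "u n x = 0" for n using u[of n] by (simp add: JT_dual_def)
      then show "g x = 0" using g[of x] by (simp add: LIMSEQ_const_iff)
    qed
  qed
  have "(\<lambda>n. dual_norm (\<lambda>t. u n t - g t)) \<longlonglongrightarrow> 0"
  proof (rule LIMSEQ_I)
    fix e :: real assume e: "0 < e"
    then obtain M where M: "\<forall>n\<ge>M. \<forall>x\<in>JT. \<bar>u n x - g x\<bar> \<le> e / 2 * jt_norm x"
      using est[of "e/2"] by auto
    have "norm (dual_norm (\<lambda>t. u n t - g t) - 0) < e" if "M \<le> n" for n
    proof -
      have "dual_norm (\<lambda>t. u n t - g t) \<le> e / 2" using M that e by (intro dual_norm_le) auto
      then show ?thesis using e dual_norm_nonneg[OF lin_subspace_diff[OF JT_dual_subspace u gJ], of n] by simp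
    qed
    then show "\<exists>no. \<forall>n\<ge>no. norm (dual_norm (\<lambda>t. u n t - g t) - 0) < e" by blast
  qed
  then show ?thesis using gJ by blast
qed

text \<open>The coordinates of a functional are its values, so \<open>N_point\<close> is the
  boundedness of evaluation at a vector.\<close>

interpretation Dual: fnormed JT_dual dual_norm
proof (unfold_locales)
  show "\<exists>C. \<forall>f\<in>JT_dual. \<bar>f x\<bar> \<le> C * dual_norm f" for x
  proof (cases "x \<in> JT")
    case True
    then show ?thesis using JT_dual_le by (intro exI[of _ "jt_norm x"]) (simp add: mult.commute)
  qed (auto simp: JT_dual_def intro!: exI[of _ 0])
qed (simp_all add: JT_dual_subspace JT_dual_add JT_dual_scale JT_dual_complete)

section \<open>Functionals on branch-null block sequences\<close>

lemma bsum_ev: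
  assumes "branch \<sigma>" shows "bsum (ev t) \<sigma> = (if t \<in> range \<sigma> then 1 else 0)"
proof (cases "t \<in> range \<sigma>")
  case True
  then obtain j where j: "t = \<sigma> j" by blast
  have "bsum (ev t) \<sigma> = (\<Sum>k\<in>{j}. ev t (\<sigma> k))"
    unfolding bsum_def
  proof (rule suminf_finite)
    fix k assume "k \<notin> {j}"
    then have "\<sigma> k \<noteq> \<sigma> j" using branch_inj[OF assms, of UNIV] by (auto dest: injD)
    then show "ev t (\<sigma> k) = 0" by (simp add: ev_def j)
  qed simp
  then show ?thesis using True j by (simp add: ev_def)
next
  case False
  then have "ev t (\<sigma> k) = 0" for k by (auto simp: ev_def)
  then show ?thesis using False by (simp add: bsum_def)
qed

text \<open>Test \<open>f\<close> on the combination of the \<open>y k\<close> with coefficients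
  \<open>f (y k)\<close> and divide by the root of the sum of squares: an upper estimate in
  \<open>JT\<close> dualises to a Bessel inequality.\<close>

lemma dual_bessel:
  assumes up: "upper2 jt_norm y C" and y: "\<And>k. y k \<in> JT" and f: "f \<in> JT_dual"
  shows "(\<Sum>k<n. (f (y k))\<^sup>2) \<le> (C * dual_norm f)\<^sup>2"
proof -
  let ?A = "\<Sum>k<n. (f (y k))\<^sup>2" and ?u = "\<lambda>t. \<Sum>k<n. f (y k) * y k t"
  have A: "0 \<le> ?A" by (simp add: sum_nonneg)
  have u: "?u \<in> JT" using y by (intro lin_subspace_sum[OF JT_subspace]) auto
  have "?A = f ?u"
    using linf_on_sum[OF JT_subspace JT_dual_linf[OF f], of "{..<n}" y "\<lambda>k. f (y k)"] y
    by (simp add: power2_eq_square)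
  also have "\<dots> \<le> dual_norm f * jt_norm ?u" using JT_dual_le[OF f u] by simp
  also have "\<dots> \<le> dual_norm f * (C * sqrt ?A)"
    by (intro mult_left_mono upper2D[OF up] dual_norm_nonneg[OF f])
  finally have le: "sqrt ?A * sqrt ?A \<le> (C * dual_norm f) * sqrt ?A" using A by (simp add: algebra_simps)
  have CD: "0 \<le> C * dual_norm f" using up dual_norm_nonneg[OF f] by (simp add: upper2_def)
  have "sqrt ?A \<le> C * dual_norm f"
  proof (cases "?A = 0")
    case False
    then have "0 < sqrt ?A" using A by simp
    then show ?thesis using le mult_right_le_imp_le by blast
  qed (use CD in simp)
  then have "(sqrt ?A)\<^sup>2 \<le> (C * dual_norm f)\<^sup>2" using A by (intro power_mono) auto
  then show ?thesis using A by simp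
qed

text \<open>Along a subsequence with an upper l2-estimate the values of \<open>f\<close> are square
  summable.\<close>

lemma branch_null_functional:
  assumes B: "blocks p x K" and null: "\<And>\<sigma>. branch \<sigma> \<Longrightarrow> (\<lambda>n. bsum (x n) \<sigma>) \<longlonglongrightarrow> 0"
    and f: "f \<in> JT_dual"
  shows "\<exists>r. strict_mono r \<and> (\<lambda>n. f (x (r n))) \<longlonglongrightarrow> 0"
proof -
  obtain r C where r: "strict_mono r" "upper2 jt_norm (x \<circ> r) C"
    using branch_null_upper2[OF B null] by blast
  have "(\<Sum>k<n. (f ((x \<circ> r) k))\<^sup>2) \<le> (C * dual_norm f)\<^sup>2" for n
    using blocksD(2)[OF B] by (intro dual_bessel[OF r(2) _ f]) simp
  then have "summable (\<lambda>k. (f ((x \<circ> r) k))\<^sup>2)"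
    by (intro summableI_nonneg_bounded) auto
  then have "(\<lambda>k. (f ((x \<circ> r) k))\<^sup>2) \<longlonglongrightarrow> 0" by (rule summable_LIMSEQ_zero)
  then have "(\<lambda>k. \<bar>f ((x \<circ> r) k)\<bar>) \<longlonglongrightarrow> 0" using tendsto_real_sqrt by fastforce
  then have "(\<lambda>k. f ((x \<circ> r) k)) \<longlonglongrightarrow> 0" by (rule tendsto_rabs_zero_cancel)
  then show ?thesis using r(1) by auto
qed

section \<open>Limits along branches of functionals\<close>

text \<open>Otherwise differences of two unit vectors along \<open>\<sigma>\<close> would form a
  block sequence on which \<open>f\<close> stays away from 0. But this sequence is branch-null: on
  \<open>\<sigma>\<close> the two terms cancel, and any other branch eventually leaves
  \<open>\<sigma>\<close>.\<close>

lemma dual_convergent_branch: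
  assumes f: "f \<in> JT_dual" and \<sigma>: "branch \<sigma>"
  shows "convergent (\<lambda>n. f (ev (\<sigma> n)))"
proof (rule ccontr)
  assume "\<not> ?thesis"
  then have "\<not> Cauchy (\<lambda>n. f (ev (\<sigma> n)))" using Cauchy_convergent by blast
  then obtain e where e: "0 < e" and far: "\<And>M. \<exists>m\<ge>M. \<exists>n>m. e \<le> \<bar>f (ev (\<sigma> m)) - f (ev (\<sigma> n))\<bar>"
    unfolding Cauchy_altdef dist_real_def not_all not_imp not_ex not_less by blast
  obtain h :: "nat \<Rightarrow> nat \<times> nat" where h: "\<And>k. fst (h k) < snd (h k)"
    "\<And>k. e \<le> \<bar>f (ev (\<sigma> (fst (h k)))) - f (ev (\<sigma> (snd (h k))))\<bar>" "\<And>k. snd (h k) < fst (h (Suc k))"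
  proof (rule exE[OF dependent_nat_choice[of
      "\<lambda>k a. fst a < snd a \<and> e \<le> \<bar>f (ev (\<sigma> (fst a))) - f (ev (\<sigma> (snd a)))\<bar>" "\<lambda>k a b. snd a < fst b"]])
    obtain m n where "m < n" "e \<le> \<bar>f (ev (\<sigma> m)) - f (ev (\<sigma> n))\<bar>" using far[of 0] by blast
    then show "\<exists>a. fst a < snd a \<and> e \<le> \<bar>f (ev (\<sigma> (fst a))) - f (ev (\<sigma> (snd a)))\<bar>"
      by (intro exI[of _ "(m, n)"]) simp
    fix a :: "nat \<times> nat" and k :: nat
    obtain m n where "Suc (snd a) \<le> m" "m < n" "e \<le> \<bar>f (ev (\<sigma> m)) - f (ev (\<sigma> n))\<bar>" using far[of "Suc (snd a)"] by blast
    then show "\<exists>b. (fst b < snd b \<and> e \<le> \<bar>f (ev (\<sigma> (fst b))) - f (ev (\<sigma> (snd b)))\<bar>) \<and> snd a < fst b"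
      by (intro exI[of _ "(m, n)"]) simp
  qed blast
  define m where "m k = fst (h k)" for k
  define n where "n k = snd (h k)" for k
  have mn: "m k < n k" "n k < m (Suc k)" for k using h(1,3) by (auto simp: m_def n_def)
  note mono = strict_monoD[OF branch_strict_mono[OF \<sigma>]]
  define x where "x k = (\<lambda>t. ev (\<sigma> (m k)) t - ev (\<sigma> (n k)) t)" for k
  have mm: "strict_mono m" using mn by (intro strict_monoI_Suc) (metis less_trans)
  have B: "blocks (\<lambda>k. \<sigma> (m k)) x 2"
    unfolding blocks_def
  proof (intro conjI allI impI)
    show "strict_mono (\<lambda>k. \<sigma> (m k))" using mm mono by (simp add: strict_mono_def)
    fix k
    show "x k \<in> JT" unfolding x_def by (intro lin_subspace_diff[OF JT_subspace] ev_JT)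
    have "jt_norm (x k) \<le> jt_norm (ev (\<sigma> (m k))) + jt_norm (ev (\<sigma> (n k)))"
      unfolding x_def by (intro JT.N_diff ev_JT)
    then show "jt_norm (x k) \<le> 2" using ev_JT(2)[of "\<sigma> (m k)"] ev_JT(2)[of "\<sigma> (n k)"] by linarith
    fix t assume "x k t \<noteq> 0"
    then have "t = \<sigma> (m k) \<or> t = \<sigma> (n k)" by (auto simp: x_def ev_def split: if_splits)
    moreover have "\<sigma> (m k) < \<sigma> (n k)" "\<sigma> (n k) < \<sigma> (m (Suc k))" using mn mono by auto
    ultimately show "\<sigma> (m k) \<le> t" "t < \<sigma> (m (Suc k))" by auto
  qed
  have bs: "bsum (x k) \<tau> = bsum (ev (\<sigma> (m k))) \<tau> - bsum (ev (\<sigma> (n k))) \<tau>" if "branch \<tau>" for \<tau> k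
    unfolding x_def
    by (rule bsum_diff[OF that, of "Suc (\<sigma> (m k) + \<sigma> (n k))"]) (auto simp: ev_def)
  have null: "(\<lambda>k. bsum (x k) \<tau>) \<longlonglongrightarrow> 0" if \<tau>: "branch \<tau>" for \<tau>
  proof (cases "\<tau> = \<sigma>")
    case True
    then have "bsum (x k) \<tau> = 0" for k using bs[OF \<tau>] bsum_ev[OF \<tau>] by simp
    then show ?thesis by simp
  next
    case False
    then obtain i where i: "\<tau> i \<noteq> \<sigma> i" by auto
    have off: "\<sigma> j \<notin> range \<tau>" if "i \<le> j" for j
    proof
      assume "\<sigma> j \<in> range \<tau>"
      then obtain l where l: "\<sigma> j = \<tau> l" by blast
      then have "j = l" by (rule branch_same_level[OF \<sigma> \<tau>])
      then have "\<sigma> j = \<tau> j" using l by simp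
      then show False using branch_agree[OF \<sigma> \<tau> _ that] i by simp
    qed
    have "bsum (x k) \<tau> = 0" if "i \<le> k" for k
    proof -
      have "i \<le> m k" "i \<le> n k" using strict_mono_imp_increasing[OF mm, of k] mn(1)[of k] that by auto
      then show ?thesis using bs[OF \<tau>] bsum_ev[OF \<tau>] off by simp
    qed
    then have "\<forall>\<^sub>F k in sequentially. bsum (x k) \<tau> = 0" unfolding eventually_sequentially by blast
    then show ?thesis by (rule tendsto_eventually)
  qed
  obtain r where "(\<lambda>k. f (x (r k))) \<longlonglongrightarrow> 0" using branch_null_functional[OF B null f] by blast
  then have "(\<lambda>k. \<bar>f (x (r k))\<bar>) \<longlonglongrightarrow> 0" by (rule tendsto_rabs_zero)
  then obtain k where k: "\<bar>f (x (r k))\<bar> < e"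
    using eventually_happens[OF order_tendstoD(2)[OF _ e]] by force
  have "f (x (r k)) = f (ev (\<sigma> (m (r k)))) - f (ev (\<sigma> (n (r k))))"
    unfolding x_def by (rule linf_on_diff[OF JT_subspace JT_dual_linf[OF f] ev_JT(1) ev_JT(1)])
  then show False using k h(2)[of "r k"] by (simp add: m_def n_def)
qed

definition blim :: "((nat \<Rightarrow> real) \<Rightarrow> real) \<Rightarrow> (nat \<Rightarrow> nat) \<Rightarrow> real" where
  "blim f \<sigma> = lim (\<lambda>n. f (ev (\<sigma> n)))"

lemma blim_tendsto:
  assumes "f \<in> JT_dual" "branch \<sigma>" shows "(\<lambda>n. f (ev (\<sigma> n))) \<longlonglongrightarrow> blim f \<sigma>"
  unfolding blim_def using dual_convergent_branch[OF assms] convergent_LIMSEQ_iff by blast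

lemma blim_add:
  assumes "f \<in> JT_dual" "g \<in> JT_dual" "branch \<sigma>"
  shows "blim (\<lambda>x. f x + g x) \<sigma> = blim f \<sigma> + blim g \<sigma>"
  unfolding blim_def[of "\<lambda>x. f x + g x"]
  by (intro limI tendsto_add blim_tendsto assms)

lemma blim_scale:
  assumes "f \<in> JT_dual" "branch \<sigma>"
  shows "blim (\<lambda>x. c * f x) \<sigma> = c * blim f \<sigma>"
  unfolding blim_def[of "\<lambda>x. c * f x"]
  by (intro limI tendsto_mult_left blim_tendsto assms)

lemma level_functional_le:
  assumes f: "f \<in> JT_dual" and G: "finite G" "\<And>\<sigma>. \<sigma> \<in> G \<Longrightarrow> branch \<sigma>" "inj_on (\<lambda>\<sigma>. \<sigma> R) G"
  shows "\<bar>\<Sum>\<sigma>\<in>G. c \<sigma> * f (ev (\<sigma> R))\<bar> \<le> dual_norm f * sqrt (\<Sum>\<sigma>\<in>G. (c \<sigma>)\<^sup>2)"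
proof -
  let ?u = "\<lambda>t. \<Sum>\<sigma>\<in>G. c \<sigma> * ev (\<sigma> R) t"
  have "f ?u = (\<Sum>\<sigma>\<in>G. c \<sigma> * f (ev (\<sigma> R)))"
    by (rule linf_on_sum[OF JT_subspace JT_dual_linf[OF f] G(1)]) (rule ev_JT(1))
  moreover have "\<bar>f ?u\<bar> \<le> dual_norm f * jt_norm ?u" by (rule JT_dual_le[OF f level_combination(1)[OF G]])
  moreover have "dual_norm f * jt_norm ?u \<le> dual_norm f * sqrt (\<Sum>\<sigma>\<in>G. (c \<sigma>)\<^sup>2)"
    by (rule mult_left_mono[OF level_combination(2)[OF G] dual_norm_nonneg[OF f]])
  ultimately show ?thesis by simp
qed

text \<open>On a level where the branches are distinct, testing \<open>f\<close> with its own values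
  as coefficients bounds their l2-norm by \<open>dual_norm f\<close>; the bound persists as the
  level grows.\<close>

lemma blim_sum_le:
  assumes f: "f \<in> JT_dual" and G: "finite G" "\<And>\<sigma>. \<sigma> \<in> G \<Longrightarrow> branch \<sigma>"
  shows "(\<Sum>\<sigma>\<in>G. (blim f \<sigma>)\<^sup>2) \<le> (dual_norm f)\<^sup>2"
proof (rule tendsto_upperbound)
  show "(\<lambda>n. \<Sum>\<sigma>\<in>G. (f (ev (\<sigma> n)))\<^sup>2) \<longlonglongrightarrow> (\<Sum>\<sigma>\<in>G. (blim f \<sigma>)\<^sup>2)"
    by (intro tendsto_sum tendsto_power blim_tendsto f G(2))
  have "(\<Sum>\<sigma>\<in>G. (f (ev (\<sigma> n)))\<^sup>2) \<le> (dual_norm f)\<^sup>2" if n: "inj_on (\<lambda>\<sigma>. \<sigma> n) G" for n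
  proof -
    let ?A = "\<Sum>\<sigma>\<in>G. (f (ev (\<sigma> n)))\<^sup>2"
    have A: "0 \<le> ?A" by (simp add: sum_nonneg)
    have "\<bar>\<Sum>\<sigma>\<in>G. f (ev (\<sigma> n)) * f (ev (\<sigma> n))\<bar> \<le> dual_norm f * sqrt ?A"
      by (rule level_functional_le[OF f G n])
    then have "sqrt ?A * sqrt ?A \<le> dual_norm f * sqrt ?A" using A by (simp add: power2_eq_square)
    then have "sqrt ?A \<le> dual_norm f"
      using A dual_norm_nonneg[OF f] mult_right_le_imp_le[of "sqrt ?A" "sqrt ?A" "dual_norm f"]
      by (cases "?A = 0") auto
    then have "(sqrt ?A)\<^sup>2 \<le> (dual_norm f)\<^sup>2" using A by (intro power_mono) auto
    then show ?thesis using A by simp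
  qed
  then show "\<forall>\<^sub>F n in sequentially. (\<Sum>\<sigma>\<in>G. (f (ev (\<sigma> n)))\<^sup>2) \<le> (dual_norm f)\<^sup>2"
    using eventually_branches_distinct[OF G] by (rule eventually_mono[rotated])
qed simp

text \<open>The inner product of l2 over the uncountable set of branches, pulled back by
  \<open>blim\<close>. It is degenerate on \<open>JT_dual\<close>: coordinate functionals have limit
  0 along every branch.\<close>

definition branch_ip :: "((nat \<Rightarrow> real) \<Rightarrow> real) \<Rightarrow> ((nat \<Rightarrow> real) \<Rightarrow> real) \<Rightarrow> real" where
  "branch_ip f g = (\<Sum>\<^sub>\<infinity>\<sigma>\<in>Collect branch. blim f \<sigma> * blim g \<sigma>)"

lemma blim_square_summable:
  assumes "f \<in> JT_dual" shows "(\<lambda>\<sigma>. (blim f \<sigma>)\<^sup>2) summable_on Collect branch"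
proof (rule nonneg_bdd_above_summable_on)
  have "sum (\<lambda>\<sigma>. (blim f \<sigma>)\<^sup>2) F \<le> (dual_norm f)\<^sup>2" if "F \<subseteq> Collect branch" "finite F" for F
    using that by (intro blim_sum_le[OF assms]) auto
  then show "bdd_above (sum (\<lambda>\<sigma>. (blim f \<sigma>)\<^sup>2) ` {F. F \<subseteq> Collect branch \<and> finite F})"
    by (intro bdd_aboveI[of _ "(dual_norm f)\<^sup>2"]) blast
qed simp

lemma blim_product_summable:
  assumes "f \<in> JT_dual" "g \<in> JT_dual"
  shows "(\<lambda>\<sigma>. blim f \<sigma> * blim g \<sigma>) summable_on Collect branch"
  by (rule abs_summable_summable, rule abs_summable_product)
     (use blim_square_summable[OF assms(1)] blim_square_summable[OF assms(2)] in
       \<open>simp_all add: power2_eq_square abs_mult\<close>)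

lemma branch_ip_sym: "branch_ip f g = branch_ip g f"
  by (simp add: branch_ip_def mult.commute)

lemma branch_ip_linf:
  assumes g: "g \<in> JT_dual" shows "linf_on JT_dual (\<lambda>f. branch_ip f g)"
  unfolding linf_on_def
proof (intro conjI ballI allI)
  fix f h assume fh: "f \<in> JT_dual" "h \<in> JT_dual"
  have "branch_ip (\<lambda>x. f x + h x) g = (\<Sum>\<^sub>\<infinity>\<sigma>\<in>Collect branch. blim f \<sigma> * blim g \<sigma> + blim h \<sigma> * blim g \<sigma>)"
    unfolding branch_ip_def by (rule infsum_cong) (simp add: blim_add[OF fh] distrib_right)
  also have "\<dots> = branch_ip f g + branch_ip h g"
    unfolding branch_ip_def by (intro infsum_add blim_product_summable fh g)
  finally show "branch_ip (\<lambda>x. f x + h x) g = branch_ip f g + branch_ip h g" .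
next
  fix f c assume f: "f \<in> JT_dual"
  have "branch_ip (\<lambda>x. c * f x) g = (\<Sum>\<^sub>\<infinity>\<sigma>\<in>Collect branch. c * (blim f \<sigma> * blim g \<sigma>))"
    unfolding branch_ip_def by (rule infsum_cong) (simp add: blim_scale[OF f])
  then show "branch_ip (\<lambda>x. c * f x) g = c * branch_ip f g"
    by (simp add: branch_ip_def infsum_cmult_right')
qed

lemma branch_ip_self:
  assumes f: "f \<in> JT_dual"
  shows "0 \<le> branch_ip f f" "branch_ip f f \<le> (dual_norm f)\<^sup>2"
    and "finite G \<Longrightarrow> (\<And>\<sigma>. \<sigma> \<in> G \<Longrightarrow> branch \<sigma>) \<Longrightarrow> (\<Sum>\<sigma>\<in>G. (blim f \<sigma>)\<^sup>2) \<le> branch_ip f f"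
proof -
  have eq: "branch_ip f f = infsum (\<lambda>\<sigma>. (blim f \<sigma>)\<^sup>2) (Collect branch)"
    by (simp add: branch_ip_def power2_eq_square)
  show "0 \<le> branch_ip f f" unfolding eq by (rule infsum_nonneg) simp
  show "branch_ip f f \<le> (dual_norm f)\<^sup>2"
    unfolding eq by (rule infsum_le_finite_sums[OF blim_square_summable[OF f]]) (auto intro: blim_sum_le[OF f])
  show "finite G \<Longrightarrow> (\<And>\<sigma>. \<sigma> \<in> G \<Longrightarrow> branch \<sigma>) \<Longrightarrow> (\<Sum>\<sigma>\<in>G. (blim f \<sigma>)\<^sup>2) \<le> branch_ip f f"
    unfolding eq by (rule finite_sum_le_infsum[OF blim_square_summable[OF f]]) auto
qed

lemma eventually_diag_subseq:
  assumes "\<And>k. \<forall>\<^sub>F n in sequentially. P k n"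
  shows "\<exists>r :: nat \<Rightarrow> nat. strict_mono r \<and> (\<forall>k :: nat. P k (r k))"
proof -
  obtain N where N: "\<And>k n. N k \<le> n \<Longrightarrow> P k n" using assms unfolding eventually_sequentially by metis
  define r where "r k = (\<Sum>i\<le>k. Suc (N i))" for k
  have "strict_mono r" by (rule strict_monoI_Suc) (simp add: r_def)
  moreover have "N k \<le> r k" for k
  proof -
    have "Suc (N k) \<le> r k" unfolding r_def by (rule member_le_sum) auto
    then show ?thesis by simp
  qed
  ultimately show ?thesis using N by blast
qed

section \<open>Removing the branch limits from a block sequence\<close>

lemma bsum_sum_ev:
  assumes G: "finite G" and \<tau>: "branch \<tau>"
  shows "bsum (\<lambda>t. \<Sum>\<sigma>\<in>G. c \<sigma> * ev (h \<sigma>) t) \<tau> = (\<Sum>\<sigma>\<in>G. if h \<sigma> \<in> range \<tau> then c \<sigma> else 0)"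
proof -
  define q where "q = Suc (\<Sum>\<sigma>\<in>G. h \<sigma>)"
  have h: "h \<sigma> < q" if "\<sigma> \<in> G" for \<sigma>
    using member_le_sum[OF that, of h] G by (simp add: q_def less_Suc_eq_le)
  have q0: "ev (h \<sigma>) t = 0" if "\<sigma> \<in> G" "q \<le> t" for \<sigma> t using h[OF that(1)] that(2) by (auto simp: ev_def)
  have "bsum (\<lambda>t. \<Sum>\<sigma>\<in>G. c \<sigma> * ev (h \<sigma>) t) \<tau> = (\<Sum>k<q. \<Sum>\<sigma>\<in>G. c \<sigma> * ev (h \<sigma>) (\<tau> k))"
    using q0 by (intro bsum_finite[OF \<tau>]) (simp add: sum.neutral)
  also have "\<dots> = (\<Sum>\<sigma>\<in>G. c \<sigma> * (\<Sum>k<q. ev (h \<sigma>) (\<tau> k)))"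
    by (subst sum.swap) (simp add: sum_distrib_left)
  also have "\<dots> = (\<Sum>\<sigma>\<in>G. c \<sigma> * bsum (ev (h \<sigma>)) \<tau>)"
  proof (intro sum.cong refl)
    fix \<sigma> assume "\<sigma> \<in> G"
    then have "bsum (ev (h \<sigma>)) \<tau> = (\<Sum>k<q. ev (h \<sigma>) (\<tau> k))" using q0 by (intro bsum_finite[OF \<tau>])
    then show "c \<sigma> * (\<Sum>k<q. ev (h \<sigma>) (\<tau> k)) = c \<sigma> * bsum (ev (h \<sigma>)) \<tau>" by simp
  qed
  also have "\<dots> = (\<Sum>\<sigma>\<in>G. if h \<sigma> \<in> range \<tau> then c \<sigma> else 0)"
    by (intro sum.cong) (auto simp: bsum_ev[OF \<tau>])
  finally show ?thesis .
qed

text \<open>Late blocks start beyond the level where the branches in \<open>G\<close> have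
  separated, and there the lower l2-estimate applies.\<close>

lemma limit_square_sum_le:
  assumes B: "blocks p x K" and c: "\<And>\<sigma>. branch \<sigma> \<Longrightarrow> (\<lambda>n. bsum (x n) \<sigma>) \<longlonglongrightarrow> c \<sigma>"
    and G: "finite G" "\<And>\<sigma>. \<sigma> \<in> G \<Longrightarrow> branch \<sigma>"
  shows "(\<Sum>\<sigma>\<in>G. (c \<sigma>)\<^sup>2) \<le> K\<^sup>2"
proof (rule tendsto_upperbound)
  show "(\<lambda>n. \<Sum>\<sigma>\<in>G. (bsum (x n) \<sigma>)\<^sup>2) \<longlonglongrightarrow> (\<Sum>\<sigma>\<in>G. (c \<sigma>)\<^sup>2)"
    by (intro tendsto_sum tendsto_power c G(2))
  obtain R where R: "inj_on (\<lambda>\<sigma>. \<sigma> R) G"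
    using eventually_happens[OF eventually_branches_distinct[OF G]] by auto
  have "(\<Sum>\<sigma>\<in>G. (bsum (x n) \<sigma>)\<^sup>2) \<le> K\<^sup>2" if n: "2 ^ Suc R \<le> n" for n
  proof -
    have "2 ^ Suc R \<le> p n + 1" using n strict_mono_imp_increasing[OF blocksD(1)[OF B], of n] by linarith
    with blocksD(2)[OF B] blocksD(4)[OF B] G R
    have "(\<Sum>\<sigma>\<in>G. (bsum (x n) \<sigma>)\<^sup>2) \<le> (jt_norm (x n))\<^sup>2" by (rule bsum_sum_distinct_le)
    also have "\<dots> \<le> K\<^sup>2" by (rule power_mono[OF blocksD(3)[OF B] jt_norm_nonneg[OF blocksD(2)[OF B]]])
    finally show ?thesis .
  qed
  then show "\<forall>\<^sub>F n in sequentially. (\<Sum>\<sigma>\<in>G. (bsum (x n) \<sigma>)\<^sup>2) \<le> K\<^sup>2"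
    unfolding eventually_sequentially by blast
qed simp

lemma large_limits_finite:
  assumes le: "\<And>G. finite G \<Longrightarrow> (\<And>\<sigma>. \<sigma> \<in> G \<Longrightarrow> branch \<sigma>) \<Longrightarrow> (\<Sum>\<sigma>\<in>G. (c \<sigma>)\<^sup>2) \<le> K" and e: "0 < (e::real)"
  shows "finite {\<sigma>. branch \<sigma> \<and> e \<le> \<bar>c \<sigma>\<bar>}"
proof (rule ccontr)
  assume inf: "infinite {\<sigma>. branch \<sigma> \<and> e \<le> \<bar>c \<sigma>\<bar>}"
  obtain m :: nat where m: "K / e\<^sup>2 < real m" using reals_Archimedean2 by blast
  obtain G where G: "finite G" "card G = m" "G \<subseteq> {\<sigma>. branch \<sigma> \<and> e \<le> \<bar>c \<sigma>\<bar>}"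
    using infinite_arbitrarily_large[OF inf] by blast
  have "real m * e\<^sup>2 = (\<Sum>\<sigma>\<in>G. e\<^sup>2)" using G(2) by simp
  also have "\<dots> \<le> (\<Sum>\<sigma>\<in>G. (c \<sigma>)\<^sup>2)"
  proof (rule sum_mono)
    fix \<sigma> assume "\<sigma> \<in> G"
    then have "e \<le> \<bar>c \<sigma>\<bar>" using G(3) by auto
    then show "e\<^sup>2 \<le> (c \<sigma>)\<^sup>2" using e abs_le_square_iff[of e "c \<sigma>"] by simp
  qed
  also have "\<dots> \<le> K" using G by (intro le) auto
  finally show False using m e by (simp add: field_simps)
qed

text \<open>The subtracted vector puts the mass \<open>c \<sigma>\<close> on one node of each branch
  in the finite set \<open>G k\<close>, so that it has the same branch limits. The level is so high
  that the branches of \<open>G k\<close> are distinct there, hence its norm is controlled by the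
  square sum of \<open>c\<close>. By \<open>growth\<close> the level \<open>p (n k)\<close> fits
  into the block, since its nodes have numbers below \<open>2 ^ Suc (p (n k))\<close>.\<close>

lemma subtract_branch_limits:
  assumes B: "blocks p x 1" and growth: "\<And>n. 2 ^ Suc (p n) \<le> p (Suc n)"
    and c: "\<And>\<sigma>. branch \<sigma> \<Longrightarrow> (\<lambda>n. bsum (x n) \<sigma>) \<longlonglongrightarrow> c \<sigma>"
  defines "G \<equiv> \<lambda>k. {\<sigma>. branch \<sigma> \<and> 1 / real (Suc k) \<le> \<bar>c \<sigma>\<bar>}"
  shows "\<exists>n. strict_mono n \<and> (\<forall>k. inj_on (\<lambda>\<sigma>. \<sigma> (p (n k))) (G k)) \<and>
    blocks (p \<circ> n) (\<lambda>k t. x (n k) t - (\<Sum>\<sigma>\<in>G k. c \<sigma> * ev (\<sigma> (p (n k))) t)) 2 \<and>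
    (\<forall>\<tau>. branch \<tau> \<longrightarrow>
      (\<lambda>k. bsum (\<lambda>t. x (n k) t - (\<Sum>\<sigma>\<in>G k. c \<sigma> * ev (\<sigma> (p (n k))) t)) \<tau>) \<longlonglongrightarrow> 0)"
proof -
  note p = blocksD(1)[OF B]
  have c_le: "(\<Sum>\<sigma>\<in>F. (c \<sigma>)\<^sup>2) \<le> 1" if "finite F" "\<And>\<sigma>. \<sigma> \<in> F \<Longrightarrow> branch \<sigma>" for F
    using limit_square_sum_le[OF B c that] by simp
  have fin: "finite {\<sigma>. branch \<sigma> \<and> e \<le> \<bar>c \<sigma>\<bar>}" if "0 < e" for e
    using large_limits_finite[OF c_le that] .
  have finG: "finite (G k)" and brG: "\<And>\<sigma>. \<sigma> \<in> G k \<Longrightarrow> branch \<sigma>" for k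
    unfolding G_def by (rule fin) auto
  have distinct: "\<forall>\<^sub>F m in sequentially. inj_on (\<lambda>\<sigma>. \<sigma> m) (G k)" for k
    using finG brG by (rule eventually_branches_distinct)
  have p_lim: "filterlim p sequentially sequentially" using p by (rule filterlim_subseq)
  have "\<forall>\<^sub>F m in sequentially. inj_on (\<lambda>\<sigma>. \<sigma> (p m)) (G k)" for k
    using eventually_compose_filterlim[OF distinct p_lim] .
  then obtain n where n: "strict_mono n" "\<And>k. inj_on (\<lambda>\<sigma>. \<sigma> (p (n k))) (G k)"
    using eventually_diag_subseq[of "\<lambda>k m. inj_on (\<lambda>\<sigma>. \<sigma> (p m)) (G k)"] by blast
  define R where "R k = p (n k)" for k
  define w where "w k = (\<lambda>t. \<Sum>\<sigma>\<in>G k. c \<sigma> * ev (\<sigma> (R k)) t)" for k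
  have inj: "inj_on (\<lambda>\<sigma>. \<sigma> (R k)) (G k)" for k using n(2) by (simp add: R_def)
  have w: "w k \<in> JT" "jt_norm (w k) \<le> 1" for k
  proof -
    show "w k \<in> JT" unfolding w_def using finG brG inj by (rule level_combination(1))
    have "jt_norm (w k) \<le> sqrt (\<Sum>\<sigma>\<in>G k. (c \<sigma>)\<^sup>2)"
      unfolding w_def using finG brG inj by (rule level_combination(2))
    also have "\<dots> \<le> sqrt 1" by (intro real_sqrt_le_mono c_le finG brG)
    finally show "jt_norm (w k) \<le> 1" by simp
  qed
  have Suc_le: "p (Suc (n k)) \<le> p (n (Suc k))" for k
    using strict_mono_less_eq[OF p] strict_monoD[OF n(1), of k "Suc k"] by simp
  have w_sup: "p (n k) \<le> t \<and> t < p (n (Suc k))" if wt: "w k t \<noteq> 0" for k t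
  proof -
    have "\<exists>\<sigma>\<in>G k. t = \<sigma> (R k)"
    proof (rule ccontr)
      assume "\<not> ?thesis"
      then have "w k t = 0" unfolding w_def by (intro sum.neutral) (auto simp: ev_def)
      then show False using wt by simp
    qed
    then obtain \<sigma> where \<sigma>: "\<sigma> \<in> G k" "t = \<sigma> (R k)" by blast
    have "R k \<le> t" using branch_ge[OF brG[OF \<sigma>(1)], of "R k"] \<sigma>(2) by simp
    moreover have "t < 2 ^ Suc (R k)" using branch_bounds(2)[OF brG[OF \<sigma>(1)], of "R k"] \<sigma>(2) by simp
    ultimately show ?thesis using growth[of "n k"] Suc_le[of k] unfolding R_def by linarith
  qed
  have x_sup: "p (n k) \<le> t \<and> t < p (n (Suc k))" if "x (n k) t \<noteq> 0" for k t
    using blocksD(4)[OF B that] Suc_le[of k] by simp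
  have Bz: "blocks (p \<circ> n) (\<lambda>k t. x (n k) t - w k t) 2"
    unfolding blocks_def
  proof (intro conjI allI impI)
    show "strict_mono (p \<circ> n)" by (rule strict_mono_o[OF p n(1)])
    fix k
    show "(\<lambda>t. x (n k) t - w k t) \<in> JT" by (intro lin_subspace_diff[OF JT_subspace] w blocksD(2)[OF B])
    have "jt_norm (\<lambda>t. x (n k) t - w k t) \<le> jt_norm (x (n k)) + jt_norm (w k)"
      by (intro JT.N_diff w blocksD(2)[OF B])
    then show "jt_norm (\<lambda>t. x (n k) t - w k t) \<le> 2" using w(2)[of k] blocksD(3)[OF B, of "n k"] by linarith
    fix t assume "x (n k) t - w k t \<noteq> 0"
    then have "x (n k) t \<noteq> 0 \<or> w k t \<noteq> 0" by auto
    then show "(p \<circ> n) k \<le> t" "t < (p \<circ> n) (Suc k)" using x_sup w_sup by auto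
  qed
  have null: "(\<lambda>k. bsum (\<lambda>t. x (n k) t - w k t) \<tau>) \<longlonglongrightarrow> 0" if \<tau>: "branch \<tau>" for \<tau>
  proof -
    \<comment> \<open>The mass at the node of \<open>\<tau>\<close> on the chosen level. At most one
      branch of \<open>G k\<close> passes through it, so this is a single limit or 0.\<close>
    define L where "L k = (\<Sum>\<sigma>\<in>{\<sigma>\<in>G k. \<sigma> (R k) = \<tau> (R k)}. c \<sigma>)" for k
    have "bsum (w k) \<tau> = L k" for k
    proof -
      have "\<sigma> (R k) \<in> range \<tau> \<longleftrightarrow> \<sigma> (R k) = \<tau> (R k)" if "\<sigma> \<in> G k" for \<sigma>
        using branch_same_level[OF brG[OF that] \<tau>] by (metis rangeE rangeI)
      then have "bsum (w k) \<tau> = (\<Sum>\<sigma>\<in>G k. if \<sigma> (R k) = \<tau> (R k) then c \<sigma> else 0)"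
        unfolding w_def bsum_sum_ev[OF finG \<tau>] by (intro sum.cong) auto
      then show ?thesis unfolding L_def using finG by (simp add: sum.inter_filter)
    qed
    moreover have "bsum (\<lambda>t. x (n k) t - w k t) \<tau> = bsum (x (n k)) \<tau> - bsum (w k) \<tau>" for k
    proof (rule bsum_diff[OF \<tau>])
      fix t assume t: "p (n (Suc k)) \<le> t"
      show "x (n k) t = 0" using x_sup[of k t] t by fastforce
      show "w k t = 0" using w_sup[of k t] t by fastforce
    qed
    moreover have "L \<longlonglongrightarrow> c \<tau>"
    proof (rule LIMSEQ_I)
      fix e :: real assume e: "0 < e"
      \<comment> \<open>Finitely many branches, eventually distinct on the level. If
        \<open>\<tau> \<notin> G k\<close>, a branch of \<open>G k\<close> through the same node
        lies outside \<open>H\<close> and so has a small limit, and the limit of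
        \<open>\<tau>\<close> is small as well.\<close>
      define H where "H = insert \<tau> {\<sigma>. branch \<sigma> \<and> e / 3 \<le> \<bar>c \<sigma>\<bar>}"
      have H: "finite H" "\<And>\<sigma>. \<sigma> \<in> H \<Longrightarrow> branch \<sigma>" using fin[of "e/3"] e \<tau> by (auto simp: H_def)
      have "filterlim R sequentially sequentially"
        unfolding R_def using filterlim_subseq[OF strict_mono_o[OF p n(1)]] by (simp add: comp_def)
      then have "\<forall>\<^sub>F k in sequentially. inj_on (\<lambda>\<sigma>. \<sigma> (R k)) H"
        using eventually_branches_distinct[OF H] filterlim_iff by blast
      then obtain k0 where k0: "\<And>k. k0 \<le> k \<Longrightarrow> inj_on (\<lambda>\<sigma>. \<sigma> (R k)) H"
        unfolding eventually_sequentially by blast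
      obtain k1 where k1: "inverse (real (Suc k1)) < e / 3" using reals_Archimedean[of "e/3"] e by auto
      have "norm (L k - c \<tau>) < e" if k: "max k0 k1 \<le> k" for k
      proof -
        let ?A = "{\<sigma>\<in>G k. \<sigma> (R k) = \<tau> (R k)}"
        have "1 / real (Suc k) \<le> 1 / real (Suc k1)" using k by (intro divide_left_mono) auto
        then have small: "1 / real (Suc k) < e / 3" using k1 by (simp add: inverse_eq_divide)
        have uniq: "\<sigma> = \<sigma>'" if "\<sigma> \<in> ?A" "\<sigma>' \<in> ?A" for \<sigma> \<sigma>'
          using that inj_onD[OF inj[of k], of \<sigma> \<sigma>'] by auto
        show ?thesis
        proof (cases "\<tau> \<in> G k")
          case True
          then have "?A = {\<tau>}" using uniq by blast
          then show ?thesis using e by (simp add: L_def)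
        next
          case False
          then have ct: "\<bar>c \<tau>\<bar> < e / 3" using \<tau> small by (simp add: G_def)
          have "\<bar>L k\<bar> < e / 3"
          proof (cases "?A = {}")
            case True
            show ?thesis unfolding L_def True using e by simp
          next
            case False
            then obtain \<sigma> where \<sigma>: "\<sigma> \<in> ?A" by blast
            then have A: "?A = {\<sigma>}" using uniq by blast
            have "\<sigma> \<noteq> \<tau>" using \<sigma> \<open>\<tau> \<notin> G k\<close> by blast
            moreover have "\<tau> \<in> H" by (simp add: H_def)
            moreover have "inj_on (\<lambda>\<sigma>. \<sigma> (R k)) H" using k0 k by simp
            ultimately have "\<sigma> \<notin> H" using \<sigma> by (auto dest: inj_onD)
            then have "\<bar>c \<sigma>\<bar> < e / 3" using brG \<sigma> by (auto simp: H_def)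
            then show ?thesis unfolding L_def A by simp
          qed
          then show ?thesis using ct by (simp add: abs_if split: if_splits)
        qed
      qed
      then show "\<exists>k0. \<forall>k\<ge>k0. norm (L k - c \<tau>) < e" by blast
    qed
    moreover have "(\<lambda>k. bsum (x (n k)) \<tau>) \<longlonglongrightarrow> c \<tau>"
      using LIMSEQ_subseq_LIMSEQ[OF c[OF \<tau>] n(1)] by (simp add: comp_def)
    ultimately show ?thesis using tendsto_diff[of "\<lambda>k. bsum (x (n k)) \<tau>" "c \<tau>" sequentially L "c \<tau>"] by simp
  qed
  show ?thesis
    using n Bz null unfolding w_def R_def by (intro exI[of _ n]) blast
qed

section \<open>Subspaces of the dual\<close>

lemma JT_dual_vanish:
  assumes f: "f \<in> JT_dual" and p: "\<And>i. i < p \<Longrightarrow> f (ev i) = 0" and x: "\<And>t. p \<le> t \<Longrightarrow> x t = 0"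
  shows "f x = 0"
proof -
  have "x = (\<lambda>t. \<Sum>i<p. x i * ev i t)"
  proof
    fix t
    have "(\<Sum>i<p. x i * ev i t) = (\<Sum>i<p. if i = t then x i else 0)"
      by (intro sum.cong) (auto simp: ev_def)
    then show "x t = (\<Sum>i<p. x i * ev i t)" using x[of t] by simp
  qed
  moreover have "f (\<lambda>t. \<Sum>i<p. x i * ev i t) = (\<Sum>i<p. x i * f (ev i))"
    by (rule linf_on_sum[OF JT_subspace JT_dual_linf[OF f]]) (auto intro: ev_JT)
  ultimately show ?thesis using p by simp
qed

text \<open>If the tail norms of \<open>f\<close> stayed above the norm of its limits along branches, they would be
  witnessed by a block sequence; subtracting its branch limits leaves a sequence on which \<open>f\<close> tends to 0.\<close>
lemma functional_tail:
  assumes f: "f \<in> JT_dual" and e: "0 < e"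
  shows "\<exists>p. \<forall>x\<in>JT. (\<forall>t<p. x t = 0) \<longrightarrow> \<bar>f x\<bar> \<le> (sqrt (branch_ip f f) + e) * jt_norm x"
proof (rule ccontr)
  define Q where "Q = sqrt (branch_ip f f)"
  have Q: "0 \<le> Q" using branch_ip_self(1)[OF f] by (simp add: Q_def)
  note lin = JT_dual_linf[OF f]
  assume "\<not> ?thesis"
  then have neg: "\<exists>x\<in>JT. (\<forall>t<p. x t = 0) \<and> (Q + e) * jt_norm x < \<bar>f x\<bar>" for p
    unfolding Q_def by (meson not_le)
  \<comment> \<open>Normalised block witnesses; the growth of the end points that
    \<open>subtract_branch_limits\<close> wants is built in.\<close>
  define good where "good x p q \<longleftrightarrow> x \<in> JT \<and> jt_norm x \<le> 1 \<and> (\<forall>t. x t \<noteq> 0 \<longrightarrow> p \<le> t \<and> t < q) \<and>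
      Q + e < f x \<and> 2 ^ Suc p \<le> q" for x p and q :: nat
  have step: "\<exists>x q. good x p q" for p
  proof -
    obtain x where x: "x \<in> JT" "\<forall>t<p. x t = 0" "(Q + e) * jt_norm x < \<bar>f x\<bar>" using neg by blast
    have n: "0 < jt_norm x"
    proof (rule ccontr)
      assume "\<not> ?thesis"
      then have "jt_norm x = 0" using jt_norm_nonneg[OF x(1)] by simp
      then show False using x(3) JT_dual_le[OF f x(1)] by simp
    qed
    define s where "s = sgn (f x) * inverse (jt_norm x)"
    define y where "y = (\<lambda>t. s * x t)"
    have "0 \<le> (Q + e) * jt_norm x" using n Q e by (intro mult_nonneg_nonneg) auto
    then have fx: "f x \<noteq> 0" using x(3) by auto
    have y: "y \<in> JT" "jt_norm y = 1"
      using JT_scale_le(1)[OF x(1)] JT_scale[OF x(1), of s] n fx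
      by (auto simp: y_def s_def abs_mult abs_sgn_eq)
    have "f y = s * f x" unfolding y_def by (rule linf_on_scale[OF lin x(1)])
    also have "\<dots> = \<bar>f x\<bar> / jt_norm x" by (simp add: s_def field_simps abs_sgn)
    finally have fy: "Q + e < f y" using x(3) n by (simp add: pos_less_divide_eq)
    \<comment> \<open>Cutting off a tail of norm at most \<open>d\<close> lowers \<open>f\<close> by
      less than its excess over \<open>Q + e\<close>.\<close>
    define d where "d = (f y - (Q + e)) / (dual_norm f + 1)"
    have D: "0 < dual_norm f + 1" using dual_norm_nonneg[OF f] by simp
    have d: "0 < d" using fy D by (simp add: d_def)
    obtain q0 where q0: "\<forall>q\<ge>q0. jt_norm (rst {q..} y) \<le> d" using JT_tail[OF y(1) d] by blast
    define q where "q = max q0 (2 ^ Suc p)"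
    have qJ: "rst {q..} y \<in> JT" "rst {..<q} y \<in> JT" "jt_norm (rst {..<q} y) \<le> 1"
      using JT_rst[OF y(1)] y(2) by auto
    have "rst {..<q} y = (\<lambda>t. y t - rst {q..} y t)" by (auto simp: rst_def)
    then have "f (rst {..<q} y) = f y - f (rst {q..} y)"
      using linf_on_diff[OF JT_subspace lin y(1) qJ(1)] by simp
    moreover have "\<bar>f (rst {q..} y)\<bar> < f y - (Q + e)"
    proof -
      have "\<bar>f (rst {q..} y)\<bar> \<le> dual_norm f * jt_norm (rst {q..} y)" by (rule JT_dual_le[OF f qJ(1)])
      also have "\<dots> \<le> dual_norm f * d" using q0 dual_norm_nonneg[OF f] by (intro mult_left_mono) (auto simp: q_def)
      also have "\<dots> < (dual_norm f + 1) * d" using d by (simp add: distrib_right)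
      also have "\<dots> = f y - (Q + e)" using D by (simp add: d_def)
      finally show ?thesis .
    qed
    ultimately have "Q + e < f (rst {..<q} y)" by linarith
    moreover have "p \<le> t \<and> t < q" if "rst {..<q} y t \<noteq> 0" for t
      using that x(2) by (auto simp: rst_def y_def not_le[symmetric] split: if_splits)
    ultimately have "good (rst {..<q} y) p q" using qJ by (auto simp: good_def q_def)
    then show ?thesis by blast
  qed
  obtain h :: "nat \<Rightarrow> (nat \<Rightarrow> real) \<times> nat \<times> nat" where h:
    "\<And>n. good (fst (h n)) (fst (snd (h n))) (snd (snd (h n)))" "\<And>n. fst (snd (h (Suc n))) = snd (snd (h n))"
  proof (rule exE[OF dependent_nat_choice[of "\<lambda>n a. good (fst a) (fst (snd a)) (snd (snd a))"
      "\<lambda>n a b. fst (snd b) = snd (snd a)"]])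
    obtain x q where "good x 0 q" using step by blast
    then show "\<exists>a. good (fst a) (fst (snd a)) (snd (snd a))" by (intro exI[of _ "(x, 0, q)"]) simp
    fix a :: "(nat \<Rightarrow> real) \<times> nat \<times> nat" and n :: nat
    obtain x q where "good x (snd (snd a)) q" using step by blast
    then show "\<exists>b. good (fst b) (fst (snd b)) (snd (snd b)) \<and> fst (snd b) = snd (snd a)"
      by (intro exI[of _ "(x, snd (snd a), q)"]) simp
  qed blast
  define x0 where "x0 n = fst (h n)" for n
  define p0 where "p0 n = fst (snd (h n))" for n
  have g0: "good (x0 n) (p0 n) (p0 (Suc n))" for n using h(1)[of n] h(2)[of n] by (simp add: x0_def p0_def)
  have grow0: "2 ^ Suc (p0 n) \<le> p0 (Suc n)" for n using g0[of n] by (simp add: good_def)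
  have p0: "strict_mono p0"
  proof (rule strict_monoI_Suc)
    fix n
    have "p0 n < 2 ^ p0 n" by (rule less_exp)
    also have "\<dots> \<le> p0 (Suc n)" using grow0[of n] by simp
    finally show "p0 n < p0 (Suc n)" .
  qed
  have B0: "blocks p0 x0 1" unfolding blocks_def using p0 g0 by (auto simp: good_def)
  obtain r where r: "strict_mono r" "\<And>\<sigma>. branch \<sigma> \<Longrightarrow> convergent (\<lambda>n. bsum (x0 (r n)) \<sigma>)"
    using branch_convergent_subseq[OF B0] by blast
  define x where "x = x0 \<circ> r"
  define p where "p = p0 \<circ> r"
  have B: "blocks p x 1" unfolding x_def p_def by (rule blocks_subseq[OF B0 r(1)])
  have growth: "2 ^ Suc (p n) \<le> p (Suc n)" for n
  proof -
    have "p0 (Suc (r n)) \<le> p0 (r (Suc n))"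
      using strict_mono_less_eq[OF p0] strict_monoD[OF r(1), of n "Suc n"] by simp
    then show ?thesis using grow0[of "r n"] by (simp add: p_def)
  qed
  have fx: "Q + e < f (x n)" for n using g0[of "r n"] by (simp add: x_def good_def)
  define c where "c \<sigma> = lim (\<lambda>n. bsum (x n) \<sigma>)" for \<sigma>
  have c: "(\<lambda>n. bsum (x n) \<sigma>) \<longlonglongrightarrow> c \<sigma>" if "branch \<sigma>" for \<sigma>
    using r(2)[OF that] unfolding c_def x_def by (simp add: convergent_LIMSEQ_iff)
  define G where "G k = {\<sigma>. branch \<sigma> \<and> 1 / real (Suc k) \<le> \<bar>c \<sigma>\<bar>}" for k
  have c_le: "(\<Sum>\<sigma>\<in>F. (c \<sigma>)\<^sup>2) \<le> 1" if "finite F" "\<And>\<sigma>. \<sigma> \<in> F \<Longrightarrow> branch \<sigma>" for F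
    using limit_square_sum_le[OF B c that] by simp
  have finG: "finite (G k)" for k
    unfolding G_def using c_le by (rule large_limits_finite) auto
  have brG: "branch \<sigma>" if "\<sigma> \<in> G k" for \<sigma> k using that by (simp add: G_def)
  obtain n where n: "strict_mono n" "\<forall>k. inj_on (\<lambda>\<sigma>. \<sigma> (p (n k))) (G k)"
    and Bz: "blocks (p \<circ> n) (\<lambda>k t. x (n k) t - (\<Sum>\<sigma>\<in>G k. c \<sigma> * ev (\<sigma> (p (n k))) t)) 2"
    and nz: "\<forall>\<tau>. branch \<tau> \<longrightarrow>
      (\<lambda>k. bsum (\<lambda>t. x (n k) t - (\<Sum>\<sigma>\<in>G k. c \<sigma> * ev (\<sigma> (p (n k))) t)) \<tau>) \<longlonglongrightarrow> 0"
    using subtract_branch_limits[OF B growth c] unfolding G_def by blast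
  define R where "R k = p (n k)" for k
  have inj: "inj_on (\<lambda>\<sigma>. \<sigma> (R k)) (G k)" for k using n(2) by (simp add: R_def)
  define z where "z k = (\<lambda>t. x (n k) t - (\<Sum>\<sigma>\<in>G k. c \<sigma> * ev (\<sigma> (R k)) t))" for k
  \<comment> \<open>The value of \<open>f\<close> on the subtracted vector. By Cauchy-Schwarz
    against \<open>blim f\<close> it is asymptotically at most \<open>Q\<close>, while
    \<open>f (x n)\<close> exceeds \<open>Q + e\<close>; so the difference \<open>f (z k)\<close>
    cannot tend to 0 along any subsequence.\<close>
  define T where "T k = (\<Sum>\<sigma>\<in>G k. c \<sigma> * f (ev (\<sigma> (R k))))" for k
  obtain u where u: "strict_mono u" "(\<lambda>k. f (z (u k))) \<longlonglongrightarrow> 0"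
    using branch_null_functional[OF Bz _ f] nz unfolding z_def R_def by blast
  have fz: "f (z k) = f (x (n k)) - T k" for k
  proof -
    have "(\<lambda>t. \<Sum>\<sigma>\<in>G k. c \<sigma> * ev (\<sigma> (R k)) t) \<in> JT"
      using finG brG inj by (rule level_combination(1))
    then have "f (z k) = f (x (n k)) - f (\<lambda>t. \<Sum>\<sigma>\<in>G k. c \<sigma> * ev (\<sigma> (R k)) t)"
      unfolding z_def by (rule linf_on_diff[OF JT_subspace lin blocksD(2)[OF B]])
    also have "f (\<lambda>t. \<Sum>\<sigma>\<in>G k. c \<sigma> * ev (\<sigma> (R k)) t) = T k"
      unfolding T_def by (rule linf_on_sum[OF JT_subspace lin finG]) (rule ev_JT(1))
    finally show ?thesis .
  qed
  have T_le: "\<forall>\<^sub>F k in sequentially. T k < Q + e / 2"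
  proof -
    define d where "d = e / (4 * (dual_norm f + 1))"
    have D: "0 < dual_norm f + 1" using dual_norm_nonneg[OF f] by simp
    have d: "0 < d" using e D by (simp add: d_def)
    \<comment> \<open>A finite \<open>F\<close> that nearly exhausts the supremum of the square sums
      makes the part of \<open>T k\<close> off \<open>F\<close> small for all \<open>k\<close>
      simultaneously; on \<open>F\<close> only finitely many branch limits of \<open>f\<close>
      matter.\<close>
    define W where "W = {\<Sum>\<sigma>\<in>F. (c \<sigma>)\<^sup>2 | F. finite F \<and> (\<forall>\<sigma>\<in>F. branch \<sigma>)}"
    have W: "W \<noteq> {}" "bdd_above W"
      unfolding W_def using c_le by (auto intro!: bdd_aboveI[of _ 1])
    have "Sup W - d\<^sup>2 < Sup W" using d by simp
    then obtain v where "v \<in> W" "Sup W - d\<^sup>2 < v" using less_cSup_iff[OF W] by blast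
    then obtain F where F: "finite F" "\<forall>\<sigma>\<in>F. branch \<sigma>" "Sup W - d\<^sup>2 < (\<Sum>\<sigma>\<in>F. (c \<sigma>)\<^sup>2)"
      unfolding W_def by blast
    have rest: "\<bar>\<Sum>\<sigma>\<in>G k - F. c \<sigma> * f (ev (\<sigma> (R k)))\<bar> \<le> e / 4" for k
    proof -
      have "(\<Sum>\<sigma>\<in>F \<union> (G k - F). (c \<sigma>)\<^sup>2) \<in> W" unfolding W_def using F finG brG by auto
      then have "(\<Sum>\<sigma>\<in>F \<union> (G k - F). (c \<sigma>)\<^sup>2) \<le> Sup W" using W(2) by (rule cSup_upper)
      moreover have "(\<Sum>\<sigma>\<in>F \<union> (G k - F). (c \<sigma>)\<^sup>2) = (\<Sum>\<sigma>\<in>F. (c \<sigma>)\<^sup>2) + (\<Sum>\<sigma>\<in>G k - F. (c \<sigma>)\<^sup>2)"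
        using F(1) finG by (intro sum.union_disjoint) auto
      ultimately have "(\<Sum>\<sigma>\<in>G k - F. (c \<sigma>)\<^sup>2) \<le> d\<^sup>2" using F(3) by linarith
      then have "sqrt (\<Sum>\<sigma>\<in>G k - F. (c \<sigma>)\<^sup>2) \<le> d" using d by (intro real_le_lsqrt) (auto simp: sum_nonneg)
      moreover have "\<bar>\<Sum>\<sigma>\<in>G k - F. c \<sigma> * f (ev (\<sigma> (R k)))\<bar> \<le> dual_norm f * sqrt (\<Sum>\<sigma>\<in>G k - F. (c \<sigma>)\<^sup>2)"
        using finG brG inj_on_subset[OF inj Diff_subset] by (intro level_functional_le[OF f]) auto
      ultimately have "\<bar>\<Sum>\<sigma>\<in>G k - F. c \<sigma> * f (ev (\<sigma> (R k)))\<bar> \<le> dual_norm f * d"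
        using dual_norm_nonneg[OF f] by (meson mult_left_mono order_trans)
      also have "\<dots> \<le> (dual_norm f + 1) * d" using d by (simp add: distrib_right)
      also have "\<dots> = e / 4" using D by (simp add: d_def field_simps)
      finally show ?thesis .
    qed
    have lim: "(\<lambda>k. \<Sum>\<sigma>\<in>F. c \<sigma> * f (ev (\<sigma> (R k)))) \<longlonglongrightarrow> (\<Sum>\<sigma>\<in>F. c \<sigma> * blim f \<sigma>)"
    proof (intro tendsto_sum tendsto_mult_left)
      fix \<sigma> assume "\<sigma> \<in> F"
      then have "(\<lambda>m. f (ev (\<sigma> m))) \<longlonglongrightarrow> blim f \<sigma>" using F(2) blim_tendsto[OF f] by blast
      from LIMSEQ_subseq_LIMSEQ[OF this strict_mono_o[OF blocksD(1)[OF B] n(1)]]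
      show "(\<lambda>k. f (ev (\<sigma> (R k)))) \<longlonglongrightarrow> blim f \<sigma>" by (simp add: R_def comp_def)
    qed
    have "(\<Sum>\<sigma>\<in>F. c \<sigma> * blim f \<sigma>) \<le> Q"
    proof -
      have "(\<Sum>\<sigma>\<in>F. c \<sigma> * blim f \<sigma>)\<^sup>2 \<le> (\<Sum>\<sigma>\<in>F. (c \<sigma>)\<^sup>2) * (\<Sum>\<sigma>\<in>F. (blim f \<sigma>)\<^sup>2)"
        by (rule Cauchy_Schwarz_ineq_sum)
      also have "\<dots> \<le> 1 * branch_ip f f"
        using F(1,2) by (intro mult_mono c_le branch_ip_self(3)[OF f]) (auto simp: sum_nonneg)
      also have "\<dots> = Q\<^sup>2" using branch_ip_self(1)[OF f] by (simp add: Q_def)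
      finally show ?thesis using Q by (rule power2_le_imp_le)
    qed
    then have "\<forall>\<^sub>F k in sequentially. (\<Sum>\<sigma>\<in>F. c \<sigma> * f (ev (\<sigma> (R k)))) < Q + e / 4"
      using e by (intro order_tendstoD(2)[OF lim]) linarith
    \<comment> \<open>A branch of \<open>F\<close> with nonzero \<open>c\<close> eventually enters
      \<open>G k\<close>, so the sum over \<open>G k \<inter> F\<close> becomes the full sum over
      \<open>F\<close>.\<close>
    moreover have "\<forall>\<^sub>F k in sequentially. \<forall>\<sigma>\<in>F. c \<sigma> = 0 \<or> \<sigma> \<in> G k"
    proof (intro eventually_ball_finite ballI F(1))
      fix \<sigma> assume \<sigma>: "\<sigma> \<in> F"
      show "\<forall>\<^sub>F k in sequentially. c \<sigma> = 0 \<or> \<sigma> \<in> G k"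
      proof (cases "c \<sigma> = 0")
        case False
        then obtain k0 where k0: "inverse (real (Suc k0)) < \<bar>c \<sigma>\<bar>" using reals_Archimedean[of "\<bar>c \<sigma>\<bar>"] by auto
        have "\<sigma> \<in> G k" if "k0 \<le> k" for k
        proof -
          have "1 / real (Suc k) \<le> 1 / real (Suc k0)" using that by (intro divide_left_mono) auto
          then show ?thesis using k0 F(2) \<sigma> by (simp add: G_def inverse_eq_divide)
        qed
        then show ?thesis unfolding eventually_sequentially by blast
      qed simp
    qed
    ultimately show ?thesis
    proof eventually_elim
      case (elim k)
      have "T k = (\<Sum>\<sigma>\<in>G k \<inter> F. c \<sigma> * f (ev (\<sigma> (R k)))) + (\<Sum>\<sigma>\<in>G k - F. c \<sigma> * f (ev (\<sigma> (R k))))"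
        unfolding T_def by (rule sum.Int_Diff[OF finG])
      also have "(\<Sum>\<sigma>\<in>G k \<inter> F. c \<sigma> * f (ev (\<sigma> (R k)))) = (\<Sum>\<sigma>\<in>F. c \<sigma> * f (ev (\<sigma> (R k))))"
        using F(1) elim(2) by (intro sum.mono_neutral_left) auto
      finally show ?case using elim(1) rest[of k] by linarith
    qed
  qed
  have "\<forall>\<^sub>F k in sequentially. e / 2 < f (z (u k))"
    using eventually_compose_filterlim[OF T_le filterlim_subseq[OF u(1)]]
  proof eventually_elim
    case (elim k)
    then show ?case using fz[of "u k"] fx[of "n (u k)"] by linarith
  qed
  moreover have "\<forall>\<^sub>F k in sequentially. f (z (u k)) < e / 2"
    using e by (intro order_tendstoD(2)[OF u(2)]) simp
  ultimately have "\<forall>\<^sub>F k in sequentially. False" by eventually_elim simp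
  then show False by simp
qed

text \<open>On the subspace \<open>E\<close> of finite codimension in \<open>N\<close> the seminorm
  from \<open>branch_ip\<close> is equivalent to \<open>dual_norm\<close>, the other inequality
  holding on the whole dual. An orthonormal sequence in \<open>E\<close> thus has upper constant
  \<open>1 / d\<close>, and its coefficient functionals satisfy Bessel's inequality on all of
  \<open>JT_dual\<close>.\<close>

lemma dual_subspace_hilbertian:
  assumes N: "closed_subspace_in JT_dual dual_norm N" "infinite_dim N" and d: "0 < d"
    and le: "\<And>f. f \<in> N \<Longrightarrow> (\<And>i. i < p \<Longrightarrow> f (ev i) = 0) \<Longrightarrow> d * dual_norm f \<le> sqrt (branch_ip f f)"
  shows "\<exists>Y. Y \<subseteq> N \<and> closed_subspace_in JT_dual dual_norm Y \<and>
    isomorphic_to_l2 dual_norm Y \<and> complemented_in JT_dual dual_norm Y"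
proof -
  have N': "lin_subspace N" "N \<subseteq> JT_dual" using N(1) by (auto simp: closed_subspace_in_def)
  define E where "E = {f\<in>N. \<forall>i<p. f (ev i) = 0}"
  let ?F = "(\<lambda>i f. f (ev i)) ` {..<p}"
  have "linf_on N \<phi>" if "\<phi> \<in> ?F" for \<phi> using that by (auto simp: linf_on_def)
  then have "lin_subspace {f\<in>N. \<forall>\<phi>\<in>?F. \<phi> f = 0} \<and> infinite_dim {f\<in>N. \<forall>\<phi>\<in>?F. \<phi> f = 0}"
    using infinite_dim_kernels[OF N'(1) N(2), of ?F] by blast
  moreover have "{f\<in>N. \<forall>\<phi>\<in>?F. \<phi> f = 0} = E" by (auto simp: E_def)
  ultimately have E: "lin_subspace E" "infinite_dim E" by simp_all
  have EN: "E \<subseteq> N" by (auto simp: E_def)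
  have ED: "E \<subseteq> JT_dual" using EN N' by blast
  have E_le: "d * dual_norm f \<le> sqrt (branch_ip f f)" if "f \<in> E" for f
    using that le[of f] by (simp add: E_def)
  have step: "\<exists>f\<in>E. branch_ip f f = 1 \<and> (\<forall>g\<in>F. branch_ip f g = 0)" if F: "finite F" "F \<subseteq> E" for F
  proof -
    let ?K = "(\<lambda>g f. branch_ip f g) ` F"
    have "linf_on E \<phi>" if "\<phi> \<in> ?K" for \<phi>
      using that F(2) ED linf_on_subset[OF branch_ip_linf ED] by blast
    then have "infinite_dim {f\<in>E. \<forall>\<phi>\<in>?K. \<phi> f = 0}"
      using infinite_dim_kernels[OF E, of ?K] F(1) by blast
    then obtain f where f: "f \<in> E" "\<forall>\<phi>\<in>?K. \<phi> f = 0" "f \<noteq> (\<lambda>x. 0)" using infinite_dim_nonzero by blast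
    have fD: "f \<in> JT_dual" using f ED by blast
    have "0 < dual_norm f" using Dual.N_eq_0D[OF fD] f(3) dual_norm_nonneg[OF fD] by fastforce
    then have "0 < sqrt (branch_ip f f)" using E_le[OF f(1)] d by (meson less_le_trans mult_pos_pos)
    then have pos: "0 < branch_ip f f" by simp
    define s where "s = inverse (sqrt (branch_ip f f))"
    let ?h = "\<lambda>x. s * f x"
    have h: "?h \<in> E" by (rule lin_subspace_scale[OF E(1) f(1)])
    have hD: "?h \<in> JT_dual" using h ED by blast
    have "branch_ip ?h ?h = s * branch_ip f ?h" by (rule linf_on_scale[OF branch_ip_linf[OF hD] fD])
    also have "branch_ip f ?h = s * branch_ip f f"
      unfolding branch_ip_sym[of f ?h] by (rule linf_on_scale[OF branch_ip_linf[OF fD] fD])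
    also have "s * (s * branch_ip f f) = 1"
      using pos by (simp add: s_def field_simps)
    finally have "branch_ip ?h ?h = 1" .
    moreover have "branch_ip ?h g = 0" if "g \<in> F" for g
    proof -
      have "branch_ip ?h g = s * branch_ip f g"
        using that F(2) ED by (intro linf_on_scale[OF branch_ip_linf fD]) blast
      then show ?thesis using f(2) that by simp
    qed
    ultimately show ?thesis using h by blast
  qed
  \<comment> \<open>The state is the finite set of earlier functionals with the newest one kept
    apart, so that its orthogonality to all of them can be carried along.\<close>
  obtain h where h:
    "\<And>n. finite (fst (h n)) \<and> fst (h n) \<subseteq> E \<and> snd (h n) \<in> E \<and> branch_ip (snd (h n)) (snd (h n)) = 1 \<and>
      (\<forall>g\<in>fst (h n). branch_ip (snd (h n)) g = 0)"
    "\<And>n. fst (h (Suc n)) = insert (snd (h n)) (fst (h n))"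
  proof (rule exE[OF dependent_nat_choice[of
      "\<lambda>n a. finite (fst a) \<and> fst a \<subseteq> E \<and> snd a \<in> E \<and> branch_ip (snd a) (snd a) = 1 \<and> (\<forall>g\<in>fst a. branch_ip (snd a) g = 0)"
      "\<lambda>n a b. fst b = insert (snd a) (fst a)"]])
    obtain f where "f \<in> E" "branch_ip f f = 1" using step[of "{}"] by blast
    then show "\<exists>a. finite (fst a) \<and> fst a \<subseteq> E \<and> snd a \<in> E \<and> branch_ip (snd a) (snd a) = 1 \<and> (\<forall>g\<in>fst a. branch_ip (snd a) g = 0)"
      by (intro exI[of _ "({}, f)"]) simp
    fix a n
    assume a: "finite (fst a) \<and> fst a \<subseteq> E \<and> snd a \<in> E \<and> branch_ip (snd a) (snd a) = 1 \<and> (\<forall>g\<in>fst a. branch_ip (snd a) g = 0)"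
    then obtain f where "f \<in> E" "branch_ip f f = 1" "\<forall>g\<in>insert (snd a) (fst a). branch_ip f g = 0"
      using step[of "insert (snd a) (fst a)"] by blast
    then show "\<exists>b. (finite (fst b) \<and> fst b \<subseteq> E \<and> snd b \<in> E \<and> branch_ip (snd b) (snd b) = 1 \<and> (\<forall>g\<in>fst b. branch_ip (snd b) g = 0)) \<and>
        fst b = insert (snd a) (fst a)"
      using a by (intro exI[of _ "(insert (snd a) (fst a), f)"]) simp
  qed blast
  define f where "f n = snd (h n)" for n
  have fE: "f n \<in> E" for n using h(1) by (simp add: f_def)
  have fD: "f n \<in> JT_dual" for n using fE ED by blast
  have later: "f j \<in> fst (h n)" if "j < n" for j n
    using that
  proof (induction n)
    case (Suc n)
    then show ?case using h(2)[of n] by (cases "j = n") (auto simp: f_def)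
  qed simp
  have ort: "branch_ip (f n) (f j) = (if n = j then 1 else 0)" for n j
  proof (cases n j rule: linorder_cases)
    case less
    then have "branch_ip (f j) (f n) = 0" using h(1)[of j] later[OF less] by (simp add: f_def)
    then show ?thesis using less branch_ip_sym[of "f n" "f j"] by simp
  next
    case greater
    then show ?thesis using h(1)[of n] later[OF greater] by (simp add: f_def)
  qed (use h(1) in \<open>simp add: f_def\<close>)
  have comb: "(\<lambda>x. \<Sum>k<n. c k * f k x) \<in> E" for n c using fE by (intro lin_subspace_sum[OF E(1)]) auto
  have ip_comb: "branch_ip (\<lambda>x. \<Sum>k<n. c k * f k x) g = (\<Sum>k<n. c k * branch_ip (f k) g)"
    if "g \<in> JT_dual" for n c g
    using fD by (intro linf_on_sum[OF JT_dual_subspace branch_ip_linf[OF that]]) auto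
  have ip_comb_self: "branch_ip (\<lambda>x. \<Sum>k<n. c k * f k x) (\<lambda>x. \<Sum>k<n. c k * f k x) = (\<Sum>k<n. (c k)\<^sup>2)" for n c
  proof -
    let ?u = "\<lambda>x. \<Sum>k<n. c k * f k x"
    have "branch_ip (f k) ?u = c k" if "k < n" for k
    proof -
      have "branch_ip (f k) ?u = (\<Sum>j<n. c j * branch_ip (f j) (f k))"
        unfolding branch_ip_sym[of "f k" ?u] by (rule ip_comb[OF fD])
      also have "\<dots> = (\<Sum>j<n. if j = k then c j else 0)" by (intro sum.cong) (auto simp: ort)
      also have "\<dots> = c k" using that by simp
      finally show ?thesis .
    qed
    then have "(\<Sum>k<n. c k * branch_ip (f k) ?u) = (\<Sum>k<n. (c k)\<^sup>2)"
      by (intro sum.cong) (auto simp: power2_eq_square)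
    then show ?thesis using ip_comb[of ?u c n] comb[of c n] ED by auto
  qed
  show ?thesis
  proof (rule Dual.l2_complemented[OF N(1), of f "1 / d" "\<lambda>k g. branch_ip g (f k)" 1])
    show "f k \<in> N" for k using fE EN by blast
    show "linf_on JT_dual (\<lambda>g. branch_ip g (f k))" for k by (rule branch_ip_linf[OF fD])
    show "branch_ip (f j) (f k) = (if j = k then 1 else 0)" for k j by (rule ort)
    show "upper2 dual_norm f (1 / d)"
      unfolding upper2_def
    proof (intro conjI allI)
      fix n c
      show "dual_norm (\<lambda>t. \<Sum>k<n. c k * f k t) \<le> 1 / d * sqrt (\<Sum>k<n. (c k)\<^sup>2)"
        using E_le[OF comb[of c n]] d by (simp add: ip_comb_self field_simps)
    qed (use d in simp)
    fix g and n :: nat assume g: "g \<in> JT_dual"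
    define c where "c k = branch_ip g (f k)" for k
    let ?u = "\<lambda>x. \<Sum>k<n. c k * f k x"
    have u: "?u \<in> JT_dual" using comb ED by blast
    have gu: "branch_ip ?u g = (\<Sum>k<n. (c k)\<^sup>2)"
      using ip_comb[OF g, of c n] by (simp add: c_def branch_ip_sym[of _ g] power2_eq_square)
    have diff: "(\<lambda>x. g x - ?u x) \<in> JT_dual" by (rule lin_subspace_diff[OF JT_dual_subspace g u])
    \<comment> \<open>Bessel's inequality from nonnegativity of \<open>branch_ip\<close> at
      \<open>g\<close> minus its orthogonal projection \<open>?u\<close>.\<close>
    have "0 \<le> branch_ip (\<lambda>x. g x - ?u x) (\<lambda>x. g x - ?u x)" by (rule branch_ip_self(1)[OF diff])
    also have "\<dots> = branch_ip g (\<lambda>x. g x - ?u x) - branch_ip ?u (\<lambda>x. g x - ?u x)"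
      by (rule linf_on_diff[OF JT_dual_subspace branch_ip_linf[OF diff] g u])
    also have "branch_ip g (\<lambda>x. g x - ?u x) = branch_ip g g - branch_ip ?u g"
      unfolding branch_ip_sym[of g "\<lambda>x. g x - ?u x"]
      by (rule linf_on_diff[OF JT_dual_subspace branch_ip_linf[OF g] g u])
    also have "branch_ip ?u (\<lambda>x. g x - ?u x) = branch_ip g ?u - branch_ip ?u ?u"
      unfolding branch_ip_sym[of ?u "\<lambda>x. g x - ?u x"]
      by (rule linf_on_diff[OF JT_dual_subspace branch_ip_linf[OF u] g u])
    finally have "(\<Sum>k<n. (c k)\<^sup>2) \<le> branch_ip g g"
      using gu ip_comb_self[of c n] branch_ip_sym[of g ?u] by simp
    also have "\<dots> \<le> (dual_norm g)\<^sup>2" by (rule branch_ip_self(2)[OF g])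
    finally show "(\<Sum>k<n. (branch_ip g (f k))\<^sup>2) \<le> (1 * dual_norm g)\<^sup>2" by (simp add: c_def)
  qed simp
qed

text \<open>The upper estimate dual to the lower one in \<open>JT\<close>: Cauchy-Schwarz together
  with \<open>sum_norm_rst_le\<close> for the restrictions of one vector. The case distinction in
  \<open>h\<close> is the normalisation of \<open>JT_dual\<close>.\<close>

lemma block_functionals_upper2:
  assumes p: "strict_mono p" and a: "strict_mono a" and f: "\<And>k. f k \<in> JT_dual" "\<And>k. dual_norm (f k) \<le> 1"
  defines "h \<equiv> \<lambda>k x. if x \<in> JT then f k (rst {p (a k)..<p (Suc (a k))} x) else 0"
  shows "h k \<in> JT_dual" "upper2 dual_norm h 1"
proof -
  let ?I = "\<lambda>k. {p (a k)..<p (Suc (a k))}"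
  have hx: "h k x = f k (rst (?I k) x)" if "x \<in> JT" for k x using that by (simp add: h_def)
  have h_le: "\<bar>h k x\<bar> \<le> jt_norm (rst (?I k) x)" if "x \<in> JT" for k x
  proof -
    have J: "rst (?I k) x \<in> JT" by (rule JT_rst(1)[OF that]) simp
    have "\<bar>h k x\<bar> \<le> dual_norm (f k) * jt_norm (rst (?I k) x)" unfolding hx[OF that] by (rule JT_dual_le[OF f(1) J])
    also have "\<dots> \<le> 1 * jt_norm (rst (?I k) x)" by (intro mult_right_mono f(2) jt_norm_nonneg J)
    finally show ?thesis by simp
  qed
  have hD: "h k \<in> JT_dual" for k
  proof (rule JT_dualI[where C = 1])
    show "\<bar>h k x\<bar> \<le> 1 * jt_norm x" if "x \<in> JT" for x
      using h_le[OF that, of k] JT_rst(2)[OF that, of "?I k"] by simp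
    show "linf_on JT (h k)"
      unfolding linf_on_def
    proof (intro conjI ballI allI)
      fix x y assume xy: "x \<in> JT" "y \<in> JT"
      have eq: "rst (?I k) (\<lambda>t. x t + y t) = (\<lambda>t. rst (?I k) x t + rst (?I k) y t)" by (auto simp: rst_def)
      show "h k (\<lambda>t. x t + y t) = h k x + h k y"
        unfolding hx[OF xy(1)] hx[OF xy(2)] hx[OF JT_add(1)[OF xy]] eq
        by (rule linf_on_add[OF JT_dual_linf[OF f(1)]]) (simp_all add: JT_rst xy)
    next
      fix x c assume x: "x \<in> JT"
      have eq: "rst (?I k) (\<lambda>t. c * x t) = (\<lambda>t. c * rst (?I k) x t)" by (auto simp: rst_def)
      show "h k (\<lambda>t. c * x t) = c * h k x"
        unfolding hx[OF x] hx[OF JT_scale_le(1)[OF x]] eq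
        by (rule linf_on_scale[OF JT_dual_linf[OF f(1)]]) (simp_all add: JT_rst x)
    qed
  qed (simp add: h_def)
  then show "h k \<in> JT_dual" .
  show "upper2 dual_norm h 1"
    unfolding upper2_def
  proof (intro conjI allI)
    fix n and c :: "nat \<Rightarrow> real"
    show "dual_norm (\<lambda>x. \<Sum>k<n. c k * h k x) \<le> 1 * sqrt (\<Sum>k<n. (c k)\<^sup>2)"
    proof (rule dual_norm_le)
      fix x assume x: "x \<in> JT"
      let ?s = "\<Sum>k<n. (c k)\<^sup>2"
      have "(\<Sum>k<n. c k * h k x)\<^sup>2 \<le> ?s * (\<Sum>k<n. (h k x)\<^sup>2)"
        by (rule Cauchy_Schwarz_ineq_sum)
      also have "\<dots> \<le> ?s * (\<Sum>k<n. (jt_norm (rst (?I k) x))\<^sup>2)"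
      proof (intro mult_left_mono sum_mono)
        fix k show "(h k x)\<^sup>2 \<le> (jt_norm (rst (?I k) x))\<^sup>2"
          using h_le[OF x, of k] abs_le_square_iff[of "h k x" "jt_norm (rst (?I k) x)"] by simp
      qed (simp add: sum_nonneg)
      also have "\<dots> \<le> ?s * (jt_norm x)\<^sup>2"
      proof (intro mult_left_mono sum_norm_rst_le[OF x])
        show "disjoint_family_on ?I {..<n}" by (rule block_intervals_disjoint[OF p a])
      qed (simp_all add: sum_nonneg)
      also have "\<dots> = (sqrt ?s * jt_norm x)\<^sup>2" by (simp add: power_mult_distrib sum_nonneg)
      finally have "\<bar>\<Sum>k<n. c k * h k x\<bar> \<le> \<bar>sqrt ?s * jt_norm x\<bar>" by (simp only: abs_le_square_iff)
      then show "\<bar>\<Sum>k<n. c k * h k x\<bar> \<le> 1 * sqrt ?s * jt_norm x"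
        using jt_norm_nonneg[OF x] by (simp add: abs_mult sum_nonneg)
    qed (simp add: sum_nonneg)
  qed simp
qed

text \<open>By \<open>functional_tail\<close> a functional with small \<open>branch_ip\<close> is
  small on vectors far out; if it also vanishes at the early unit vectors, it is close to a block
  functional. Here the \<open>f (a k)\<close> are the basis of the copy of l2, and evaluations at
  block vectors \<open>w k\<close> are the coefficient functionals.\<close>

lemma dual_subspace_block:
  assumes N: "closed_subspace_in JT_dual dual_norm N"
    and small: "\<And>d p. 0 < d \<Longrightarrow> \<exists>f\<in>N. (\<forall>i<p. f (ev i) = 0) \<and> sqrt (branch_ip f f) < d * dual_norm f"
  shows "\<exists>Y. Y \<subseteq> N \<and> closed_subspace_in JT_dual dual_norm Y \<and>
    isomorphic_to_l2 dual_norm Y \<and> complemented_in JT_dual dual_norm Y"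
proof -
  have N': "lin_subspace N" "N \<subseteq> JT_dual" using N by (auto simp: closed_subspace_in_def)
  define good where "good n f p q \<longleftrightarrow> f \<in> N \<and> dual_norm f = 1 \<and> (\<forall>i<p. f (ev i) = 0) \<and> p < q \<and>
    (\<forall>x\<in>JT. (\<forall>t<q. x t = 0) \<longrightarrow> \<bar>f x\<bar> \<le> 1/8 * (1/2) ^ n * jt_norm x)" for n f p and q :: nat
  have step: "\<exists>f q. good n f p q" for n p
  proof -
    \<comment> \<open>Half of the tail bound in \<open>good\<close>: \<open>small\<close> and
      \<open>functional_tail\<close> contribute \<open>?d\<close> each.\<close>
    let ?d = "1/16 * (1/2::real) ^ n"
    obtain g where g: "g \<in> N" "\<forall>i<p. g (ev i) = 0" "sqrt (branch_ip g g) < ?d * dual_norm g"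
      using small[of ?d p] by auto
    have gD: "g \<in> JT_dual" using g N' by blast
    have "0 \<le> sqrt (branch_ip g g)" using branch_ip_self(1)[OF gD] by simp
    then have ng: "0 < dual_norm g" using g(3) dual_norm_nonneg[OF gD] by (cases "dual_norm g = 0") auto
    define s where "s = inverse (dual_norm g)"
    have s: "0 < s" using ng by (simp add: s_def)
    obtain q where q: "\<forall>x\<in>JT. (\<forall>t<q. x t = 0) \<longrightarrow> \<bar>g x\<bar> \<le> (sqrt (branch_ip g g) + ?d * dual_norm g) * jt_norm x"
      using functional_tail[OF gD, of "?d * dual_norm g"] ng by auto
    define f where "f = (\<lambda>x. s * g x)"
    have "\<bar>f x\<bar> \<le> 1/8 * (1/2) ^ n * jt_norm x" if x: "x \<in> JT" "\<forall>t<max q (Suc p). x t = 0" for x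
    proof -
      have "\<bar>g x\<bar> \<le> (sqrt (branch_ip g g) + ?d * dual_norm g) * jt_norm x" using q x by simp
      also have "\<dots> \<le> (2 * ?d * dual_norm g) * jt_norm x"
      proof (rule mult_right_mono)
        show "sqrt (branch_ip g g) + ?d * dual_norm g \<le> 2 * ?d * dual_norm g" using g(3) by linarith
      qed (rule jt_norm_nonneg[OF x(1)])
      finally have "s * \<bar>g x\<bar> \<le> s * ((2 * ?d * dual_norm g) * jt_norm x)"
        using s by (intro mult_left_mono) auto
      also have "\<dots> = (s * dual_norm g) * (1/8 * (1/2) ^ n * jt_norm x)" by simp
      finally show ?thesis using s ng by (simp add: f_def abs_mult s_def)
    qed
    moreover have "f \<in> N" unfolding f_def by (rule lin_subspace_scale[OF N'(1) g(1)])
    moreover have "dual_norm f = 1" unfolding f_def JT_dual_scale[OF gD] using ng by (simp add: s_def)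
    moreover have "\<forall>i<p. f (ev i) = 0" using g(2) by (simp add: f_def)
    ultimately have "good n f p (max q (Suc p))" unfolding good_def by simp
    then show ?thesis by blast
  qed
  obtain h :: "nat \<Rightarrow> ((nat \<Rightarrow> real) \<Rightarrow> real) \<times> nat \<times> nat" where h:
    "\<And>n. good n (fst (h n)) (fst (snd (h n))) (snd (snd (h n)))"
    "\<And>n. fst (snd (h (Suc n))) = snd (snd (h n))"
  proof (rule exE[OF dependent_nat_choice[of "\<lambda>n a. good n (fst a) (fst (snd a)) (snd (snd a))"
      "\<lambda>n a b. fst (snd b) = snd (snd a)"]])
    obtain f q where "good 0 f 0 q" using step by blast
    then show "\<exists>a. good 0 (fst a) (fst (snd a)) (snd (snd a))" by (intro exI[of _ "(f, 0, q)"]) simp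
    fix a :: "((nat \<Rightarrow> real) \<Rightarrow> real) \<times> nat \<times> nat" and n
    obtain f q where "good (Suc n) f (snd (snd a)) q" using step by blast
    then show "\<exists>b. good (Suc n) (fst b) (fst (snd b)) (snd (snd b)) \<and> fst (snd b) = snd (snd a)"
      by (intro exI[of _ "(f, snd (snd a), q)"]) simp
  qed blast
  define f where "f n = fst (h n)" for n
  define p where "p n = fst (snd (h n))" for n
  have gd: "good n (f n) (p n) (p (Suc n))" for n using h(1)[of n] h(2)[of n] by (simp add: f_def p_def)
  have fN: "f n \<in> N" and f1: "dual_norm (f n) = 1" and f0: "\<And>i. i < p n \<Longrightarrow> f n (ev i) = 0"
    and pS: "p n < p (Suc n)" for n using gd[of n] by (auto simp: good_def)
  have f_tail: "\<bar>f n x\<bar> \<le> 1/8 * (1/2) ^ n * jt_norm x" if "x \<in> JT" "\<And>t. t < p (Suc n) \<Longrightarrow> x t = 0" for n x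
    using gd[of n] that by (auto simp: good_def)
  have fD: "f n \<in> JT_dual" for n using fN N' by blast
  have p: "strict_mono p" using pS by (rule strict_monoI_Suc)
  let ?I = "\<lambda>n. {p n..<p (Suc n)}"
  have split: "f n x - f n (rst (?I n) x) = f n (rst {p (Suc n)..} x)" if x: "x \<in> JT" for n x
  proof -
    have J: "rst (?I n) x \<in> JT" "rst {p (Suc n)..} x \<in> JT" "rst {..<p n} x \<in> JT" by (simp_all add: JT_rst x)
    have eq: "(\<lambda>t. x t - rst (?I n) x t) = (\<lambda>t. rst {p (Suc n)..} x t + rst {..<p n} x t)"
      using pS[of n] by (auto simp: rst_def)
    have "f n x - f n (rst (?I n) x) = f n (\<lambda>t. x t - rst (?I n) x t)"
      by (rule linf_on_diff[OF JT_subspace JT_dual_linf[OF fD] x J(1), symmetric])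
    also have "\<dots> = f n (rst {p (Suc n)..} x) + f n (rst {..<p n} x)"
      unfolding eq by (rule linf_on_add[OF JT_dual_linf[OF fD] J(2,3)])
    also have "f n (rst {..<p n} x) = 0"
      by (rule JT_dual_vanish[OF fD f0]) (auto simp: rst_def)
    finally show ?thesis by simp
  qed
  have split_le: "\<bar>f n x - f n (rst (?I n) x)\<bar> \<le> 1/8 * (1/2) ^ n * jt_norm x" if x: "x \<in> JT" for n x
  proof -
    have J: "rst {p (Suc n)..} x \<in> JT" "jt_norm (rst {p (Suc n)..} x) \<le> jt_norm x" by (simp_all add: JT_rst x)
    have "\<bar>f n (rst {p (Suc n)..} x)\<bar> \<le> 1/8 * (1/2) ^ n * jt_norm (rst {p (Suc n)..} x)"
      by (rule f_tail[OF J(1)]) (simp add: rst_def)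
    also have "\<dots> \<le> 1/8 * (1/2) ^ n * jt_norm x" using J(2) by (intro mult_left_mono) auto
    finally show ?thesis using split[OF x] by simp
  qed
  have pw: "1/8 * (1/2::real) ^ n \<le> 1/8" for n by (simp add: power_le_one)
  \<comment> \<open>An almost norming vector is cut down to the block. Of a value above
    \<open>3/4 * jt_norm x\<close> at most \<open>1/8 * jt_norm x\<close> is lost, so more than half
    the norm remains, and normalising the value to 1 gives norm at most 2.\<close>
  have "\<exists>x. x \<in> JT \<and> jt_norm x \<le> 2 \<and> (\<forall>t. x t \<noteq> 0 \<longrightarrow> p n \<le> t \<and> t < p (Suc n)) \<and> f n x = 1" for n
  proof -
    have "\<exists>x\<in>JT. 3/4 * jt_norm x < \<bar>f n x\<bar>"
    proof (rule ccontr)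
      assume "\<not> ?thesis"
      then have "dual_norm (f n) \<le> 3/4" by (intro dual_norm_le) (auto simp: not_less)
      then show False using f1[of n] by simp
    qed
    then obtain x where x: "x \<in> JT" "3/4 * jt_norm x < \<bar>f n x\<bar>" by blast
    let ?y = "rst (?I n) x"
    have y: "?y \<in> JT" "jt_norm ?y \<le> jt_norm x" by (simp_all add: JT_rst x)
    have "1/8 * (1/2) ^ n * jt_norm x \<le> 1/8 * jt_norm x"
      by (intro mult_right_mono pw jt_norm_nonneg x)
    then have fy: "1/2 * jt_norm x < \<bar>f n ?y\<bar>" using split_le[OF x(1), of n] x(2) jt_norm_nonneg[OF x(1)] by linarith
    then have fy0: "f n ?y \<noteq> 0" using jt_norm_nonneg[OF x(1)] by auto
    define s where "s = inverse (f n ?y)"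
    have "jt_norm (\<lambda>t. s * ?y t) \<le> 2"
    proof -
      have "jt_norm (\<lambda>t. s * ?y t) = jt_norm ?y / \<bar>f n ?y\<bar>"
        unfolding JT_scale[OF y(1)] s_def by (simp add: field_simps)
      also have "\<dots> \<le> 2" using fy fy0 y(2) by (simp add: pos_divide_le_eq)
      finally show ?thesis .
    qed
    moreover have "f n (\<lambda>t. s * ?y t) = 1"
      using linf_on_scale[OF JT_dual_linf[OF fD] y(1), of n s] fy0 by (simp add: s_def)
    moreover have "\<forall>t. s * ?y t \<noteq> 0 \<longrightarrow> p n \<le> t \<and> t < p (Suc n)" by (simp add: rst_def)
    ultimately show ?thesis using JT_scale_le(1)[OF y(1), of s] by blast
  qed
  then obtain x where x: "\<And>n. x n \<in> JT" "\<And>n. jt_norm (x n) \<le> 2"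
    "\<And>n t. x n t \<noteq> 0 \<Longrightarrow> p n \<le> t \<and> t < p (Suc n)" "\<And>n. f n (x n) = 1" by metis
  have B: "blocks p x 2" unfolding blocks_def using p x by blast
  obtain a b C where ab: "strict_mono a" "\<And>k. a k < b k" "\<And>k. b k < a (Suc k)"
    and up: "upper2 jt_norm (\<lambda>k t. x (a k) t - x (b k) t) C"
    using blocks_diff_upper2[OF B] by blast
  define y where "y k = (\<lambda>t. x (a k) t - x (b k) t)" for k
  have yJ: "y k \<in> JT" for k unfolding y_def by (intro lin_subspace_diff[OF JT_subspace] x)
  have pm: "p m \<le> p n" if "m \<le> n" for m n using strict_mono_less_eq[OF p] that by simp
  \<comment> \<open>\<open>x (b k)\<close> lies beyond the block of \<open>f (a k)\<close>, where
    that functional is at most 1/8 of the norm; as the norm is at most 2, this costs at most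
    1/4.\<close>
  have fy: "3/4 \<le> f (a k) (y k)" for k
  proof -
    have "f (a k) (y k) = 1 - f (a k) (x (b k))"
      unfolding y_def using linf_on_diff[OF JT_subspace JT_dual_linf[OF fD] x(1) x(1)] x(4) by simp
    moreover have "\<bar>f (a k) (x (b k))\<bar> \<le> 1/8 * (1/2) ^ a k * jt_norm (x (b k))"
    proof (rule f_tail[OF x(1)])
      fix t assume "t < p (Suc (a k))"
      then have "\<not> p (b k) \<le> t" using pm[of "Suc (a k)" "b k"] ab(2)[of k] by simp
      then show "x (b k) t = 0" using x(3) by blast
    qed
    moreover have "1/8 * (1/2) ^ a k * jt_norm (x (b k)) \<le> 1/8 * 2"
      by (intro mult_mono pw x jt_norm_nonneg) auto
    ultimately show ?thesis by linarith
  qed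
  \<comment> \<open>Rescaling restores the exact value 1 on the diagonal, at a factor of at most
    4/3.\<close>
  define s where "s k = inverse (f (a k) (y k))" for k
  have s: "\<bar>s k\<bar> \<le> 2" "s k * f (a k) (y k) = 1" for k
  proof -
    show "s k * f (a k) (y k) = 1" using fy[of k] by (simp add: s_def)
    have "inverse (f (a k) (y k)) \<le> inverse (3/4)" using fy[of k] by (intro le_imp_inverse_le) auto
    then show "\<bar>s k\<bar> \<le> 2" using fy[of k] by (simp add: s_def)
  qed
  define w where "w k = (\<lambda>t. s k * y k t)" for k
  have wJ: "w k \<in> JT" for k unfolding w_def by (rule JT_scale_le(1)[OF yJ])
  have up_w: "upper2 jt_norm w (C * 2)"
    unfolding w_def y_def using upper2_scale[OF up s(1)] by simp
  define hh where "hh k = (\<lambda>x. if x \<in> JT then f (a k) (rst (?I (a k)) x) else 0)" for k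
  have hh: "hh k \<in> JT_dual" "upper2 dual_norm hh 1" for k
    unfolding hh_def using block_functionals_upper2[OF p ab(1), of "\<lambda>k. f (a k)"] fD f1 by simp_all
  show ?thesis
  proof (rule Dual.l2_complemented_above[OF N, of "\<lambda>k. f (a k)" "1 + 2 * 1" "\<lambda>k g. g (w k)" "C * 2"])
    show "f (a k) \<in> N" for k by (rule fN)
    show "linf_on JT_dual (\<lambda>g. g (w k))" for k by (simp add: linf_on_def)
    show "0 \<le> C * 2" using up by (simp add: upper2_def)
    show "(\<Sum>k<n. (g (w k))\<^sup>2) \<le> (C * 2 * dual_norm g)\<^sup>2" if "g \<in> JT_dual" for g n
      by (rule dual_bessel[OF up_w wJ that])
    show "f (a k) (w k) = 1" for k
      unfolding w_def using linf_on_scale[OF JT_dual_linf[OF fD] yJ] s(2) by simp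
    \<comment> \<open>Exact vanishing in this direction holds because \<open>f (a j)\<close> is 0 at
      the unit vectors before \<open>p (a j)\<close>, and \<open>b k < a (Suc k)\<close> puts the
      whole support of \<open>w k\<close> there.\<close>
    show "f (a j) (w k) = 0" if kj: "k < j" for k j
    proof (rule JT_dual_vanish[OF fD f0])
      fix t assume t: "p (a j) \<le> t"
      have "b k < a j" using ab(3)[of k] strict_mono_less_eq[OF ab(1), of "Suc k" j] kj by simp
      then have "p (Suc (a k)) \<le> p (a j)" "p (Suc (b k)) \<le> p (a j)" using ab(2)[of k] by (auto intro!: pm)
      then have "x (a k) t = 0" "x (b k) t = 0" using x(3)[of "a k" t] x(3)[of "b k" t] t by fastforce+
      then show "w k t = 0" by (simp add: w_def y_def)
    qed
    show "upper2 dual_norm (\<lambda>k. f (a k)) (1 + 2 * 1)"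
    proof (rule Dual.upper2_perturb[OF hh(2) hh(1) fD])
      fix k
      show "dual_norm (\<lambda>x. f (a k) x - hh k x) \<le> 1 * (1/2) ^ k"
      proof (rule dual_norm_le)
        fix u assume u: "u \<in> JT"
        have "\<bar>f (a k) u - hh k u\<bar> \<le> 1/8 * (1/2) ^ a k * jt_norm u" using split_le[OF u] u by (simp add: hh_def)
        also have "\<dots> \<le> 1 * (1/2) ^ k * jt_norm u"
          using strict_mono_imp_increasing[OF ab(1), of k]
          by (intro mult_right_mono mult_mono power_decreasing jt_norm_nonneg[OF u]) auto
        finally show "\<bar>f (a k) u - hh k u\<bar> \<le> 1 * (1/2) ^ k * jt_norm u" .
      qed simp
    qed simp
  qed
qed

text \<open>Finite codimension is expressed by vanishing at \<open>ev i\<close> for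
  \<open>i < p\<close>, so the negated alternative hands over, for all \<open>d\<close> and
  \<open>p\<close>, functionals that already vanish early, ready for the gliding hump.\<close>

theorem JT_dual_complemented_l2:
  assumes N: "closed_subspace_in JT_dual dual_norm N" "infinite_dim N"
  shows "\<exists>Y. Y \<subseteq> N \<and> closed_subspace_in JT_dual dual_norm Y \<and>
    isomorphic_to_l2 dual_norm Y \<and> complemented_in JT_dual dual_norm Y"
proof (cases "\<exists>d p. 0 < d \<and> (\<forall>f\<in>N. (\<forall>i<p. f (ev i) = 0) \<longrightarrow> d * dual_norm f \<le> sqrt (branch_ip f f))")
  case True
  then obtain d p where "0 < d" "\<forall>f\<in>N. (\<forall>i<p. f (ev i) = 0) \<longrightarrow> d * dual_norm f \<le> sqrt (branch_ip f f)"
    by blast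
  then show ?thesis by (intro dual_subspace_hilbertian[OF N, of d p]) auto
next
  case False
  then have "\<exists>f\<in>N. (\<forall>i<p. f (ev i) = 0) \<and> sqrt (branch_ip f f) < d * dual_norm f" if "0 < d" for d p
    using that by (meson not_le)
  then show ?thesis by (rule dual_subspace_block[OF N(1)])
qed

theorem mainTheorem1:
  shows "(\<forall>M. closed_subspace_in JT jt_norm M \<and> infinite_dim M \<longrightarrow>
            (\<exists>Y. Y \<subseteq> M \<and> closed_subspace_in JT jt_norm Y \<and>
                 isomorphic_to_l2 jt_norm Y \<and> complemented_in JT jt_norm Y)) \<and>
         (\<forall>N. closed_subspace_in JT_dual dual_norm N \<and> infinite_dim N \<longrightarrow>
            (\<exists>Y. Y \<subseteq> N \<and> closed_subspace_in JT_dual dual_norm Y \<and>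
                 isomorphic_to_l2 dual_norm Y \<and> complemented_in JT_dual dual_norm Y))"
  using JT_complemented_l2 JT_dual_complemented_l2 by blast

end
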